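(* Let $(W,S)$ be a Coxeter system. The union of the (closed) chambers $C_w$ over all $w\in W$ with $w^{-1}\in L_0$ is a convex set, i.e. it is an intersection of closed half-spaces bounded by reflecting hyperplanes $H_\alpha$, $\alpha\in\Phi^+$.
   Context: Let $(W,S)$ be a Coxeter system with length function $\ell$. Fix a geometric representation: $W$ acts faithfully on a real vector space $V$ preserving a symmetric bilinear form $B$, each $s\in S$ acting as the $B$-reflection in a simple root $\alpha_s$ with $B(\alpha_s,\alpha_s)=1$; $\Delta=\{\alpha_s\}$, $\Phi=W(\Delta)$, $\Phi^+=\Phi\cap\operatorname{cone}(\Delta)$, $\Phi^-=-\Phi^+$, $\Phi=\Phi^+\sqcup\Phi^-$. For $\beta\in\Phi$, $s_\beta$ is the corresponding reflection. Inversion set: $\Phi(w)=\Phi^+\cap w(\Phi^-)$; short inversions: $\Phi^1(w)=\{\beta\in\Phi^+\mid\ell(s_\beta w)=\ell(w)-1\}$. Dominance order on $\Phi^+$: $\alpha\preceq_{\operatorname{dom}}\beta$ iff for every $w\in W$, $\beta\in\Phi(w)\Rightarrow\alpha\in\Phi(w)$. $\operatorname{dp}_\infty(\beta)=|\{\alpha\in\Phi^+\setminus\{\beta\}\mid\alpha\preceq_{\operatorname{dom}}\beta\}|$. Small roots: $\Sigma_0=\{\beta\in\Phi^+\mid\operatorname{dp}_\infty(\beta)=0\}$. Low elements: $L_0=\{w\in W\mid\Phi^1(w)\subseteq\Sigma_0\}$. Geometric setting: $W$ acts on its Tits cone $\mathcal U$ (in the dual of $V$), with closed fundamental chamber $C=C_e$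 and chambers $C_w=wC$. For $\alpha\in\Phi$, the closed half-space $H_\alpha^+$ is the union of the chambers $C_w$ with $w^{-1}(\alpha)\in\Phi^+$ (in the Tits cone, $\{f\in\mathcal U\mid f(\alpha)\ge0\}$), $H_\alpha^-=H_{-\alpha}^+$, and $H_\alpha=H_\alpha^+\cap H_\alpha^-$. A subset of $\mathcal U$ is called convex if it is of the form $\bigcap_{\alpha\in\Gamma}H_\alpha^{\epsilon_\alpha}$ for some $\Gamma\subseteq\Phi$ and signs $\epsilon_\alpha\in\{+,-\}$. *)

theory Defs
  imports
    "HOL-Algebra.Group_Action"
    "HOL-Algebra.Generated_Groups"
    "HOL-Algebra.Multiplicative_Group"
    "HOL-Analysis.Analysis"
    "HOL-Library.Extended_Nat"
begin

section \<open>Coxeter systems\<close>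

definition word_prod :: "('g, 'm) monoid_scheme \<Rightarrow> 'g list \<Rightarrow> 'g" where
  "word_prod W ss = foldr (\<lambda>x y. x \<otimes>\<^bsub>W\<^esub> y) ss \<one>\<^bsub>W\<^esub>"

text \<open>
  The congruence on words over \<open>S\<close> generated by \<open>(s t)\<^sup>m = 1\<close> for \<open>s, t \<in> S\<close>, where \<open>m\<close> is the
  order of \<open>s t\<close> in \<open>W\<close>. The library's \<^const>\<open>group.ord\<close> is \<open>0\<close> for elements of infinite order, for
  which the relation is the trivial one. The case \<open>s = t\<close> is the relation \<open>s s = 1\<close>, so that
  this monoid congruence also presents a group.
\<close>
inductive coxeter_equiv :: "('g, 'm) monoid_scheme \<Rightarrow> 'g set \<Rightarrow> 'g list \<Rightarrow> 'g list \<Rightarrow> bool"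
  for W (structure) and S where
  refl: "coxeter_equiv W S u u"
| sym: "coxeter_equiv W S u v \<Longrightarrow> coxeter_equiv W S v u"
| trans: "coxeter_equiv W S u v \<Longrightarrow> coxeter_equiv W S v w \<Longrightarrow> coxeter_equiv W S u w"
| rel: "s \<in> S \<Longrightarrow> t \<in> S \<Longrightarrow>
    coxeter_equiv W S (u @ concat (replicate (group.ord W (s \<otimes> t)) [s, t]) @ v) (u @ v)"

locale coxeter_system = group W for W :: "('g, 'm) monoid_scheme" (structure) +
  fixes S :: "'g set"
  assumes S_subset: "S \<subseteq> carrier W"
    and S_order: "s \<in> S \<Longrightarrow> ord s = 2"
    and S_generates: "generate W S = carrier W"
    and presentation: "\<lbrakk>set ss \<subseteq> S; word_prod W ss = \<one>\<rbrakk> \<Longrightarrow> coxeter_equiv W S ss []"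

section \<open>Geometric representations\<close>

text \<open>
  \<open>\<rho> w\<close> is the action of \<open>w\<close> on the vector space \<open>'v\<close>, \<open>B\<close> the bilinear form and \<open>\<alpha> s\<close> the simple root
  of \<open>s\<close>. This locale carries the notation only; the axioms are in \<open>geometric_representation\<close>.
\<close>
locale geometric_data =
  fixes W :: "('g, 'm) monoid_scheme" (structure)
    and S :: "'g set"
    and \<rho> :: "'g \<Rightarrow> 'v::real_vector \<Rightarrow> 'v"
    and B :: "'v \<Rightarrow> 'v \<Rightarrow> real"
    and \<alpha> :: "'g \<Rightarrow> 'v"
begin

definition len :: "'g \<Rightarrow> nat" where
  "len w = (LEAST n. \<exists>ss. set ss \<subseteq> S \<and> length ss = n \<and> word_prod W ss = w)"

definition reflect :: "'v \<Rightarrow> 'v \<Rightarrow> 'v" where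
  "reflect \<beta> v = v - (2 * B v \<beta>) *\<^sub>R \<beta>"

definition roots :: "'v set" where
  "roots = {\<rho> w (\<alpha> s) | w s. w \<in> carrier W \<and> s \<in> S}"

definition pos_roots :: "'v set" where
  "pos_roots = roots \<inter> convex_cone hull (\<alpha> ` S)"

definition neg_roots :: "'v set" where
  "neg_roots = uminus ` pos_roots"

text \<open>The element \<open>s\<^sub>\<beta>\<close> of \<open>W\<close>; it is unique because the action is faithful.\<close>
definition root_refl :: "'v \<Rightarrow> 'g" where
  "root_refl \<beta> = (THE t. t \<in> carrier W \<and> \<rho> t = reflect \<beta>)"

definition inversions :: "'g \<Rightarrow> 'v set" where
  "inversions w = pos_roots \<inter> \<rho> w ` neg_roots"

definition short_inversions :: "'g \<Rightarrow> 'v set" where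
  "short_inversions w = {\<beta> \<in> pos_roots. len (root_refl \<beta> \<otimes> w) + 1 = len w}"

definition dom_le :: "'v \<Rightarrow> 'v \<Rightarrow> bool" where
  "dom_le \<gamma> \<beta> \<longleftrightarrow> (\<forall>w \<in> carrier W. \<beta> \<in> inversions w \<longrightarrow> \<gamma> \<in> inversions w)"

text \<open>Valued in \<^typ>\<open>enat\<close> since \<^const>\<open>card\<close> would make an infinite set count as depth \<open>0\<close>.\<close>
definition dp_inf :: "'v \<Rightarrow> enat" where
  "dp_inf \<beta> = (let D = {\<gamma> \<in> pos_roots - {\<beta>}. dom_le \<gamma> \<beta>} in if finite D then enat (card D) else \<infinity>)"

definition small_roots :: "'v set" where
  "small_roots = {\<beta> \<in> pos_roots. dp_inf \<beta> = 0}"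

definition low_elements :: "'g set" where
  "low_elements = {w \<in> carrier W. short_inversions w \<subseteq> small_roots}"

end

text \<open>
  The condition \<open>gram\<close> is the one on the simple roots of a based root system. The positive
  independence of the simple roots follows from \<open>roots_disjoint\<close>: if \<open>0\<close> were a nontrivial
  nonnegative combination of them, some simple root would lie in \<open>- cone \<Delta>\<close>.
\<close>
locale geometric_representation =
  geometric_data W S \<rho> B \<alpha> + coxeter_system W S + faithful_action W UNIV \<rho>
  for W :: "('g, 'm) monoid_scheme" (structure)
    and S :: "'g set"
    and \<rho> :: "'g \<Rightarrow> 'v::real_vector \<Rightarrow> 'v"
    and B :: "'v \<Rightarrow> 'v \<Rightarrow> real"
    and \<alpha> :: "'g \<Rightarrow> 'v" +
  assumes act_linear: "w \<in> carrier W \<Longrightarrow> linear (\<rho> w)"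
    and B_bilinear: "bilinear B"
    and B_sym: "B x y = B y x"
    and B_invariant: "w \<in> carrier W \<Longrightarrow> B (\<rho> w x) (\<rho> w y) = B x y"
    and simple_norm: "s \<in> S \<Longrightarrow> B (\<alpha> s) (\<alpha> s) = 1"
    and simple_refl: "s \<in> S \<Longrightarrow> \<rho> s = reflect (\<alpha> s)"
    and gram: "\<lbrakk>s \<in> S; t \<in> S; s \<noteq> t\<rbrakk> \<Longrightarrow>
      (if ord (s \<otimes> t) = 0 then B (\<alpha> s) (\<alpha> t) \<le> -1
       else B (\<alpha> s) (\<alpha> t) = - cos (pi / real (ord (s \<otimes> t))))"
    and roots_union: "roots = pos_roots \<union> neg_roots"
    and roots_disjoint: "pos_roots \<inter> neg_roots = {}"

section \<open>Chambers, half-spaces and convexity\<close>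

datatype sign = Plus | Minus

context geometric_data
begin

text \<open>The dual of \<open>'v\<close> is the set of linear functionals \<open>f\<close>, on which \<open>W\<close> acts contragrediently.\<close>
definition dual_act :: "'g \<Rightarrow> ('v \<Rightarrow> real) \<Rightarrow> ('v \<Rightarrow> real)" where
  "dual_act w f = (\<lambda>v. f (\<rho> (inv w) v))"

definition fund_chamber :: "('v \<Rightarrow> real) set" where
  "fund_chamber = {f. linear f \<and> (\<forall>s \<in> S. f (\<alpha> s) \<ge> 0)}"

definition chamber :: "'g \<Rightarrow> ('v \<Rightarrow> real) set" where
  "chamber w = dual_act w ` fund_chamber"

definition tits_cone :: "('v \<Rightarrow> real) set" where
  "tits_cone = (\<Union>w \<in> carrier W. chamber w)"

definition pos_half_space :: "'v \<Rightarrow> ('v \<Rightarrow> real) set" where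
  "pos_half_space \<beta> = (\<Union>w \<in> {w \<in> carrier W. \<rho> (inv w) \<beta> \<in> pos_roots}. chamber w)"

definition half_space :: "sign \<Rightarrow> 'v \<Rightarrow> ('v \<Rightarrow> real) set" where
  "half_space \<epsilon> \<beta> = (case \<epsilon> of Plus \<Rightarrow> pos_half_space \<beta> | Minus \<Rightarrow> pos_half_space (- \<beta>))"

text \<open>Intersections are taken inside the Tits cone, so the empty one is the whole Tits cone.\<close>
definition half_space_inter :: "'v set \<Rightarrow> ('v \<Rightarrow> sign) \<Rightarrow> ('v \<Rightarrow> real) set" where
  "half_space_inter \<Gamma> \<epsilon> = tits_cone \<inter> (\<Inter>\<beta> \<in> \<Gamma>. half_space (\<epsilon> \<beta>) \<beta>)"

definition tits_convex :: "('v \<Rightarrow> real) set \<Rightarrow> bool" where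
  "tits_convex X \<longleftrightarrow> (\<exists>\<Gamma> \<epsilon>. \<Gamma> \<subseteq> roots \<and> X = half_space_inter \<Gamma> \<epsilon>)"

end

end

(*
  The half-spaces are the positive ones of the roots gamma that properly dominate a simple root alpha_s:
  gamma is distinct from alpha_s, and every w inverting gamma also inverts alpha_s. If v = w^-1 is low
  and v gamma were negative, then -v alpha_s would be a short inversion of v properly dominating
  -v gamma, hence not small. Conversely, let f lie in all these half-spaces and choose w of minimal
  length with f in C_w. If v = w^-1 is not low, some -v alpha_s is positive and properly dominates a
  positive root theta. Then gamma = -w theta is one of the roots above, so f vanishes at gamma, and by
  minimality w maps the face of the simple cone on which f o w vanishes into the cone, contradicting
  that -w theta is positive.

  This uses that lowness is detected on descents: if some short inversion of v is not small, then some
  -v alpha_s is positive and not small. That follows by induction on depth from bipodality: in a plane,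
  if one of the two simple roots of the root subsystem is not small, then neither is any positive root
  of the subsystem other than these two. Bipodality is reduced to rank three by adding a root dominated
  by the given one. A functional on that rank three space, vanishing exactly on the plane and negative
  on finitely many positive roots, serves to move the plane to a face, and the remaining dihedral cases
  are settled by following a root that separates the two faces along an inversion sequence.
*)
theory Submission
  imports Defs
begin

section \<open>Roots and the cone of simple roots\<close>

text \<open>Dominance quantifies over all of \<open>W\<close>; the form makes it computable. Two
  positive roots with product at most -1 are never inverted together, and a root properly dominated
  by another has product at least 1 with it. So \<zeta> is not small as soon as some
  \<open>u\<close> keeping \<open>\<rho> (inv u) \<zeta>\<close> positive inverts a root
  \<open>k\<close> with \<open>B k (\<rho> (inv u) \<zeta>) \<le> -1\<close>. Bipodality becomes a
  search for one such root. The obstacle is that a rank three subsystem may have an indefinite form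
  and more than three simple roots. Most positions of a simple root \<eta> relative to the two of
  the plane give \<open>k\<close> directly or by induction. What remains are chains of three simple
  roots with one product -1/2. The positive definite ones contain no product at most -1, and the
  others are shown to have no fourth simple root, so that the walk through them is forced.\<close>

lemma convex_coneI:
  assumes "0 \<in> Z" "\<And>x y. x \<in> Z \<Longrightarrow> y \<in> Z \<Longrightarrow> x + y \<in> Z"
    "\<And>x c. x \<in> Z \<Longrightarrow> c \<ge> 0 \<Longrightarrow> c *\<^sub>R x \<in> Z"
  shows "convex_cone Z"
  using assms by (simp add: convex_cone_iff)

context geometric_representation
begin

abbreviation "\<Phi> \<equiv> pos_roots"
abbreviation "K \<equiv> convex_cone hull (\<alpha> ` S)"

lemma act_mult [simp]:
  assumes "w \<in> carrier W" "u \<in> carrier W"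
  shows "\<rho> (w \<otimes> u) x = \<rho> w (\<rho> u x)"
  using composition_rule[OF _ assms] by simp

lemma act_one [simp]: "\<rho> \<one> x = x"
  using id_eq_one by (metis UNIV_I eq_id_iff restrict_apply')

lemma act_inv [simp]:
  assumes "w \<in> carrier W"
  shows "\<rho> (inv w) (\<rho> w x) = x" "\<rho> w (\<rho> (inv w) x) = x"
  using assms act_mult[of "inv w" w x] act_mult[of w "inv w" x] by auto

lemma act_lin:
  assumes "w \<in> carrier W"
  shows "\<rho> w (x + y) = \<rho> w x + \<rho> w y" "\<rho> w (c *\<^sub>R x) = c *\<^sub>R \<rho> w x"
    "\<rho> w (- x) = - \<rho> w x" "\<rho> w (x - y) = \<rho> w x - \<rho> w y" "\<rho> w 0 = 0"
  using act_linear[OF assms]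
  by (simp_all add: linear_add linear_scale linear_neg linear_diff linear_0)

lemma act_cancel [simp]:
  assumes "w \<in> carrier W"
  shows "\<rho> w x = \<rho> w y \<longleftrightarrow> x = y"
  using act_inv(1)[OF assms] by metis

lemma act_eqI:
  assumes "w \<in> carrier W" "u \<in> carrier W" "\<And>x. \<rho> w x = \<rho> u x"
  shows "w = u"
  using assms faithful by (auto dest: inj_onD)

lemma B_lin:
  "B (x + y) z = B x z + B y z" "B x (y + z) = B x y + B x z"
  "B (c *\<^sub>R x) y = c * B x y" "B x (c *\<^sub>R y) = c * B x y"
  "B (- x) y = - B x y" "B x (- y) = - B x y"
  "B (x - y) z = B x z - B y z" "B x (y - z) = B x y - B x z"
  "B 0 x = 0" "B x 0 = 0"
  using B_bilinear
  by (simp_all add: bilinear_ladd bilinear_radd bilinear_lmul bilinear_rmul bilinear_lneg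
      bilinear_rneg bilinear_lsub bilinear_rsub bilinear_lzero bilinear_rzero)

lemma B_act_inv:
  assumes "w \<in> carrier W"
  shows "B (\<rho> w x) y = B x (\<rho> (inv w) y)"
  by (metis B_invariant act_inv(2) assms)

lemma S_closed [simp]: "s \<in> S \<Longrightarrow> s \<in> carrier W"
  using S_subset by blast

lemma simple_act: "s \<in> S \<Longrightarrow> \<rho> s x = x - (2 * B x (\<alpha> s)) *\<^sub>R \<alpha> s"
  by (simp add: simple_refl reflect_def)

lemma simple_act_self: "s \<in> S \<Longrightarrow> \<rho> s (\<alpha> s) = - \<alpha> s"
  by (simp add: simple_act simple_norm algebra_simps flip: scaleR_2)

lemma simple_sq: "s \<in> S \<Longrightarrow> s \<otimes> s = \<one>"
  by (rule act_eqI) (simp_all add: simple_act B_lin simple_norm algebra_simps)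

lemma simple_inv: "s \<in> S \<Longrightarrow> inv s = s"
  using simple_sq S_closed inv_equality by blast

lemma gram_nonpos:
  assumes "s \<in> S" "t \<in> S" "s \<noteq> t"
  shows "B (\<alpha> s) (\<alpha> t) \<le> 0"
proof -
  have st: "s \<otimes> t \<in> carrier W" using assms by simp
  have "ord (s \<otimes> t) \<noteq> 1"
  proof
    assume "ord (s \<otimes> t) = 1"
    then have "s \<otimes> t = \<one>" using st ord_eq_1 by blast
    then have "s = inv t" using assms by (simp add: inv_equality)
    then show False using assms simple_inv by simp
  qed
  then consider "ord (s \<otimes> t) = 0" | "ord (s \<otimes> t) \<ge> 2" by linarith
  then show ?thesis
  proof cases
    case 1 then show ?thesis using gram[OF assms] by simp
  next
    case 2
    have "pi / real (ord (s \<otimes> t)) \<le> pi / 2" using 2 by (intro divide_left_mono) auto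
    moreover have "pi / real (ord (s \<otimes> t)) \<ge> 0" by simp
    ultimately have "cos (pi / real (ord (s \<otimes> t))) \<ge> 0" by (intro cos_ge_zero) linarith+
    then show ?thesis using gram[OF assms] 2 by auto
  qed
qed

lemma root_norm: "x \<in> roots \<Longrightarrow> B x x = 1"
  by (auto simp: roots_def B_invariant simple_norm)

lemma act_root: 
  assumes "w \<in> carrier W" "x \<in> roots" shows "\<rho> w x \<in> roots"
proof -
  obtain u s where "x = \<rho> u (\<alpha> s)" "u \<in> carrier W" "s \<in> S" using assms unfolding roots_def by blast
  then have "\<rho> w x = \<rho> (w \<otimes> u) (\<alpha> s)" using assms by simp
  then show ?thesis unfolding roots_def using assms \<open>u \<in> _\<close> \<open>s \<in> S\<close> by blast
qed

lemma act_root_iff [simp]: "w \<in> carrier W \<Longrightarrow> \<rho> w x \<in> roots \<longleftrightarrow> x \<in> roots"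
  by (metis act_root act_inv(1) inv_closed)

lemma simple_root: "s \<in> S \<Longrightarrow> \<alpha> s \<in> roots"
  unfolding roots_def using act_one one_closed by force

lemma neg_root: "x \<in> roots \<Longrightarrow> - x \<in> roots"
proof -
  assume "x \<in> roots"
  then obtain u s where x: "x = \<rho> u (\<alpha> s)" "u \<in> carrier W" "s \<in> S" unfolding roots_def by blast
  then have "- x = \<rho> u (\<rho> s (\<alpha> s))" by (simp add: simple_act_self act_lin)
  then show ?thesis using x simple_root by simp
qed

lemma neg_root_iff [simp]: "- x \<in> roots \<longleftrightarrow> x \<in> roots"
  using neg_root by fastforce

lemma pos_root: "x \<in> \<Phi> \<Longrightarrow> x \<in> roots" by (simp add: pos_roots_def)

lemma pos_K: "x \<in> \<Phi> \<Longrightarrow> x \<in> K" by (simp add: pos_roots_def)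

lemma mem_neg: "x \<in> neg_roots \<longleftrightarrow> - x \<in> \<Phi>"
  unfolding neg_roots_def by (metis imageE image_eqI minus_minus)

lemma not_pos_neg: "x \<in> \<Phi> \<Longrightarrow> - x \<in> \<Phi> \<Longrightarrow> False"
  using roots_disjoint mem_neg by blast

lemma neg_iff: "x \<in> roots \<Longrightarrow> - x \<in> \<Phi> \<longleftrightarrow> x \<notin> \<Phi>"
  using roots_union mem_neg not_pos_neg by blast

lemma pos_or_neg: "x \<in> roots \<Longrightarrow> x \<in> \<Phi> \<or> - x \<in> \<Phi>"
  using neg_iff by blast

lemma posI: "x \<in> roots \<Longrightarrow> x \<in> K \<Longrightarrow> x \<in> \<Phi>" by (simp add: pos_roots_def)

lemma root_nz: "x \<in> roots \<Longrightarrow> x \<noteq> 0" using root_norm B_lin(9) by fastforce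

lemmas K_add = convex_cone_hull_add[of _ "\<alpha> ` S"] and K_scale = convex_cone_hull_mul[of _ "\<alpha> ` S"]
  and K_0 = convex_cone_hull_contains_0[of "\<alpha> ` S"]

lemma simple_K: "s \<in> S \<Longrightarrow> \<alpha> s \<in> K" by (simp add: hull_inc)

lemma simple_pos: "s \<in> S \<Longrightarrow> \<alpha> s \<in> \<Phi>" by (simp add: posI simple_K simple_root)

lemma pos_not_neg_K: "x \<in> \<Phi> \<Longrightarrow> - x \<notin> K"
  using not_pos_neg posI pos_root neg_root by blast

text \<open>The elements of \<open>K\<close> that are zero or have no negative in \<open>K\<close>
  form a convex cone, and the simple roots belong to it by \<open>roots_disjoint\<close>. Minimality
  of the hull, here and later, replaces explicit finite combinations.\<close>

lemma K_salient:
  assumes "k \<in> K" "- k \<in> K" shows "k = 0"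
proof -
  let ?Z = "{k \<in> K. k = 0 \<or> - k \<notin> K}"
  have "convex_cone ?Z" 
  proof (rule convex_coneI)
    show "0 \<in> ?Z" using K_0 by simp
  next
    fix x y assume xy: "x \<in> ?Z" "y \<in> ?Z"
    have "x + y = 0" if n: "- (x + y) \<in> K"
    proof -
      have "- x = - (x + y) + y" "- y = - (x + y) + x" by simp_all
      then have "- x \<in> K" "- y \<in> K" using n xy K_add by (metis (mono_tags, lifting) mem_Collect_eq)+
      then show ?thesis using xy by auto
    qed
    then show "x + y \<in> ?Z" using xy K_add by blast
  next
    fix x and c :: real assume x: "x \<in> ?Z" and c: "c \<ge> 0"
    have "c *\<^sub>R x = 0" if n: "- (c *\<^sub>R x) \<in> K"
    proof (cases "c = 0")
      case False
      then have "- x = (1 / c) *\<^sub>R (- (c *\<^sub>R x))" by simp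
      then have "- x \<in> K" using n K_scale[of _ "1/c"] c by (metis divide_nonneg_nonneg zero_le_one)
      then show ?thesis using x by simp
    qed simp
    then show "c *\<^sub>R x \<in> ?Z" using x c K_scale by blast
  qed
  moreover have "\<alpha> ` S \<subseteq> ?Z" using simple_K simple_pos pos_not_neg_K by blast
  ultimately have "K \<subseteq> ?Z" by (intro hull_minimal)
  then show ?thesis using assms by blast
qed

lemma K_sum_zero:
  assumes "x \<in> K" "y \<in> K" "x + y = 0" shows "x = 0" "y = 0"
proof -
  have "y = - x" using assms(3) by (simp add: add_eq_0_iff)
  then show "x = 0" "y = 0" using assms K_salient by auto
qed

text \<open>With dependent simple roots the coefficient of \<open>\<alpha> s\<close> is undefined.
  What survives is that a multiple of \<open>\<alpha> s\<close> splits off, leaving a rest that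
  comes from the other simple roots and so has nonpositive product with it.\<close>

lemma K_split:
  assumes "x \<in> K" "s \<in> S"
  shows "\<exists>c k. c \<ge> 0 \<and> k \<in> K \<and> B k (\<alpha> s) \<le> 0 \<and> x = c *\<^sub>R \<alpha> s + k"
proof -
  let ?Z = "{x. \<exists>c k. c \<ge> 0 \<and> k \<in> K \<and> B k (\<alpha> s) \<le> 0 \<and> x = c *\<^sub>R \<alpha> s + k}"
  have "convex_cone ?Z" 
  proof (rule convex_coneI)
    have "0 \<le> (0::real) \<and> 0 \<in> K \<and> B 0 (\<alpha> s) \<le> 0 \<and> 0 = 0 *\<^sub>R \<alpha> s + 0" using K_0 by (simp add: B_lin)
    then show "0 \<in> ?Z" by blast
  next
    fix x y assume "x \<in> ?Z" "y \<in> ?Z"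
    then obtain c k d l where "c \<ge> 0 \<and> k \<in> K \<and> B k (\<alpha> s) \<le> 0 \<and> x = c *\<^sub>R \<alpha> s + k"
      "d \<ge> 0 \<and> l \<in> K \<and> B l (\<alpha> s) \<le> 0 \<and> y = d *\<^sub>R \<alpha> s + l" by blast
    then have "c + d \<ge> 0 \<and> k + l \<in> K \<and> B (k + l) (\<alpha> s) \<le> 0 \<and> x + y = (c + d) *\<^sub>R \<alpha> s + (k + l)"
      using K_add by (simp add: B_lin algebra_simps)
    then show "x + y \<in> ?Z" by blast
  next
    fix x and a :: real assume "x \<in> ?Z" and a: "a \<ge> 0"
    then obtain c k where "c \<ge> 0 \<and> k \<in> K \<and> B k (\<alpha> s) \<le> 0 \<and> x = c *\<^sub>R \<alpha> s + k" by blast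
    then have "a * c \<ge> 0 \<and> a *\<^sub>R k \<in> K \<and> B (a *\<^sub>R k) (\<alpha> s) \<le> 0 \<and> a *\<^sub>R x = (a * c) *\<^sub>R \<alpha> s + a *\<^sub>R k"
      using a K_scale by (simp add: B_lin mult_nonneg_nonpos algebra_simps)
    then show "a *\<^sub>R x \<in> ?Z" by blast
  qed
  moreover have "\<alpha> t \<in> ?Z" if "t \<in> S" for t
  proof (cases "t = s")
    case True
    have "0 \<le> (1::real) \<and> 0 \<in> K \<and> B 0 (\<alpha> s) \<le> 0 \<and> \<alpha> t = 1 *\<^sub>R \<alpha> s + 0" using K_0 True by (simp add: B_lin)
    then show ?thesis by blast
  next
    case False
    have "0 \<le> (0::real) \<and> \<alpha> t \<in> K \<and> B (\<alpha> t) (\<alpha> s) \<le> 0 \<and> \<alpha> t = 0 *\<^sub>R \<alpha> s + \<alpha> t"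
      using that assms False simple_K gram_nonpos by simp
    then show ?thesis by blast
  qed
  ultimately have "K \<subseteq> ?Z" by (intro hull_minimal) auto
  then show ?thesis using assms by blast
qed

lemma unit_multiple:
  assumes "x \<in> \<Phi>" "y \<in> \<Phi>" "x = c *\<^sub>R y" shows "x = y"
proof -
  have "c * c = 1" using assms root_norm[OF pos_root[OF assms(1)]] root_norm[OF pos_root[OF assms(2)]]
    by (simp add: B_lin)
  then have "c = 1 \<or> c = -1" by (simp add: square_eq_1_iff)
  then show ?thesis using assms not_pos_neg[OF assms(2)] by fastforce
qed

text \<open>If \<open>x\<close> and \<open>- \<rho> s x\<close> both lie in \<open>K\<close>, the
  remainders of their splittings sum to a multiple \<open>y\<close> of \<open>\<alpha> s\<close>.
  Pairing with \<open>\<alpha> s\<close> gives \<open>y \<le> 0\<close>, so salience kills the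
  remainders and \<open>x\<close> is a multiple of \<open>\<alpha> s\<close>.\<close>

lemma simple_permutes:
  assumes s: "s \<in> S" and x: "x \<in> \<Phi>" "x \<noteq> \<alpha> s"
  shows "\<rho> s x \<in> \<Phi>"
proof (rule ccontr)
  assume "\<rho> s x \<notin> \<Phi>"
  then have "- \<rho> s x \<in> K" using s x by (metis S_closed act_root_iff neg_iff pos_K pos_root)
  then obtain d l where d: "d \<ge> 0" "l \<in> K" "B l (\<alpha> s) \<le> 0" "- \<rho> s x = d *\<^sub>R \<alpha> s + l" using K_split s by blast
  obtain c k where c: "c \<ge> 0" "k \<in> K" "B k (\<alpha> s) \<le> 0" "x = c *\<^sub>R \<alpha> s + k" using K_split[OF pos_K[OF x(1)] s] by blast
  define y where "y = 2 * B x (\<alpha> s) - c - d"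
  have e: "k + l = y *\<^sub>R \<alpha> s" using c(4) d(4) simple_act[OF s] unfolding y_def
    by (simp add: algebra_simps)
  have "B (k + l) (\<alpha> s) = y" using e s by (simp add: B_lin simple_norm)
  then have "y \<le> 0" using c d by (simp add: B_lin)
  then have "(- y) *\<^sub>R \<alpha> s \<in> K" by (intro K_scale simple_K s) simp
  moreover have "k + (l + (- y) *\<^sub>R \<alpha> s) = 0" using e by (simp add: algebra_simps)
  ultimately have "k = 0" using K_sum_zero c(2) d(2) K_add by metis
  then have "x = \<alpha> s" using c(4) unit_multiple[OF x(1) simple_pos[OF s], of c] by simp
  then show False using x by simp
qed

section \<open>Length and inversions\<close>

abbreviation "word \<equiv> word_prod W"

lemma word_Nil [simp]: "word [] = \<one>" and word_Cons [simp]: "word (s # ss) = s \<otimes> word ss"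
  by (simp_all add: word_prod_def)

lemma word_closed [simp]: "set ss \<subseteq> S \<Longrightarrow> word ss \<in> carrier W"
  by (induction ss) auto

lemma word_append: "set us \<subseteq> S \<Longrightarrow> set vs \<subseteq> S \<Longrightarrow> word (us @ vs) = word us \<otimes> word vs"
  by (induction us) (auto simp: m_assoc)

lemma word_exists:
  assumes "w \<in> carrier W" shows "\<exists>ss. set ss \<subseteq> S \<and> word ss = w"
proof -
  have "w \<in> generate W S" using assms S_generates by simp
  then show ?thesis
  proof (induction rule: generate.induct)
    case one
    have "set [] \<subseteq> S \<and> word [] = \<one>" by simp
    then show ?case by blast
  next
    case (incl h)
    then have "set [h] \<subseteq> S \<and> word [h] = h" by simp
    then show ?case by blast
  next
    case (inv h)
    then have "set [h] \<subseteq> S \<and> word [h] = inv h" by (simp add: simple_inv)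
    then show ?case by blast
  next
    case (eng h1 h2)
    then obtain us vs where "set us \<subseteq> S" "word us = h1" "set vs \<subseteq> S" "word vs = h2" by blast
    then have "set (us @ vs) \<subseteq> S \<and> word (us @ vs) = h1 \<otimes> h2" by (simp add: word_append)
    then show ?case by blast
  qed
qed

lemma reduced_word:
  assumes "w \<in> carrier W" shows "\<exists>ss. set ss \<subseteq> S \<and> length ss = len w \<and> word ss = w"
proof -
  have "\<exists>n ss. set ss \<subseteq> S \<and> length ss = n \<and> word ss = w" using word_exists[OF assms] by blast
  from LeastI_ex[OF this] show ?thesis unfolding len_def .
qed

lemma len_le: "set ss \<subseteq> S \<Longrightarrow> len (word ss) \<le> length ss"
  unfolding len_def by (rule Least_le) auto

lemma len_mult_le:
  assumes "u \<in> carrier W" "w \<in> carrier W" shows "len (u \<otimes> w) \<le> len u + len w"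
proof -
  obtain us vs where "set us \<subseteq> S" "length us = len u" "word us = u"
    "set vs \<subseteq> S" "length vs = len w" "word vs = w" using reduced_word assms by metis
  then show ?thesis using len_le[of "us @ vs"] by (simp add: word_append)
qed

lemma len_one [simp]: "len \<one> = 0" using len_le[of "[]"] by simp

lemma len_simple_le: "s \<in> S \<Longrightarrow> len s \<le> 1" using len_le[of "[s]"] by simp

lemma len_zero: "w \<in> carrier W \<Longrightarrow> len w = 0 \<Longrightarrow> w = \<one>"
  using reduced_word by fastforce

section \<open>Reflections in arbitrary roots\<close>

lemma act_conj_refl:
  assumes "w \<in> carrier W" "t \<in> carrier W" "\<And>y. \<rho> t y = y - (2 * B y \<beta>) *\<^sub>R \<beta>"
  shows "\<rho> (w \<otimes> t \<otimes> inv w) x = x - (2 * B x (\<rho> w \<beta>)) *\<^sub>R \<rho> w \<beta>"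
  using assms by (simp add: act_lin B_act_inv[of "inv w"])

lemma refl_exists:
  assumes "\<beta> \<in> roots"
  shows "\<exists>t \<in> carrier W. \<forall>x. \<rho> t x = x - (2 * B x \<beta>) *\<^sub>R \<beta>"
proof -
  obtain w s where "\<beta> = \<rho> w (\<alpha> s)" "w \<in> carrier W" "s \<in> S" using assms unfolding roots_def by blast
  then show ?thesis using act_conj_refl[of w s] by (intro bexI[of _ "w \<otimes> s \<otimes> inv w"]) (auto simp: simple_act)
qed

lemma refl_eqI:
  assumes "t \<in> carrier W" "\<And>x. \<rho> t x = x - (2 * B x \<beta>) *\<^sub>R \<beta>"
  shows "root_refl \<beta> = t"
  unfolding root_refl_def using assms by (intro the_equality) (auto simp: fun_eq_iff reflect_def intro: act_eqI)

abbreviation "r \<equiv> root_refl"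

lemma r_closed [simp]: "\<beta> \<in> roots \<Longrightarrow> r \<beta> \<in> carrier W"
  using refl_exists refl_eqI by metis

lemma r_act: "\<beta> \<in> roots \<Longrightarrow> \<rho> (r \<beta>) x = x - (2 * B x \<beta>) *\<^sub>R \<beta>"
  using refl_exists refl_eqI by metis

lemma r_simple: "s \<in> S \<Longrightarrow> r (\<alpha> s) = s"
  by (rule refl_eqI) (auto simp: simple_act)

lemma r_conj:
  assumes "w \<in> carrier W" "\<beta> \<in> roots" shows "r (\<rho> w \<beta>) = w \<otimes> r \<beta> \<otimes> inv w"
  using assms by (intro refl_eqI act_conj_refl) (auto simp: r_act)

lemma r_neg: "\<beta> \<in> roots \<Longrightarrow> r (- \<beta>) = r \<beta>"
  by (rule refl_eqI) (auto simp: r_act B_lin)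

lemma r_act_self: "\<beta> \<in> roots \<Longrightarrow> \<rho> (r \<beta>) \<beta> = - \<beta>"
  by (simp add: r_act root_norm algebra_simps flip: scaleR_2)

lemma r_sq: "\<beta> \<in> roots \<Longrightarrow> r \<beta> \<otimes> r \<beta> = \<one>"
  by (rule act_eqI) (simp_all add: r_act B_lin root_norm algebra_simps)

lemma r_inv: "\<beta> \<in> roots \<Longrightarrow> inv (r \<beta>) = r \<beta>"
  using r_sq r_closed inv_equality by blast

lemma r_act_twice [simp]: "\<beta> \<in> roots \<Longrightarrow> \<rho> (r \<beta>) (\<rho> (r \<beta>) x) = x"
  using act_inv(1)[of "r \<beta>"] r_inv by simp

lemma simple_act_twice [simp]: "s \<in> S \<Longrightarrow> \<rho> s (\<rho> s x) = x"
  using act_inv(1)[of s] simple_inv by simp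

text \<open>Apply the word to \<open>\<alpha> s\<close> letter by letter from the right. The letter
  \<open>t\<close> that turns the root negative meets it at \<open>\<alpha> t\<close>, so
  \<open>t\<close> is the conjugate of \<open>s\<close> by the rest of the word, and deleting it
  amounts to multiplying by \<open>s\<close>.\<close>

lemma exchange:
  assumes "set ss \<subseteq> S" "s \<in> S" "- \<rho> (word ss) (\<alpha> s) \<in> \<Phi>"
  shows "\<exists>ts. set ts \<subseteq> S \<and> length ts + 1 = length ss \<and> word ts = word ss \<otimes> s"
  using assms
proof (induction ss)
  case Nil
  then show ?case using not_pos_neg simple_pos by auto
next
  case (Cons t ss)
  have ts: "t \<in> S" "set ss \<subseteq> S" using Cons by auto
  let ?x = "\<rho> (word ss) (\<alpha> s)"
  show ?case
  proof (cases "- ?x \<in> \<Phi>")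
    case True
    then obtain us where "set us \<subseteq> S \<and> length us + 1 = length ss \<and> word us = word ss \<otimes> s"
      using Cons ts by blast
    then have "set (t # us) \<subseteq> S \<and> length (t # us) + 1 = length (t # ss) \<and> word (t # us) = word (t # ss) \<otimes> s"
      using ts Cons.prems by (simp add: m_assoc)
    then show ?thesis by blast
  next
    case False
    have "?x \<in> roots" using ts Cons.prems simple_root by simp
    then have p: "?x \<in> \<Phi>" using False neg_iff by blast
    have "- \<rho> t ?x \<in> \<Phi>" using Cons.prems ts by simp
    then have "?x = \<alpha> t" using simple_permutes[OF ts(1) p] not_pos_neg by blast
    then have "t = word ss \<otimes> s \<otimes> inv (word ss)"
      using r_conj[of "word ss" "\<alpha> s"] ts Cons.prems simple_root by (simp add: r_simple)
    then have "t \<otimes> word ss = word ss \<otimes> s" using ts Cons.prems by (simp add: m_assoc)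
    then have "word (t # ss) \<otimes> s = word ss \<otimes> s \<otimes> s" by simp
    also have "\<dots> = word ss" using ts Cons.prems by (simp add: m_assoc simple_sq)
    finally show ?thesis using ts by (intro exI[of _ ss]) simp
  qed
qed

section \<open>Length and inversion sets under simple reflections\<close>

lemma len_mult_simple_neg:
  assumes w: "w \<in> carrier W" and s: "s \<in> S" and n: "- \<rho> w (\<alpha> s) \<in> \<Phi>"
  shows "len (w \<otimes> s) + 1 = len w"
proof -
  obtain ss where ss: "set ss \<subseteq> S" "length ss = len w" "word ss = w" using reduced_word w by blast
  then obtain ts where ts: "set ts \<subseteq> S" "length ts + 1 = length ss" "word ts = w \<otimes> s" using exchange s n by metis
  then have "len (w \<otimes> s) + 1 \<le> len w" using len_le ss by fastforce
  moreover have "w = (w \<otimes> s) \<otimes> s" using w s by (simp add: m_assoc simple_sq)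
  then have "len w \<le> len (w \<otimes> s) + 1"
    using len_mult_le[of "w \<otimes> s" s] len_simple_le[OF s] w s by simp
  ultimately show ?thesis by simp
qed

lemma len_mult_simple_pos:
  assumes w: "w \<in> carrier W" and s: "s \<in> S" and n: "\<rho> w (\<alpha> s) \<in> \<Phi>"
  shows "len (w \<otimes> s) = len w + 1"
proof -
  have "- \<rho> (w \<otimes> s) (\<alpha> s) \<in> \<Phi>" using w s n by (simp add: simple_act_self act_lin)
  then have "len (w \<otimes> s \<otimes> s) + 1 = len (w \<otimes> s)" using w s by (intro len_mult_simple_neg) auto
  then show ?thesis using w s by (simp add: m_assoc simple_sq)
qed

text \<open>These are the \<open>inversions\<close> of the inverse of \<open>w\<close>. In this
  orientation a left multiplication by a simple reflection that lengthens \<open>w\<close> adds one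
  root and removes none.\<close>

definition invs :: "'g \<Rightarrow> 'v set" where "invs w = {x \<in> \<Phi>. - \<rho> w x \<in> \<Phi>}"

lemma invs_one [simp]: "invs \<one> = {}" using not_pos_neg by (auto simp: invs_def)

lemma not_invs: "w \<in> carrier W \<Longrightarrow> x \<in> \<Phi> \<Longrightarrow> x \<notin> invs w \<longleftrightarrow> \<rho> w x \<in> \<Phi>"
  using neg_iff[of "\<rho> w x"] pos_root by (auto simp: invs_def)

lemma invs_left:
  assumes w: "w \<in> carrier W" and s: "s \<in> S" and p: "\<rho> (inv w) (\<alpha> s) \<in> \<Phi>"
  shows "invs (s \<otimes> w) = insert (\<rho> (inv w) (\<alpha> s)) (invs w)" "\<rho> (inv w) (\<alpha> s) \<notin> invs w"
proof -
  show "\<rho> (inv w) (\<alpha> s) \<notin> invs w" using w s not_pos_neg simple_pos by (auto simp: invs_def)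
  have "x \<in> invs (s \<otimes> w) \<longleftrightarrow> x = \<rho> (inv w) (\<alpha> s) \<or> x \<in> invs w" for x
  proof (cases "x \<in> \<Phi> \<and> x \<noteq> \<rho> (inv w) (\<alpha> s)")
    case True
    then have r: "\<rho> w x \<in> roots" using w pos_root by auto
    have ne: "\<rho> w x \<noteq> \<alpha> s" using True act_inv(1)[OF w, of x] by auto
    have ne': "- \<rho> w x \<noteq> \<alpha> s"
    proof
      assume "- \<rho> w x = \<alpha> s"
      then have "\<rho> w (- x) = \<alpha> s" using w by (simp add: act_lin)
      then have "- x = \<rho> (inv w) (\<alpha> s)" using w act_inv(1) by metis
      then show False using p True not_pos_neg[of x] by simp
    qed
    have "- \<rho> s (\<rho> w x) \<in> \<Phi> \<longleftrightarrow> - \<rho> w x \<in> \<Phi>"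
    proof
      assume "- \<rho> s (\<rho> w x) \<in> \<Phi>"
      then show "- \<rho> w x \<in> \<Phi>" using simple_permutes[OF s _ ne] not_pos_neg pos_or_neg[OF r] by blast
    next
      assume "- \<rho> w x \<in> \<Phi>"
      then show "- \<rho> s (\<rho> w x) \<in> \<Phi>" using simple_permutes[OF s _ ne'] s by (simp add: act_lin)
    qed
    then show ?thesis using True w s by (simp add: invs_def)
  next
    case False
    then show ?thesis using w s p simple_pos by (auto simp: invs_def simple_act_self)
  qed
  then show "invs (s \<otimes> w) = insert (\<rho> (inv w) (\<alpha> s)) (invs w)" by auto
qed

lemma inv_word_closed: "set ss \<subseteq> S \<Longrightarrow> inv (word ss) = word (rev ss)"
  by (induction ss) (auto simp: word_append inv_mult_group simple_inv)

lemma len_inv [simp]: assumes "w \<in> carrier W" shows "len (inv w) = len w"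
proof -
  have "len (inv u) \<le> len u" if u: "u \<in> carrier W" for u
  proof -
    obtain ss where ss: "set ss \<subseteq> S" "length ss = len u" "word ss = u" using reduced_word u by blast
    then have "len (word (rev ss)) \<le> len u" using len_le[of "rev ss"] by simp
    then show ?thesis using ss inv_word_closed by metis
  qed
  from this[OF assms] this[of "inv w"] show ?thesis using assms by simp
qed

lemma left_len:
  assumes w: "w \<in> carrier W" and s: "s \<in> S"
  shows "\<rho> (inv w) (\<alpha> s) \<in> \<Phi> \<Longrightarrow> len (s \<otimes> w) = len w + 1"
    "- \<rho> (inv w) (\<alpha> s) \<in> \<Phi> \<Longrightarrow> len (s \<otimes> w) + 1 = len w"
proof -
  have e: "len (s \<otimes> w) = len (inv w \<otimes> s)" using w s len_inv[of "s \<otimes> w"] by (simp add: inv_mult_group simple_inv)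
  show "\<rho> (inv w) (\<alpha> s) \<in> \<Phi> \<Longrightarrow> len (s \<otimes> w) = len w + 1"
    using len_mult_simple_pos[of "inv w" s] w s e by simp
  show "- \<rho> (inv w) (\<alpha> s) \<in> \<Phi> \<Longrightarrow> len (s \<otimes> w) + 1 = len w"
    using len_mult_simple_neg[of "inv w" s] w s e by simp
qed

text \<open>The inversion sets of the suffixes of a reduced word form a chain growing by one root at
  a time; the later inductions run along this chain.\<close>

lemma peel:
  assumes w: "w \<in> carrier W" and ne: "w \<noteq> \<one>"
  obtains s g where "s \<in> S" "g \<in> carrier W" "w = s \<otimes> g" "len w = len g + 1"
    "\<rho> (inv g) (\<alpha> s) \<in> \<Phi>" "invs w = insert (\<rho> (inv g) (\<alpha> s)) (invs g)"
    "\<rho> (inv g) (\<alpha> s) \<notin> invs g"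
proof -
  obtain ss where ss: "set ss \<subseteq> S" "length ss = len w" "word ss = w" using reduced_word w by blast
  then obtain s us where us: "ss = s # us" using ne by (cases ss) auto
  have s: "s \<in> S" and g: "word us \<in> carrier W" using ss us by auto
  have wg: "w = s \<otimes> word us" using ss us by simp
  have l: "len (word us) < len w" using len_le[of us] ss us by auto
  have "\<rho> (inv (word us)) (\<alpha> s) \<in> roots" using g s simple_root by simp
  then have p: "\<rho> (inv (word us)) (\<alpha> s) \<in> \<Phi>" using left_len(2)[OF g s] neg_iff[of "\<rho> (inv (word us)) (\<alpha> s)"] l wg by fastforce
  show ?thesis using that[OF s g wg _ p] left_len(1)[OF g s p] invs_left[OF g s p] wg by simp
qed

lemma finite_invs_card:
  assumes "w \<in> carrier W" shows "finite (invs w) \<and> card (invs w) = len w"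
  using assms
proof (induction "len w" arbitrary: w)
  case 0
  then show ?case using len_zero[of w] by simp
next
  case (Suc n)
  have "w \<noteq> \<one>" using Suc by auto
  then obtain s g where g: "s \<in> S" "g \<in> carrier W" "w = s \<otimes> g" "len w = len g + 1"
    "invs w = insert (\<rho> (inv g) (\<alpha> s)) (invs g)" "\<rho> (inv g) (\<alpha> s) \<notin> invs g"
    using peel[OF Suc.prems] by blast
  moreover have "finite (invs g) \<and> card (invs g) = len g" using Suc.hyps g by simp
  ultimately show ?case by simp
qed

lemmas finite_invs = finite_invs_card[THEN conjunct1]
lemmas card_invs = finite_invs_card[THEN conjunct2]

section \<open>Counting inversions under an arbitrary reflection\<close>

lemma K_comb_pos:
  assumes "x \<in> roots" "x = a *\<^sub>R y + b *\<^sub>R z" "y \<in> K" "z \<in> K" "a \<ge> 0" "b \<ge> 0"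
  shows "x \<in> \<Phi>"
  using assms K_add K_scale posI by simp

text \<open>The map \<sigma> to \<open>- \<rho> (r \<gamma>) \<sigma>\<close> is an involution on
  the roots inverted by \<open>r \<gamma>\<close>. Two partners sum to a multiple of \<gamma>, and
  salience of the cone makes the multiple positive.\<close>

lemma invs_r_pair:
  assumes g: "\<gamma> \<in> \<Phi>" and s: "\<sigma> \<in> invs (r \<gamma>)"
  shows "B \<sigma> \<gamma> > 0" "- \<rho> (r \<gamma>) \<sigma> \<in> invs (r \<gamma>)" "- \<rho> (r \<gamma>) \<sigma> = (2 * B \<sigma> \<gamma>) *\<^sub>R \<gamma> - \<sigma>"
proof -
  have rg: "\<gamma> \<in> roots" using g pos_root by simp
  show e: "- \<rho> (r \<gamma>) \<sigma> = (2 * B \<sigma> \<gamma>) *\<^sub>R \<gamma> - \<sigma>" using r_act[OF rg] by simp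
  have sp: "\<sigma> \<in> \<Phi>" "- \<rho> (r \<gamma>) \<sigma> \<in> \<Phi>" using s by (auto simp: invs_def)
  show "- \<rho> (r \<gamma>) \<sigma> \<in> invs (r \<gamma>)" using sp rg by (simp add: invs_def act_lin)
  show "B \<sigma> \<gamma> > 0"
  proof (rule ccontr)
    assume "\<not> B \<sigma> \<gamma> > 0"
    then have "(- (2 * B \<sigma> \<gamma>)) *\<^sub>R \<gamma> \<in> K" by (intro K_scale pos_K g) auto
    moreover have "\<sigma> + (- \<rho> (r \<gamma>) \<sigma> + (- (2 * B \<sigma> \<gamma>)) *\<^sub>R \<gamma>) = 0" unfolding e by simp
    ultimately have "\<sigma> = 0" using K_sum_zero sp pos_K K_add by metis
    then show False using sp root_nz pos_root by blast
  qed
qed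

text \<open>Partners sum to a positive multiple of \<gamma>, so an element making \<gamma> negative
  cannot leave both positive.\<close>

lemma pair_inverted:
  assumes v: "v \<in> carrier W" and g: "\<gamma> \<in> \<Phi>" "- \<rho> v \<gamma> \<in> \<Phi>" and s: "\<sigma> \<in> invs (r \<gamma>)" "\<rho> v \<sigma> \<in> \<Phi>"
  shows "- \<rho> v (- \<rho> (r \<gamma>) \<sigma>) \<in> \<Phi>"
proof (rule ccontr)
  let ?t = "- \<rho> (r \<gamma>) \<sigma>"
  note p = invs_r_pair[OF g(1) s(1)]
  assume "- \<rho> v ?t \<notin> \<Phi>"
  moreover have "\<rho> v ?t \<in> roots" using v g s pos_root by (simp add: act_lin invs_def)
  ultimately have "\<rho> v ?t \<in> \<Phi>" using neg_iff by blast
  then have a: "\<rho> v \<sigma> + \<rho> v ?t \<in> K" using s pos_K K_add by blast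
  have "\<rho> v \<sigma> + \<rho> v ?t = (2 * B \<sigma> \<gamma>) *\<^sub>R \<rho> v \<gamma>" using v unfolding p(3) by (simp add: act_lin)
  moreover have "(2 * B \<sigma> \<gamma>) *\<^sub>R (- \<rho> v \<gamma>) \<in> K" using p(1) by (intro K_scale pos_K[OF g(2)]) simp
  ultimately have "\<rho> v \<sigma> + \<rho> v ?t = 0" using K_salient[OF a] by simp
  then show False using K_sum_zero(1) s \<open>\<rho> v ?t \<in> \<Phi>\<close> pos_K root_nz pos_root by metis
qed

text \<open>Outside \<open>I\<close> the reflection carries the inversions of \<open>v\<close>
  bijectively to those of \<open>v \<otimes> r \<gamma>\<close>. Inside \<open>I\<close> the pairing
  exchanges inverted and non-inverted roots.\<close>

lemma count_refl:
  assumes v: "v \<in> carrier W" and g: "\<gamma> \<in> \<Phi>"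
  defines "I \<equiv> invs (r \<gamma>)"
  shows "len v + card (I - invs v) = len (v \<otimes> r \<gamma>) + card (I \<inter> invs v)"
proof -
  have rg: "\<gamma> \<in> roots" using g pos_root by simp
  have fI: "finite I" unfolding I_def using finite_invs rg by simp
  let ?u = "v \<otimes> r \<gamma>"
  have u: "?u \<in> carrier W" using v rg by simp
  have f: "finite (invs v)" "finite (invs ?u)" using finite_invs v u by auto
  have "bij_betw (\<rho> (r \<gamma>)) (invs v - I) (invs ?u - I)"
    by (rule bij_betw_byWitness[where f' = "\<rho> (r \<gamma>)"])
      (use v rg in \<open>auto simp: I_def invs_def neg_iff pos_root\<close>)
  then have c1: "card (invs v - I) = card (invs ?u - I)" by (rule bij_betw_same_card)
  have "bij_betw (\<lambda>x. - \<rho> (r \<gamma>) x) (invs ?u \<inter> I) (I - invs v)"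
    by (rule bij_betw_byWitness[where f' = "\<lambda>x. - \<rho> (r \<gamma>) x"])
      (use v rg not_pos_neg in \<open>auto simp: I_def invs_def act_lin neg_iff pos_root\<close>)
  then have c2: "card (invs ?u \<inter> I) = card (I - invs v)" by (rule bij_betw_same_card)
  have "len v = card (invs v - I) + card (invs v \<inter> I)"
    using f(1) card_invs[OF v] card_Diff_subset_Int[of "invs v" I] card_mono[of "invs v" "invs v \<inter> I"] by force
  moreover have "len ?u = card (invs ?u - I) + card (invs ?u \<inter> I)"
    using f(2) card_invs[OF u] card_Diff_subset_Int[of "invs ?u" I] card_mono[of "invs ?u" "invs ?u \<inter> I"] by force
  ultimately show ?thesis using c1 c2 by (simp add: Int_commute)
qed

text \<open>The partner of a root left positive is inverted by \<open>pair_inverted\<close>. It is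
  not \<gamma>, because \<gamma> is its own partner and is inverted.\<close>

lemma count_inj:
  assumes v: "v \<in> carrier W" and g: "\<gamma> \<in> invs v"
  shows "(\<lambda>x. - \<rho> (r \<gamma>) x) ` (invs (r \<gamma>) - invs v) \<subseteq> invs (r \<gamma>) \<inter> invs v - {\<gamma>}"
    "inj_on (\<lambda>x. - \<rho> (r \<gamma>) x) (invs (r \<gamma>) - invs v)"
proof -
  have gp: "\<gamma> \<in> \<Phi>" "- \<rho> v \<gamma> \<in> \<Phi>" and rg: "\<gamma> \<in> roots" using g pos_root by (auto simp: invs_def)
  show "inj_on (\<lambda>x. - \<rho> (r \<gamma>) x) (invs (r \<gamma>) - invs v)" using rg by (auto intro: inj_onI)
  show "(\<lambda>x. - \<rho> (r \<gamma>) x) ` (invs (r \<gamma>) - invs v) \<subseteq> invs (r \<gamma>) \<inter> invs v - {\<gamma>}"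
  proof clarify
    fix x assume x: "x \<in> invs (r \<gamma>)" "x \<notin> invs v"
    have "\<rho> v x \<in> \<Phi>" using x not_invs[OF v] by (auto simp: invs_def)
    then have "- \<rho> v (- \<rho> (r \<gamma>) x) \<in> \<Phi>" using pair_inverted[OF v gp x(1)] by simp
    moreover have "- \<rho> (r \<gamma>) x \<in> invs (r \<gamma>)" using invs_r_pair(2)[OF gp(1) x(1)] .
    moreover have "- \<rho> (r \<gamma>) x \<noteq> \<gamma>"
    proof
      assume "- \<rho> (r \<gamma>) x = \<gamma>"
      then have "\<rho> (r \<gamma>) x = \<rho> (r \<gamma>) \<gamma>" using r_act_self[OF rg] by (metis minus_minus)
      then show False using x g rg by simp
    qed
    ultimately show "- \<rho> (r \<gamma>) x \<in> invs (r \<gamma>) \<inter> invs v - {\<gamma>}" by (auto simp: invs_def)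
  qed
qed

lemma self_inv: "\<gamma> \<in> \<Phi> \<Longrightarrow> \<gamma> \<in> invs (r \<gamma>)"
  by (simp add: invs_def r_act_self pos_root)

lemma refl_shortens:
  assumes v: "v \<in> carrier W" and g: "\<gamma> \<in> invs v"
  shows "len (v \<otimes> r \<gamma>) < len v"
proof -
  have gp: "\<gamma> \<in> \<Phi>" using g by (auto simp: invs_def)
  let ?I = "invs (r \<gamma>)"
  have f: "finite ?I" using finite_invs gp pos_root by simp
  have "card (?I - invs v) \<le> card (?I \<inter> invs v - {\<gamma>})"
    using count_inj[OF v g] f card_inj_on_le by blast
  also have "\<dots> < card (?I \<inter> invs v)" using f g self_inv[OF gp] by (intro psubset_card_mono) auto
  finally show ?thesis using count_refl[OF v gp] by simp
qed

text \<open>A drop of exactly one leaves no slack in \<open>count_inj\<close>: the pairing must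
  reach every inverted root of \<open>invs (r \<gamma>)\<close> other than \<gamma>. A root \<sigma>
  whose partner is inverted too would not be reached.\<close>

lemma short_pair:
  assumes v: "v \<in> carrier W" and g: "\<gamma> \<in> invs v" and l: "len (v \<otimes> r \<gamma>) + 1 = len v"
    and a: "\<sigma> \<in> invs (r \<gamma>)" "\<sigma> \<in> invs v" "\<sigma> \<noteq> \<gamma>"
  shows "\<rho> v (- \<rho> (r \<gamma>) \<sigma>) \<in> \<Phi>"
proof (rule ccontr)
  have gp: "\<gamma> \<in> \<Phi>" and rg: "\<gamma> \<in> roots" using g pos_root by (auto simp: invs_def)
  let ?I = "invs (r \<gamma>)" and ?t = "- \<rho> (r \<gamma>) \<sigma>"
  have f: "finite ?I" using finite_invs rg by simp
  assume n: "\<rho> v ?t \<notin> \<Phi>"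
  have t: "?t \<in> ?I" using invs_r_pair(2)[OF gp a(1)] .
  then have t': "?t \<in> invs v" using n not_invs[OF v] by (auto simp: invs_def)
  have "\<sigma> \<notin> (\<lambda>x. - \<rho> (r \<gamma>) x) ` (?I - invs v)"
  proof
    assume "\<sigma> \<in> (\<lambda>x. - \<rho> (r \<gamma>) x) ` (?I - invs v)"
    then obtain x where x: "x \<notin> invs v" "\<sigma> = - \<rho> (r \<gamma>) x" by blast
    then have "?t = x" using rg by (simp add: act_lin)
    then show False using x t' by simp
  qed
  then have "(\<lambda>x. - \<rho> (r \<gamma>) x) ` (?I - invs v) \<subseteq> ?I \<inter> invs v - {\<gamma>, \<sigma>}" using count_inj(1)[OF v g] by blast
  then have "card (?I - invs v) \<le> card (?I \<inter> invs v - {\<gamma>, \<sigma>})"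
    using count_inj(2)[OF v g] f card_inj_on_le by (metis finite_Diff finite_Int)
  moreover have "card (?I \<inter> invs v - {\<gamma>, \<sigma>}) + 2 = card (?I \<inter> invs v)"
  proof -
    have "{\<gamma>, \<sigma>} \<subseteq> ?I \<inter> invs v" using a g self_inv[OF gp] by simp
    then show ?thesis using a f card_Diff_subset[of "{\<gamma>, \<sigma>}" "?I \<inter> invs v"] card_mono[of "?I \<inter> invs v" "{\<gamma>, \<sigma>}"] by simp
  qed
  ultimately show False using count_refl[OF v gp] l by simp
qed

section \<open>Dominance\<close>

text \<open>Append the letters of \<open>inv g\<close> to \<open>v\<close> one at a time. The root
  deciding each step is inverted by \<open>g\<close>, hence not by \<open>v\<close>, so the length
  always grows.\<close>

lemma len_additive:
  assumes "g \<in> carrier W" "v \<in> carrier W" "invs v \<inter> invs g = {}"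
  shows "len (v \<otimes> inv g) = len v + len g"
  using assms(1,3)
proof (induction "len g" arbitrary: g)
  case 0
  then show ?case using len_zero[of g] assms(2) by simp
next
  case (Suc n)
  have "g \<noteq> \<one>" using Suc.hyps by auto
  then obtain s h where h: "s \<in> S" "h \<in> carrier W" "g = s \<otimes> h" "len g = len h + 1"
    "\<rho> (inv h) (\<alpha> s) \<in> \<Phi>" "invs g = insert (\<rho> (inv h) (\<alpha> s)) (invs h)" "\<rho> (inv h) (\<alpha> s) \<notin> invs h"
    using peel[OF Suc.prems(1)] by blast
  have l: "len (v \<otimes> inv h) = len v + len h" using Suc h by (intro Suc.hyps) auto
  have "\<rho> (v \<otimes> inv h) (\<alpha> s) \<in> \<Phi>" using Suc.prems h assms(2) not_invs[OF assms(2) h(5)] by auto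
  then have "len (v \<otimes> inv h \<otimes> s) = len v + len h + 1"
    using len_mult_simple_pos[of "v \<otimes> inv h" s] l h assms(2) by simp
  moreover have "v \<otimes> inv g = v \<otimes> inv h \<otimes> s" using h assms(2) by (simp add: inv_mult_group simple_inv m_assoc)
  ultimately show ?case using h by simp
qed

text \<open>Writing \<open>x\<close> for the root, \<open>v \<otimes> r x \<otimes> inv g\<close>
  equals \<open>v \<otimes> inv g \<otimes> s\<close>, which is one shorter than
  \<open>len v + len g\<close>. So \<open>r x\<close> cannot shorten \<open>v\<close> by more than
  one.\<close>

lemma short_of_additive:
  assumes "v \<in> carrier W" "g \<in> carrier W" "s \<in> S" "invs v \<inter> invs g = {}" "\<rho> (inv g) (\<alpha> s) \<in> invs v"
  shows "len (v \<otimes> r (\<rho> (inv g) (\<alpha> s))) + 1 = len v"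
proof -
  let ?x = "\<rho> (inv g) (\<alpha> s)"
  have rx: "r ?x = inv g \<otimes> s \<otimes> g" using r_conj[of "inv g" "\<alpha> s"] assms simple_root by (simp add: r_simple)
  have e: "(v \<otimes> r ?x) \<otimes> inv g = (v \<otimes> inv g) \<otimes> s" using assms unfolding rx by (simp add: m_assoc)
  have "- \<rho> (v \<otimes> inv g) (\<alpha> s) \<in> \<Phi>" using assms by (simp add: invs_def)
  then have "len (v \<otimes> inv g \<otimes> s) + 1 = len v + len g"
    using len_mult_simple_neg[of "v \<otimes> inv g" s] len_additive[of g v] assms by simp
  moreover have "len ((v \<otimes> r ?x) \<otimes> inv g) \<le> len (v \<otimes> r ?x) + len g"
    using len_mult_le[of "v \<otimes> r ?x" "inv g"] assms rx by simp
  ultimately have "len v \<le> len (v \<otimes> r ?x) + 1" unfolding e by linarith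
  then show ?thesis using refl_shortens[OF assms(1,5)] by linarith
qed

text \<open>Along the chain of suffixes of \<open>x\<close>, the first root that \<open>v\<close>
  also inverts is short for \<open>v\<close>: all earlier roots are disjoint from
  \<open>invs v\<close>, so lengths add up to that point.\<close>

lemma common_short_inversion:
  assumes "x \<in> carrier W" "v \<in> carrier W" "invs x \<inter> invs v \<noteq> {}"
  shows "\<exists>a \<in> invs x \<inter> invs v. len (v \<otimes> r a) + 1 = len v"
  using assms(1,3)
proof (induction "len x" arbitrary: x)
  case 0
  then show ?case using len_zero[of x] by simp
next
  case (Suc n)
  have "x \<noteq> \<one>" using Suc.hyps by auto
  then obtain s h where h: "s \<in> S" "h \<in> carrier W" "x = s \<otimes> h" "len x = len h + 1"
    "\<rho> (inv h) (\<alpha> s) \<in> \<Phi>" "invs x = insert (\<rho> (inv h) (\<alpha> s)) (invs h)" "\<rho> (inv h) (\<alpha> s) \<notin> invs h"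
    using peel[OF Suc.prems(1)] by blast
  show ?case
  proof (cases "invs h \<inter> invs v = {}")
    case True
    then have "\<rho> (inv h) (\<alpha> s) \<in> invs v" using Suc.prems h by auto
    then show ?thesis using short_of_additive[of v h s] h assms True by blast
  next
    case False
    then show ?thesis using Suc.hyps(1)[of h] Suc.hyps(2) h by auto
  qed
qed

section \<open>Depth and dominance of roots\<close>

definition depth :: "'v \<Rightarrow> nat" where
  "depth x = (LEAST n. \<exists>y \<in> carrier W. - \<rho> y x \<in> \<Phi> \<and> len y = n)"

lemma depth_le: "y \<in> carrier W \<Longrightarrow> - \<rho> y x \<in> \<Phi> \<Longrightarrow> depth x \<le> len y"
  unfolding depth_def by (rule Least_le) blast

lemma depth_attained:
  assumes "x \<in> \<Phi>" shows "\<exists>y \<in> carrier W. - \<rho> y x \<in> \<Phi> \<and> len y = depth x"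
proof -
  have "- \<rho> (r x) x \<in> \<Phi>" using assms by (simp add: r_act_self pos_root)
  then have "\<exists>n. \<exists>y \<in> carrier W. - \<rho> y x \<in> \<Phi> \<and> len y = n" using assms pos_root r_closed by blast
  from LeastI_ex[OF this] show ?thesis unfolding depth_def .
qed

text \<open>Dominance on arbitrary vectors, with \<open>w\<close> in place of its inverse. In this
  form it is preserved by \<open>W\<close> and, on roots, reversed by negation; on positive roots it
  agrees with \<open>dom_le\<close>.\<close>

definition dom :: "'v \<Rightarrow> 'v \<Rightarrow> bool" where
  "dom x y \<longleftrightarrow> (\<forall>w \<in> carrier W. - \<rho> w y \<in> \<Phi> \<longrightarrow> - \<rho> w x \<in> \<Phi>)"

lemma domD: "dom x y \<Longrightarrow> w \<in> carrier W \<Longrightarrow> - \<rho> w y \<in> \<Phi> \<Longrightarrow> - \<rho> w x \<in> \<Phi>"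
  by (simp add: dom_def)

lemma dom_act:
  assumes "u \<in> carrier W" "dom x y" shows "dom (\<rho> u x) (\<rho> u y)"
  unfolding dom_def
proof (intro ballI impI)
  fix w assume "w \<in> carrier W" "- \<rho> w (\<rho> u y) \<in> \<Phi>"
  then show "- \<rho> w (\<rho> u x) \<in> \<Phi>" using assms(1) domD[OF assms(2), of "w \<otimes> u"] by simp
qed

lemma dom_neg:
  assumes "dom x y" "x \<in> roots" "y \<in> roots" shows "dom (- y) (- x)"
  unfolding dom_def
proof (intro ballI impI)
  fix w assume w: "w \<in> carrier W" "- \<rho> w (- x) \<in> \<Phi>"
  then have "- \<rho> w x \<notin> \<Phi>" using not_pos_neg by (auto simp: act_lin)
  then show "- \<rho> w (- y) \<in> \<Phi>" using domD[OF assms(1) w(1)] neg_iff[of "\<rho> w y"] w assms by (auto simp: act_lin)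
qed

text \<open>Infinite descent on the length of \<open>w\<close>. The shorter element
  \<open>w \<otimes> r \<kappa>\<close> inverts \<xi> and the image of \<kappa> under
  \<open>r \<xi>\<close> followed by \<open>r \<kappa>\<close>. With
  \<open>b = - B \<kappa> \<xi>\<close> their product is minus the Chebyshev value
  \<open>4 * b * b * b - 3 * b\<close>, again at most -1.\<close>

lemma disjoint_pair:
  assumes "w \<in> carrier W" "\<kappa> \<in> invs w" "\<xi> \<in> invs w"
  shows "B \<kappa> \<xi> > -1"
proof (rule ccontr)
  assume "\<not> B \<kappa> \<xi> > -1"
  then have "B \<kappa> \<xi> \<le> -1" by simp
  then show False using assms
  proof (induction "len w" arbitrary: w \<kappa> rule: less_induct)
    case less
    define b where "b = - B \<kappa> \<xi>"
    have b: "b \<ge> 1" using less.prems b_def by simp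
    have p: "\<kappa> \<in> \<Phi>" "\<xi> \<in> \<Phi>" "- \<rho> w \<kappa> \<in> \<Phi>" "- \<rho> w \<xi> \<in> \<Phi>" using less.prems by (auto simp: invs_def)
    note R = p(1,2)[THEN pos_root]
    let ?w = "w \<otimes> r \<kappa>" and ?k = "\<rho> (r \<kappa>) (\<rho> (r \<xi>) \<kappa>)"
    have w: "w \<in> carrier W" "?w \<in> carrier W" using less.prems R by auto
    have l: "len ?w < len w" using refl_shortens less.prems by blast
    have Bs: "B \<xi> \<kappa> = - b" "B \<kappa> \<xi> = - b" using b_def B_sym[of \<xi> \<kappa>] by auto
    have e1: "\<rho> (r \<kappa>) \<xi> = \<xi> + (2 * b) *\<^sub>R \<kappa>" using R Bs by (simp add: r_act)
    have e2: "\<rho> (r \<xi>) \<kappa> = \<kappa> + (2 * b) *\<^sub>R \<xi>" using R Bs by (simp add: r_act)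
    have e3: "?k = (4 * b * b - 1) *\<^sub>R \<kappa> + (2 * b) *\<^sub>R \<xi>"
      unfolding e2 using R by (simp add: act_lin r_act_self e1 algebra_simps)
    have bb: "4 * b * b - 1 \<ge> 0" using b mult_mono[of 1 b 1 b] by simp
    have kp: "?k \<in> \<Phi>" using K_comb_pos[OF _ e3] R p b bb pos_K by simp
    have n1: "- \<rho> ?w \<xi> = 1 *\<^sub>R (- \<rho> w \<xi>) + (2 * b) *\<^sub>R (- \<rho> w \<kappa>)" using w R e1 by (simp add: act_lin)
    have "- \<rho> ?w \<xi> \<in> \<Phi>" using K_comb_pos[OF _ n1] p b pos_K w(2) R by simp
    then have x: "\<xi> \<in> invs ?w" using p by (simp add: invs_def)
    have n2: "- \<rho> ?w ?k = 1 *\<^sub>R (- \<rho> w \<kappa>) + (2 * b) *\<^sub>R (- \<rho> w \<xi>)" using w R e2 by (simp add: act_lin)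
    have "- \<rho> ?w ?k \<in> \<Phi>" using K_comb_pos[OF _ n2] p b pos_K w(2) R by simp
    then have k: "?k \<in> invs ?w" using kp by (simp add: invs_def)
    have "B ?k \<xi> = 3 * b - 4 * b * b * b" unfolding e3 using R Bs by (simp add: B_lin root_norm algebra_simps)
    moreover have "4 * b * b * b - 3 * b - 1 = (b - 1) * (2 * b + 1) * (2 * b + 1)" by (simp add: algebra_simps)
    moreover have "(b - 1) * (2 * b + 1) * (2 * b + 1) \<ge> 0" using b by simp
    ultimately have "B ?k \<xi> \<le> -1" by linarith
    then show ?case using less.hyps[OF l _ w(2) k x] by simp
  qed
qed

text \<open>For a plane rotation by \<theta>, the sum of its \<open>p\<close>-th power and the
  inverse of that power is then a nonpositive scalar. This allows positivity arguments without
  knowing that \<theta> is a rational multiple of \<open>pi\<close>.\<close>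

lemma cos_multiple_nonpos:
  assumes "0 < (\<theta>::real)" "\<theta> < pi"
  obtains p :: nat where "p \<ge> 1" "cos (real p * \<theta>) \<le> 0"
proof
  let ?p = "nat \<lceil>pi / 2 / \<theta>\<rceil>"
  have z: "pi / 2 / \<theta> > 0" using assms by simp
  have c: "real ?p \<ge> pi / 2 / \<theta>" by (rule real_nat_ceiling_ge)
  have c2: "real ?p < pi / 2 / \<theta> + 1" using z ceiling_correct[of "pi / 2 / \<theta>"] by linarith
  have lo: "real ?p * \<theta> \<ge> pi / 2" using c assms pos_divide_le_eq[of \<theta> "pi / 2" "real ?p"] by simp
  have "real ?p * \<theta> < (pi / 2 / \<theta> + 1) * \<theta>" using c2 assms by (intro mult_strict_right_mono) auto
  moreover have "(pi / 2 / \<theta> + 1) * \<theta> = pi / 2 + \<theta>" using assms by (simp add: field_simps)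
  ultimately have hi: "real ?p * \<theta> < pi / 2 + \<theta>" by simp
  have "cos (real ?p * \<theta> - pi) \<ge> 0" using lo hi assms by (intro cos_ge_zero) auto
  then show "cos (real ?p * \<theta>) \<le> 0" by (simp add: cos_diff)
  have "real ?p > 0" using c z by linarith
  then show "?p \<ge> 1" by linarith
qed

text \<open>The roots \<open>\<tau> n\<close> are those obtained by applying alternating products of the two reflections. They
  rotate in a plane, so a sign change from positive to negative occurs.\<close>

lemma jointly_negative:
  assumes R: "\<kappa> \<in> roots" "\<xi> \<in> roots" and b: "\<bar>B \<kappa> \<xi>\<bar> < 1"
  shows "\<exists>w \<in> carrier W. - \<rho> w \<kappa> \<in> \<Phi> \<and> - \<rho> w \<xi> \<in> \<Phi>"
proof -
  define \<theta> where "\<theta> = arccos (- B \<kappa> \<xi>)"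
  have ct: "cos \<theta> = - B \<kappa> \<xi>" unfolding \<theta>_def using b by (intro cos_arccos) auto
  have th: "0 < \<theta>" "\<theta> < pi" unfolding \<theta>_def using arccos_lt_bounded[of "- B \<kappa> \<xi>"] b by auto
  have st: "sin \<theta> > 0" using th by (rule sin_gt_zero)
  \<comment> \<open>The coefficients are Chebyshev values: they solve the recurrence
    \<open>rec\<close> governing alternating products of the two reflections, normalised so that
    \<open>\<tau> 0 = \<kappa>\<close>.\<close>
  define \<tau> where "\<tau> n = (sin (real (n + 1) * \<theta>) / sin \<theta>) *\<^sub>R \<kappa> + (sin (real n * \<theta>) / sin \<theta>) *\<^sub>R \<xi>" for n
  have sum: "\<tau> (n + 2 * p) + \<tau> n = (2 * cos (real p * \<theta>)) *\<^sub>R \<tau> (n + p)" for n p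
  proof -
    have a: "sin (x + 2 * y) + sin x = 2 * cos y * sin (x + y)" for x y :: real
    proof -
      have h: "sin (z + y) + sin (z - y) = 2 * cos y * sin z" for z :: real by (simp add: sin_add sin_diff)
      have e: "(x + y) + y = x + 2 * y" "(x + y) - y = x" by simp_all
      show ?thesis using h[of "x + y"] unfolding e .
    qed
    have "sin (real (n + 2 * p + 1) * \<theta>) + sin (real (n + 1) * \<theta>) = 2 * cos (real p * \<theta>) * sin (real (n + p + 1) * \<theta>)"
      "sin (real (n + 2 * p) * \<theta>) + sin (real n * \<theta>) = 2 * cos (real p * \<theta>) * sin (real (n + p) * \<theta>)"
      using a[of "real (n + 1) * \<theta>" "real p * \<theta>"] a[of "real n * \<theta>" "real p * \<theta>"] by (simp_all add: algebra_simps)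
    then have E: "sin (real (n + 2 * p + 1) * \<theta>) / sin \<theta> + sin (real (n + 1) * \<theta>) / sin \<theta> = 2 * cos (real p * \<theta>) * (sin (real (n + p + 1) * \<theta>) / sin \<theta>)"
      "sin (real (n + 2 * p) * \<theta>) / sin \<theta> + sin (real n * \<theta>) / sin \<theta> = 2 * cos (real p * \<theta>) * (sin (real (n + p) * \<theta>) / sin \<theta>)"
      by (metis add_divide_distrib times_divide_eq_right)+
    have C: "(a1 *\<^sub>R \<kappa> + b1 *\<^sub>R \<xi>) + (a2 *\<^sub>R \<kappa> + b2 *\<^sub>R \<xi>) = (a1 + a2) *\<^sub>R \<kappa> + (b1 + b2) *\<^sub>R \<xi>" for a1 a2 b1 b2
      by (simp add: algebra_simps)
    show ?thesis unfolding \<tau>_def C E by (simp add: scaleR_add_right)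
  qed
  have rec: "\<tau> (n + 2) = (- 2 * B \<kappa> \<xi>) *\<^sub>R \<tau> (n + 1) - \<tau> n" for n
    using sum[of n 1] ct by (simp add: eq_diff_eq)
  have t0: "\<tau> 0 = \<kappa>" unfolding \<tau>_def using st by simp
  have t1: "\<tau> 1 = \<xi> - (2 * B \<xi> \<kappa>) *\<^sub>R \<kappa>" unfolding \<tau>_def using st ct B_sym[of \<kappa> \<xi>] sin_double[of \<theta>] by simp
  have P: "\<exists>w \<in> carrier W. (\<rho> w \<kappa> = \<tau> (n + 1) \<and> \<rho> w \<xi> = - \<tau> n) \<or> (\<rho> w \<kappa> = - \<tau> n \<and> \<rho> w \<xi> = \<tau> (n + 1))" for n
  proof (induction n)
    case 0
    then show ?case using R t0 t1 by (intro bexI[of _ "r \<kappa>"]) (simp_all add: r_act_self, simp add: r_act)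
  next
    case (Suc n)
    then obtain w where w: "w \<in> carrier W" "(\<rho> w \<kappa> = \<tau> (n + 1) \<and> \<rho> w \<xi> = - \<tau> n) \<or> (\<rho> w \<kappa> = - \<tau> n \<and> \<rho> w \<xi> = \<tau> (n + 1))" by blast
    have rec': "\<tau> (Suc n + 1) = (- 2 * B \<kappa> \<xi>) *\<^sub>R \<tau> (n + 1) - \<tau> n" using rec[of n] by simp
    from w(2) show ?case
    proof
      assume a: "\<rho> w \<kappa> = \<tau> (n + 1) \<and> \<rho> w \<xi> = - \<tau> n"
      have "\<rho> (w \<otimes> r \<kappa>) \<kappa> = - \<tau> (Suc n)" using a w R by (simp add: r_act_self act_lin)
      moreover have "\<rho> (w \<otimes> r \<kappa>) \<xi> = \<tau> (Suc n + 1)" unfolding rec' using a w R B_sym[of \<kappa> \<xi>] by (simp add: r_act act_lin)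
      ultimately show ?thesis using w R by (intro bexI[of _ "w \<otimes> r \<kappa>"]) auto
    next
      assume a: "\<rho> w \<kappa> = - \<tau> n \<and> \<rho> w \<xi> = \<tau> (n + 1)"
      have "\<rho> (w \<otimes> r \<xi>) \<xi> = - \<tau> (Suc n)" using a w R by (simp add: r_act_self act_lin)
      moreover have "\<rho> (w \<otimes> r \<xi>) \<kappa> = \<tau> (Suc n + 1)" unfolding rec' using a w R by (simp add: r_act act_lin)
      ultimately show ?thesis using w R by (intro bexI[of _ "w \<otimes> r \<xi>"]) auto
    qed
  qed
  have tr: "\<tau> n \<in> roots" for n
  proof -
    obtain w where "w \<in> carrier W" "\<rho> w \<kappa> = - \<tau> n \<or> \<rho> w \<xi> = - \<tau> n" using P[of n] by blast
    then show ?thesis using R by (metis act_root_iff neg_root_iff)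
  qed
  obtain p :: nat where p: "p \<ge> 1" "cos (real p * \<theta>) \<le> 0" using cos_multiple_nonpos th by blast
  have s0: "\<tau> (n + 2 * p) + (\<tau> n + (- 2 * cos (real p * \<theta>)) *\<^sub>R \<tau> (n + p)) = 0" for n
    using sum[of n p] by (simp add: algebra_simps)
  \<comment> \<open>Three roots in progression with step \<open>p\<close> have a vanishing
    nonnegative combination, so they cannot all have the same sign.\<close>
  have np: "\<not> (\<tau> n \<in> \<Phi> \<and> \<tau> (n + p) \<in> \<Phi> \<and> \<tau> (n + 2 * p) \<in> \<Phi>)" for n
  proof
    assume a: "\<tau> n \<in> \<Phi> \<and> \<tau> (n + p) \<in> \<Phi> \<and> \<tau> (n + 2 * p) \<in> \<Phi>"
    then have "(- 2 * cos (real p * \<theta>)) *\<^sub>R \<tau> (n + p) \<in> K" using p by (intro K_scale pos_K) auto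
    then show False using s0[of n] a pos_K K_add K_sum_zero(1) root_nz tr by metis
  qed
  have nn: "\<not> (- \<tau> n \<in> \<Phi> \<and> - \<tau> (n + p) \<in> \<Phi> \<and> - \<tau> (n + 2 * p) \<in> \<Phi>)" for n
  proof
    assume a: "- \<tau> n \<in> \<Phi> \<and> - \<tau> (n + p) \<in> \<Phi> \<and> - \<tau> (n + 2 * p) \<in> \<Phi>"
    then have k: "(- 2 * cos (real p * \<theta>)) *\<^sub>R (- \<tau> (n + p)) \<in> K" using p by (intro K_scale pos_K) auto
    have "- \<tau> (n + 2 * p) + (- \<tau> n + (- 2 * cos (real p * \<theta>)) *\<^sub>R (- \<tau> (n + p))) = 0"
      using s0[of n] by (simp add: algebra_simps)
    then show False using a k pos_K K_add K_sum_zero(1) root_nz tr by (metis neg_root_iff)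
  qed
  obtain i where i: "\<tau> i \<in> \<Phi>" using nn[of 0] pos_or_neg[OF tr] by blast
  \<comment> \<open>The sequence is positive somewhere and cannot stay positive. Where it turns
    negative, the two images provided by \<open>P\<close>, namely \<open>\<tau> (k + 1)\<close> and
    \<open>- \<tau> k\<close>, are negative together.\<close>
  have "\<exists>k. \<tau> k \<in> \<Phi> \<and> \<tau> (k + 1) \<notin> \<Phi>"
  proof (rule ccontr)
    assume "\<nexists>k. \<tau> k \<in> \<Phi> \<and> \<tau> (k + 1) \<notin> \<Phi>"
    then have "\<tau> (i + n) \<in> \<Phi>" for n by (induction n) (use i in auto)
    then show False using np[of i] i by blast
  qed
  then obtain k where k: "\<tau> k \<in> \<Phi>" "- \<tau> (k + 1) \<in> \<Phi>" using neg_iff[OF tr] by blast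
  then show ?thesis using P[of k] by (metis minus_minus)
qed

text \<open>A product at most -1 is excluded because \<open>r \<beta>\<close> would invert both
  roots. A product strictly between -1 and 1 is excluded because some element makes \<beta> and
  \<open>- \<theta>\<close> negative together.\<close>

lemma dom_B:
  assumes "\<theta> \<in> \<Phi>" "\<beta> \<in> \<Phi>" "dom \<theta> \<beta>" "\<theta> \<noteq> \<beta>" shows "B \<theta> \<beta> \<ge> 1"
proof (rule ccontr)
  assume n: "\<not> B \<theta> \<beta> \<ge> 1"
  note R = assms(1,2)[THEN pos_root]
  show False
  proof (cases "B \<theta> \<beta> \<le> -1")
    case True
    have b: "\<beta> \<in> invs (r \<beta>)" using self_inv assms by blast
    then have "\<theta> \<in> invs (r \<beta>)" using domD[OF assms(3)] assms(1) R by (simp add: invs_def)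
    then show False using disjoint_pair[of "r \<beta>" \<theta> \<beta>] b R True by simp
  next
    case False
    then have "\<bar>B \<beta> (- \<theta>)\<bar> < 1" using n B_sym[of \<theta> \<beta>] by (simp add: B_lin)
    then obtain w where "w \<in> carrier W" "- \<rho> w \<beta> \<in> \<Phi>" "- \<rho> w (- \<theta>) \<in> \<Phi>"
      using jointly_negative[of \<beta> "- \<theta>"] R by auto
    then show False using domD[OF assms(3), of w] not_pos_neg by (simp add: act_lin)
  qed
qed

section \<open>Simple systems of subspaces\<close>

text \<open>These are the canonical simple roots of the root subsystem cut out by \<open>U\<close>.\<close>

definition sbase :: "'v set \<Rightarrow> 'v set" where
  "sbase U = {x \<in> \<Phi> \<inter> U. \<exists>y \<in> carrier W. invs y \<inter> U = {x}}"

lemma sbaseD: "x \<in> sbase U \<Longrightarrow> x \<in> \<Phi>" "x \<in> sbase U \<Longrightarrow> x \<in> U" "x \<in> sbase U \<Longrightarrow> x \<in> roots"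
  by (auto simp: sbase_def pos_root)

lemma sbase_witness:
  assumes "x \<in> sbase U"
  obtains y where "y \<in> carrier W" "- \<rho> y x \<in> \<Phi>" "\<And>z. z \<in> \<Phi> \<Longrightarrow> z \<in> U \<Longrightarrow> z \<noteq> x \<Longrightarrow> \<rho> y z \<in> \<Phi>"
proof -
  obtain y where y: "y \<in> carrier W" "invs y \<inter> U = {x}" using assms by (auto simp: sbase_def)
  then have "- \<rho> y x \<in> \<Phi>" by (auto simp: invs_def)
  moreover have "\<rho> y z \<in> \<Phi>" if "z \<in> \<Phi>" "z \<in> U" "z \<noteq> x" for z
    using not_invs[OF y(1) that(1)] y(2) that by blast
  ultimately show ?thesis using that y by blast
qed

lemma simple_sbase:
  assumes "s \<in> S" "\<alpha> s \<in> U" shows "\<alpha> s \<in> sbase U"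
proof -
  have "invs s = {\<alpha> s}" using invs_left(1)[of \<one> s] assms simple_pos by simp
  then show ?thesis using assms simple_pos S_closed by (auto simp: sbase_def)
qed

text \<open>The first inversion set in the chain of suffixes of \<open>x\<close> that meets
  \<open>U\<close> meets it in a single root, which is simple by definition.\<close>

lemma sbase_inverted:
  assumes "x \<in> carrier W" "invs x \<inter> U \<noteq> {}"
  shows "\<exists>\<delta> \<in> sbase U. \<delta> \<in> invs x"
  using assms
proof (induction "len x" arbitrary: x)
  case 0
  then show ?case using len_zero[of x] by simp
next
  case (Suc n)
  have "x \<noteq> \<one>" using Suc.hyps by auto
  then obtain s h where h: "s \<in> S" "h \<in> carrier W" "x = s \<otimes> h" "len x = len h + 1"
    "\<rho> (inv h) (\<alpha> s) \<in> \<Phi>" "invs x = insert (\<rho> (inv h) (\<alpha> s)) (invs h)" "\<rho> (inv h) (\<alpha> s) \<notin> invs h"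
    using peel[OF Suc.prems(1)] by blast
  show ?case
  proof (cases "invs h \<inter> U = {}")
    case True
    then have "invs x \<inter> U = {\<rho> (inv h) (\<alpha> s)}" using Suc.prems h by auto
    then have "\<rho> (inv h) (\<alpha> s) \<in> sbase U" using Suc.prems h(5) unfolding sbase_def by blast
    then show ?thesis using h by blast
  next
    case False
    then show ?thesis using Suc.hyps(1)[of h] Suc.hyps(2) h by auto
  qed
qed

lemma act_r_subspace:
  assumes "subspace U" "\<delta> \<in> roots" "\<delta> \<in> U" "x \<in> U" shows "\<rho> (r \<delta>) x \<in> U"
  using assms by (simp add: r_act subspace_diff subspace_scale)

text \<open>If \<sigma> became negative, it would have a partner in \<open>U\<close> summing with it
  to a multiple of \<delta>. An element inverting only \<delta> within \<open>U\<close> must invert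
  one of the two, so the partner is \<delta>, and then \<sigma> is \<delta>.\<close>

lemma sbase_permutes:
  assumes "subspace U" "\<delta> \<in> sbase U" "\<sigma> \<in> \<Phi>" "\<sigma> \<in> U" "\<sigma> \<noteq> \<delta>"
  shows "\<rho> (r \<delta>) \<sigma> \<in> \<Phi>"
proof (rule ccontr)
  note d = sbaseD[OF assms(2)]
  assume "\<rho> (r \<delta>) \<sigma> \<notin> \<Phi>"
  then have s: "\<sigma> \<in> invs (r \<delta>)" using not_invs[of "r \<delta>" \<sigma>] assms d by auto
  obtain y where y: "y \<in> carrier W" "- \<rho> y \<delta> \<in> \<Phi>" "\<And>z. z \<in> \<Phi> \<Longrightarrow> z \<in> U \<Longrightarrow> z \<noteq> \<delta> \<Longrightarrow> \<rho> y z \<in> \<Phi>"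
    using sbase_witness assms(2) by blast
  let ?t = "- \<rho> (r \<delta>) \<sigma>"
  have n: "- \<rho> y ?t \<in> \<Phi>" using pair_inverted[OF y(1) d(1) y(2) s] y(3) assms by blast
  have "?t \<in> U" using act_r_subspace assms d by (simp add: subspace_neg)
  moreover have "?t \<in> \<Phi>" using s by (simp add: invs_def)
  ultimately have "?t = \<delta>" using y(3) n not_pos_neg by blast
  then have "\<rho> (r \<delta>) \<sigma> = \<rho> (r \<delta>) \<delta>" using r_act_self[OF d(3)] by (metis minus_minus)
  then show False using assms d by simp
qed

text \<open>A positive product would make \<epsilon> a nonnegative combination of \<delta> and the
  reflected root, both different from \<epsilon>; then \<epsilon> could not be inverted alone within
  \<open>U\<close>.\<close>

lemma sbase_obtuse:
  assumes "subspace U" "\<delta> \<in> sbase U" "\<epsilon> \<in> sbase U" "\<delta> \<noteq> \<epsilon>"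
  shows "B \<delta> \<epsilon> \<le> 0"
proof (rule ccontr)
  assume b: "\<not> B \<delta> \<epsilon> \<le> 0"
  note d = sbaseD[OF assms(2)] and e = sbaseD[OF assms(3)]
  let ?s = "\<rho> (r \<delta>) \<epsilon>"
  have s: "?s \<in> \<Phi>" "?s \<in> U" using sbase_permutes act_r_subspace assms d e by auto
  have se: "?s = \<epsilon> - (2 * B \<delta> \<epsilon>) *\<^sub>R \<delta>" using r_act d B_sym by simp
  then have ne: "?s \<noteq> \<epsilon>" using b root_nz[OF d(3)] by simp
  obtain y where y: "y \<in> carrier W" "- \<rho> y \<epsilon> \<in> \<Phi>" "\<And>z. z \<in> \<Phi> \<Longrightarrow> z \<in> U \<Longrightarrow> z \<noteq> \<epsilon> \<Longrightarrow> \<rho> y z \<in> \<Phi>"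
    using sbase_witness assms(3) by blast
  have "\<epsilon> = ?s + (2 * B \<delta> \<epsilon>) *\<^sub>R \<delta>" using se by simp
  then have "\<rho> y \<epsilon> = \<rho> y ?s + (2 * B \<delta> \<epsilon>) *\<^sub>R \<rho> y \<delta>" using y(1) by (metis act_lin(1,2))
  moreover have "\<rho> y ?s + (2 * B \<delta> \<epsilon>) *\<^sub>R \<rho> y \<delta> \<in> K"
    using y(3)[OF s ne] y(3)[OF d(1,2)] assms(4) b by (intro K_add K_scale pos_K) auto
  ultimately show False using pos_not_neg_K[OF y(2)] by (metis minus_minus)
qed

text \<open>Let a shortest \<open>y\<close> make \<sigma> negative and let \<delta> be a simple root
  it inverts. Reflecting in \<delta> lowers the depth. The product with \<delta> is positive, since
  otherwise the shorter \<open>y \<otimes> r \<delta>\<close> would make \<sigma> negative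
  too.\<close>

lemma pos_in_sbase_cone:
  assumes "subspace U" "\<sigma> \<in> \<Phi>" "\<sigma> \<in> U"
  shows "\<sigma> \<in> convex_cone hull (sbase U)"
  using assms(2,3)
proof (induction "depth \<sigma>" arbitrary: \<sigma> rule: less_induct)
  case less
  obtain y where y: "y \<in> carrier W" "- \<rho> y \<sigma> \<in> \<Phi>" "len y = depth \<sigma>" using depth_attained less.prems by blast
  then have "invs y \<inter> U \<noteq> {}" using less.prems by (auto simp: invs_def)
  then obtain \<delta> where d: "\<delta> \<in> sbase U" "\<delta> \<in> invs y" using sbase_inverted y by blast
  note D = sbaseD[OF d(1)]
  show ?case
  proof (cases "\<sigma> = \<delta>")
    case True
    then show ?thesis using d by (simp add: hull_inc)
  next
    case False
    let ?s = "\<rho> (r \<delta>) \<sigma>" and ?y = "y \<otimes> r \<delta>"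
    have s: "?s \<in> \<Phi>" "?s \<in> U" using sbase_permutes act_r_subspace assms less.prems d D False by auto
    have l: "len ?y < len y" using refl_shortens y d by blast
    have "- \<rho> ?y ?s \<in> \<Phi>" using y D by simp
    then have "depth ?s < depth \<sigma>" using depth_le[of ?y ?s] l y D by simp
    then have h: "?s \<in> convex_cone hull (sbase U)" using less.hyps s by blast
    have se: "?s = \<sigma> - (2 * B \<sigma> \<delta>) *\<^sub>R \<delta>" using r_act D by simp
    have "B \<sigma> \<delta> > 0"
    proof (rule ccontr)
      assume b: "\<not> B \<sigma> \<delta> > 0"
      have e: "- \<rho> ?y \<sigma> = 1 *\<^sub>R (- \<rho> y \<sigma>) + (- 2 * B \<sigma> \<delta>) *\<^sub>R (- \<rho> y \<delta>)" using se y D by (simp add: act_lin)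
      have "- \<rho> ?y \<sigma> \<in> \<Phi>" using y D d b less.prems
        by (intro K_comb_pos[OF _ e] pos_K) (auto simp: invs_def pos_root)
      then show False using depth_le[of ?y \<sigma>] l y D by simp
    qed
    then have "?s + (2 * B \<sigma> \<delta>) *\<^sub>R \<delta> \<in> convex_cone hull (sbase U)"
      by (intro convex_cone_hull_add[OF h] convex_cone_hull_mul hull_inc d(1)) simp
    then show ?thesis using se by simp
  qed
qed

text \<open>With coefficients of opposite signs, an element inverting only \<epsilon> within
  \<open>U\<close> would make \<sigma> negative as well. So \<sigma> is \<epsilon>, and \<delta>
  would be a multiple of \<epsilon>.\<close>

lemma sbase_coords_pos:
  assumes "subspace U" "\<delta> \<in> sbase U" "\<epsilon> \<in> sbase U" "\<delta> \<noteq> \<epsilon>"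
    and "\<sigma> \<in> \<Phi>" "\<sigma> = a *\<^sub>R \<delta> + b *\<^sub>R \<epsilon>"
  shows "a \<ge> 0 \<and> b \<ge> 0"
proof -
  have main: False if de: "\<delta> \<in> sbase U" "\<epsilon> \<in> sbase U" "\<delta> \<noteq> \<epsilon>" and s: "\<sigma> = a *\<^sub>R \<delta> + b *\<^sub>R \<epsilon>" and a: "a < 0"
    for \<delta> \<epsilon> a b
  proof -
    note d = sbaseD[OF de(1)] and e = sbaseD[OF de(2)]
    have sU: "\<sigma> \<in> U" using s d e assms(1) by (simp add: subspace_add subspace_scale)
    have b: "b \<ge> 0"
    proof (rule ccontr)
      assume "\<not> b \<ge> 0"
      then have "(- a) *\<^sub>R \<delta> + (- b) *\<^sub>R \<epsilon> \<in> K" using a d e by (intro K_add K_scale pos_K) auto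
      then show False using s pos_not_neg_K[OF assms(5)] by simp
    qed
    obtain y where y: "y \<in> carrier W" "- \<rho> y \<epsilon> \<in> \<Phi>" "\<And>z. z \<in> \<Phi> \<Longrightarrow> z \<in> U \<Longrightarrow> z \<noteq> \<epsilon> \<Longrightarrow> \<rho> y z \<in> \<Phi>"
      using sbase_witness de(2) by blast
    have "- \<rho> y \<sigma> = (- a) *\<^sub>R \<rho> y \<delta> + b *\<^sub>R (- \<rho> y \<epsilon>)" using s y by (simp add: act_lin)
    also have "\<dots> \<in> K" using a b y d de(3) by (intro K_add K_scale pos_K) auto
    finally have "\<rho> y \<sigma> \<notin> \<Phi>" using pos_not_neg_K by blast
    then have "\<sigma> = \<epsilon>" using y(3) assms(5) sU by blast
    then have "(- a) *\<^sub>R \<delta> = (b - 1) *\<^sub>R \<epsilon>" using s by (simp add: algebra_simps)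
    then have "(1 / (- a)) *\<^sub>R ((- a) *\<^sub>R \<delta>) = ((b - 1) / (- a)) *\<^sub>R \<epsilon>" by simp
    then have "\<delta> = ((b - 1) / (- a)) *\<^sub>R \<epsilon>" using a by simp
    then show False using unit_multiple d e de(3) by blast
  qed
  have "\<sigma> = b *\<^sub>R \<epsilon> + a *\<^sub>R \<delta>" using assms(6) by simp
  then show ?thesis using main[OF assms(2,3,4,6)] main[OF assms(3,2) _ \<open>\<sigma> = b *\<^sub>R \<epsilon> + a *\<^sub>R \<delta>\<close>] assms(4) by fastforce
qed

section \<open>Two simple roots of a subsystem and the roots they span\<close>

lemma sbase_coords:
  assumes "subspace U" "\<delta> \<in> sbase U" "\<epsilon> \<in> sbase U" "\<delta> \<noteq> \<epsilon>"
    and "\<sigma> \<in> roots" "\<sigma> = a *\<^sub>R \<delta> + b *\<^sub>R \<epsilon>"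
  shows "a * b \<ge> 0"
proof (cases "\<sigma> \<in> \<Phi>")
  case True
  then show ?thesis using sbase_coords_pos assms by (metis mult_nonneg_nonneg)
next
  case False
  then have "- \<sigma> \<in> \<Phi>" using neg_iff[OF assms(5)] by simp
  moreover have "- \<sigma> = (- a) *\<^sub>R \<delta> + (- b) *\<^sub>R \<epsilon>" using assms(6) by simp
  ultimately have "- a \<ge> 0 \<and> - b \<ge> 0" using sbase_coords_pos assms(1-4) by blast
  then show ?thesis by (simp add: mult_nonpos_nonpos)
qed

text \<open>The coefficients would be nonnegative and the products of \<eta> with \<delta> and
  \<epsilon> nonpositive, so \<eta> would have nonpositive norm.\<close>

lemma sbase_not_comb:
  assumes "subspace U" "\<delta> \<in> sbase U" "\<epsilon> \<in> sbase U" "\<eta> \<in> sbase U" "\<eta> \<noteq> \<delta>" "\<eta> \<noteq> \<epsilon>" "\<delta> \<noteq> \<epsilon>"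
  shows "\<eta> \<noteq> a *\<^sub>R \<delta> + b *\<^sub>R \<epsilon>"
proof
  assume e: "\<eta> = a *\<^sub>R \<delta> + b *\<^sub>R \<epsilon>"
  have ab: "a \<ge> 0 \<and> b \<ge> 0" using sbase_coords_pos[OF assms(1,2,3,7) sbaseD(1)[OF assms(4)] e] .
  have "B \<eta> \<delta> \<le> 0" "B \<eta> \<epsilon> \<le> 0" using sbase_obtuse assms by auto
  then have "a * B \<eta> \<delta> + b * B \<eta> \<epsilon> \<le> 0" using ab by (simp add: mult_nonneg_nonpos add_nonpos_nonpos)
  moreover have "B \<eta> \<eta> = a * B \<eta> \<delta> + b * B \<eta> \<epsilon>" using e B_lin(2,4) by metis
  ultimately show False using root_norm sbaseD(3) assms(4) by fastforce
qed

text \<open>Two successive images of \<epsilon> under the reflections have coordinates of equal sign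
  only for these values. They are the cosines of \<open>pi / 2\<close> and \<open>pi / 3\<close>,
  and everything from the cosine of \<open>pi / 4\<close> on; no finer list is needed for the rank
  three cases.\<close>

lemma sbase_gram:
  assumes "subspace U" "\<delta> \<in> sbase U" "\<epsilon> \<in> sbase U" "\<delta> \<noteq> \<epsilon>"
  defines "g \<equiv> - B \<delta> \<epsilon>"
  shows "g = 0 \<or> g = 1 / 2 \<or> 2 * g\<^sup>2 \<ge> 1"
proof (rule ccontr)
  assume n: "\<not> ?thesis"
  note d = sbaseD[OF assms(2)] and e = sbaseD[OF assms(3)]
  have g0: "g > 0" using sbase_obtuse assms(1-4) n unfolding g_def by fastforce
  have Bs: "B \<delta> \<epsilon> = - g" "B \<epsilon> \<delta> = - g" using B_sym[of \<epsilon> \<delta>] by (simp_all add: g_def)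
  let ?s = "\<rho> (r \<epsilon>) (\<rho> (r \<delta>) \<epsilon>)"
  have s1: "?s = (2 * g) *\<^sub>R \<delta> + (4 * g\<^sup>2 - 1) *\<^sub>R \<epsilon>"
    using d e Bs by (simp add: r_act B_lin root_norm algebra_simps power2_eq_square scaleR_2)
  have "(2 * g) * (4 * g\<^sup>2 - 1) \<ge> 0" using sbase_coords[OF assms(1-4) _ s1] d e by simp
  then have "4 * g\<^sup>2 - 1 \<ge> 0" using g0 by (simp add: zero_le_mult_iff)
  moreover have "4 * g\<^sup>2 - 1 \<noteq> 0"
  proof
    assume "4 * g\<^sup>2 - 1 = 0"
    then have "(2 * g)\<^sup>2 = 1\<^sup>2" by (simp add: power_mult_distrib)
    then show False using n g0 power2_eq_iff_nonneg[of "2 * g" 1] by simp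
  qed
  ultimately have p: "4 * g\<^sup>2 - 1 > 0" by simp
  have s2: "\<rho> (r \<delta>) ?s = (2 * g * (4 * g\<^sup>2 - 1) - 2 * g) *\<^sub>R \<delta> + (4 * g\<^sup>2 - 1) *\<^sub>R \<epsilon>"
    unfolding s1 using d e Bs by (simp add: r_act B_lin root_norm algebra_simps) (simp flip: scaleR_left_distrib)
  have "(2 * g * (4 * g\<^sup>2 - 1) - 2 * g) * (4 * g\<^sup>2 - 1) \<ge> 0" using sbase_coords[OF assms(1-4) _ s2] d e by simp
  then have "2 * g * (4 * g\<^sup>2 - 1) - 2 * g \<ge> 0" using p by (simp add: zero_le_mult_iff)
  then have "2 * g * (4 * g\<^sup>2 - 2) \<ge> 0" by (simp add: algebra_simps)
  then have "4 * g\<^sup>2 - 2 \<ge> 0" using g0 by (simp add: zero_le_mult_iff)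
  then show False using n by simp
qed

text \<open>Alternating reflections shift the angle of a root by \<theta>, so its coordinates run
  through consecutive values \<open>q k\<close>; equality of signs is
  \<open>sbase_coords\<close>.\<close>

lemma sbase_rotate:
  assumes "subspace U" "\<delta> \<in> sbase U" "\<epsilon> \<in> sbase U" "\<delta> \<noteq> \<epsilon>" "B \<delta> \<epsilon> = - cos \<theta>"
    and "a *\<^sub>R \<delta> + b *\<^sub>R \<epsilon> \<in> roots" "sin \<theta> * a = sin \<phi>" "sin \<theta> * b = sin (\<phi> + \<theta>)" "sin \<theta> > 0"
  shows "sin (\<phi> + real k * \<theta>) * sin (\<phi> + real (k + 1) * \<theta>) \<ge> 0"
proof -
  note d = sbaseD[OF assms(2)] and e = sbaseD[OF assms(3)]
  have Bs: "B \<epsilon> \<delta> = - cos \<theta>" using B_sym[of \<epsilon> \<delta>] assms by simp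
  define q where "q k = sin (\<phi> + real k * \<theta>) / sin \<theta>" for k
  have q0: "q 0 = a" "q 1 = b" unfolding q_def using assms by (simp_all add: field_simps)
  have rec: "q (k + 2) = 2 * cos \<theta> * q (k + 1) - q k" for k
  proof -
    have h: "sin (z + \<theta>) + sin (z - \<theta>) = 2 * cos \<theta> * sin z" for z :: real by (simp add: sin_add sin_diff)
    have e: "(\<phi> + real (k + 1) * \<theta>) + \<theta> = \<phi> + real (k + 2) * \<theta>" "(\<phi> + real (k + 1) * \<theta>) - \<theta> = \<phi> + real k * \<theta>"
      by (simp_all add: algebra_simps)
    have "sin (\<phi> + real (k + 2) * \<theta>) = 2 * cos \<theta> * sin (\<phi> + real (k + 1) * \<theta>) - sin (\<phi> + real k * \<theta>)"
      using h[of "\<phi> + real (k + 1) * \<theta>"] unfolding e by simp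
    then show ?thesis unfolding q_def by (simp add: diff_divide_distrib)
  qed
  have "q k *\<^sub>R \<delta> + q (k + 1) *\<^sub>R \<epsilon> \<in> roots \<or> q (k + 1) *\<^sub>R \<delta> + q k *\<^sub>R \<epsilon> \<in> roots" for k
  proof (induction k)
    case 0
    then show ?case using assms q0 by simp
  next
    case (Suc k)
    then show ?case
    proof
      assume h: "q k *\<^sub>R \<delta> + q (k + 1) *\<^sub>R \<epsilon> \<in> roots"
      have "\<rho> (r \<delta>) (q k *\<^sub>R \<delta> + q (k + 1) *\<^sub>R \<epsilon>) = q (k + 2) *\<^sub>R \<delta> + q (k + 1) *\<^sub>R \<epsilon>"
        unfolding rec using d Bs by (simp add: r_act B_lin root_norm algebra_simps) (simp flip: scaleR_left_distrib)
      then show ?thesis using h d act_root_iff[of "r \<delta>"] by (metis add_2_eq_Suc' Suc_eq_plus1 r_closed)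
    next
      assume h: "q (k + 1) *\<^sub>R \<delta> + q k *\<^sub>R \<epsilon> \<in> roots"
      have "\<rho> (r \<epsilon>) (q (k + 1) *\<^sub>R \<delta> + q k *\<^sub>R \<epsilon>) = q (k + 1) *\<^sub>R \<delta> + q (k + 2) *\<^sub>R \<epsilon>"
        unfolding rec using e assms(5) by (simp add: r_act B_lin root_norm algebra_simps) (simp flip: scaleR_left_distrib)
      then show ?thesis using h e act_root_iff[of "r \<epsilon>"] by (metis add_2_eq_Suc' Suc_eq_plus1 r_closed)
    qed
  qed
  then have "q k * q (k + 1) \<ge> 0" using sbase_coords[OF assms(1-4)] by (metis mult.commute)
  moreover have "q k * q (k + 1) = sin (\<phi> + real k * \<theta>) * sin (\<phi> + real (k + 1) * \<theta>) / (sin \<theta> * sin \<theta>)"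
    by (simp add: q_def)
  ultimately show ?thesis using assms(9) by (metis mult_pos_pos not_le divide_neg_pos)
qed

text \<open>Take the first angle not below \<open>pi\<close>. The previous sine is positive and the
  step is less than \<open>pi\<close>, so jumping beyond \<open>pi\<close> would change the sign of
  the sine.\<close>

lemma angle_hits_pi:
  assumes "0 < (\<theta>::real)" "\<theta> < pi" "0 < \<phi>" "\<phi> < pi"
    and h: "\<And>k::nat. sin (\<phi> + real k * \<theta>) * sin (\<phi> + real (k + 1) * \<theta>) \<ge> 0"
  obtains k :: nat where "k \<ge> 1" "\<phi> + real k * \<theta> = pi"
proof -
  obtain n :: nat where "real n * \<theta> > pi" using reals_Archimedean3[OF assms(1)] by blast
  then have ex: "\<exists>n. \<phi> + real n * \<theta> \<ge> pi" using assms by (intro exI[of _ n]) simp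
  define k where "k = (LEAST n. \<phi> + real n * \<theta> \<ge> pi)"
  have k: "\<phi> + real k * \<theta> \<ge> pi" unfolding k_def using ex by (rule LeastI_ex)
  have k0: "k \<noteq> 0" using k assms by (intro notI) simp
  then obtain j where j: "k = j + 1" by (metis Suc_eq_plus1 not0_implies_Suc)
  have lt: "\<phi> + real j * \<theta> < pi" using not_less_Least[of j "\<lambda>n. \<phi> + real n * \<theta> \<ge> pi"] j k_def by simp
  have "\<phi> + real j * \<theta> > 0" using assms by (simp add: add_pos_nonneg)
  then have "sin (\<phi> + real j * \<theta>) > 0" using lt by (intro sin_gt_zero)
  then have s: "sin (\<phi> + real k * \<theta>) \<ge> 0" using h[of j] j by (simp add: zero_le_mult_iff)
  have "\<phi> + real k * \<theta> = (\<phi> + real j * \<theta>) + \<theta>" using j by (simp add: algebra_simps)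
  then have u: "\<phi> + real k * \<theta> < 2 * pi" using lt assms by linarith
  have "\<not> \<phi> + real k * \<theta> > pi" using s u sin_lt_zero by force
  then show ?thesis using that[of k] k k0 by simp
qed

text \<open>Sign agreement stops the angles from jumping over \<open>pi\<close>. Applied to the
  reflection of \<delta> in \<epsilon> this makes \<theta> a fraction of \<open>pi\<close>; applied
  to an arbitrary root it makes the angle of that root a multiple of \<theta>.\<close>

lemma sbase_dihedral:
  assumes U: "subspace U" and de: "\<delta> \<in> sbase U" "\<epsilon> \<in> sbase U" "\<delta> \<noteq> \<epsilon>" and b: "B \<delta> \<epsilon> > -1"
  obtains m :: nat where "m \<ge> 2" "B \<delta> \<epsilon> = - cos (pi / real m)"
    "\<And>a b. a *\<^sub>R \<delta> + b *\<^sub>R \<epsilon> \<in> roots \<Longrightarrow> a > 0 \<Longrightarrow> b > 0 \<Longrightarrow>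
      \<exists>n. 1 \<le> n \<and> n + 2 \<le> m \<and> a = sin (real n * (pi / real m)) / sin (pi / real m)
        \<and> b = sin (real (n + 1) * (pi / real m)) / sin (pi / real m)"
proof -
  note d = sbaseD[OF de(1)] and e = sbaseD[OF de(2)]
  define \<theta> where "\<theta> = arccos (- B \<delta> \<epsilon>)"
  have b0: "B \<delta> \<epsilon> \<le> 0" using sbase_obtuse U de by blast
  have ct: "B \<delta> \<epsilon> = - cos \<theta>" unfolding \<theta>_def using b b0 by (subst cos_arccos) auto
  have th: "0 < \<theta>" "\<theta> \<le> pi / 2" unfolding \<theta>_def
    using arccos_lt_bounded[of "- B \<delta> \<epsilon>"] arccos_le_pi2[of "- B \<delta> \<epsilon>"] b b0 by auto
  have th2: "\<theta> < pi" using th(2) pi_gt_zero by linarith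
  have st: "sin \<theta> > 0" using th(1) th2 by (rule sin_gt_zero)
  have "\<rho> (r \<epsilon>) \<delta> = 1 *\<^sub>R \<delta> + (2 * cos \<theta>) *\<^sub>R \<epsilon>" using e ct by (simp add: r_act)
  then have r1: "1 *\<^sub>R \<delta> + (2 * cos \<theta>) *\<^sub>R \<epsilon> \<in> roots" using d e act_root[of "r \<epsilon>" \<delta>] by simp
  have "sin (\<theta> + real k * \<theta>) * sin (\<theta> + real (k + 1) * \<theta>) \<ge> 0" for k
    by (rule sbase_rotate[OF U de ct r1 _ _ st]) (simp_all add: sin_double)
  then obtain k :: nat where k: "k \<ge> 1" "\<theta> + real k * \<theta> = pi" using th(1)
    using angle_hits_pi[of \<theta> \<theta>] th2 by blast
  \<comment> \<open>The starting root has angle \<theta>, not zero, so \<open>pi\<close> is reached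
    after \<open>k + 1\<close> multiples of \<theta>.\<close>
  define m where "m = k + 1"
  have tm: "\<theta> = pi / real m" using k unfolding m_def by (simp add: field_simps)
  show ?thesis
  proof (rule that[of m])
    show "m \<ge> 2" using k m_def by simp
    show "B \<delta> \<epsilon> = - cos (pi / real m)" using ct tm by simp
  next
    fix a b assume ab: "a *\<^sub>R \<delta> + b *\<^sub>R \<epsilon> \<in> roots" "a > 0" "b > 0"
    have "B (a *\<^sub>R \<delta> + b *\<^sub>R \<epsilon>) (a *\<^sub>R \<delta> + b *\<^sub>R \<epsilon>) = a\<^sup>2 + b\<^sup>2 - 2 * a * b * cos \<theta>"
      using ct B_sym[of \<epsilon> \<delta>] d e by (simp add: B_lin root_norm algebra_simps power2_eq_square)
    then have nrm: "a\<^sup>2 + b\<^sup>2 - 2 * a * b * cos \<theta> = 1" using root_norm ab by simp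
    \<comment> \<open>The norm equation places the point with coordinates
      \<open>b - a * cos \<theta>\<close> and \<open>a * sin \<theta>\<close> on the unit circle;
      its angle \<phi> is the parameter that \<open>sbase_rotate\<close> asks for.\<close>
    have "(b - a * x)\<^sup>2 + (a * y)\<^sup>2 = a\<^sup>2 * (x\<^sup>2 + y\<^sup>2) + b\<^sup>2 - 2 * a * b * x" for x y :: real
      by (simp add: power2_eq_square algebra_simps)
    from this[of "cos \<theta>" "sin \<theta>"] have "(b - a * cos \<theta>)\<^sup>2 + (a * sin \<theta>)\<^sup>2 = 1" using nrm by simp
    then obtain \<phi> where ph: "0 \<le> \<phi>" "\<phi> < 2 * pi" "b - a * cos \<theta> = cos \<phi>" "a * sin \<theta> = sin \<phi>"
      using sincos_total_2pi by metis
    have "sin \<phi> > 0" using ph ab st by (metis mult_pos_pos)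
    then have "\<phi> \<noteq> 0" "\<not> pi \<le> \<phi>" using ph(2) sin_le_zero[of \<phi>] by auto
    then have ph': "0 < \<phi>" "\<phi> < pi" using ph(1) by linarith+
    have "sin (\<phi> + \<theta>) = a * sin \<theta> * cos \<theta> + (b - a * cos \<theta>) * sin \<theta>" using ph by (simp add: sin_add)
    then have sb: "sin \<theta> * b = sin (\<phi> + \<theta>)" by (simp add: algebra_simps)
    then have "sin (\<phi> + \<theta>) > 0" using st ab by (metis mult_pos_pos)
    then have pt: "\<phi> + \<theta> < pi" using ph' th sin_le_zero[of "\<phi> + \<theta>"] by linarith
    have "sin (\<phi> + real k * \<theta>) * sin (\<phi> + real (k + 1) * \<theta>) \<ge> 0" for k
      by (rule sbase_rotate[OF U de ct ab(1) _ sb st]) (use ph in \<open>simp add: mult.commute\<close>)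
    then obtain j :: nat where j: "j \<ge> 1" "\<phi> + real j * \<theta> = pi" using th(1) ph'
      using angle_hits_pi[of \<theta> \<phi>] th2 by blast
    have mt: "real m * \<theta> = pi" using tm k m_def by simp
    have "real j * \<theta> < real m * \<theta>" using j mt ph' by linarith
    then have jm: "j < m" using th by (simp add: mult_less_cancel_right)
    have pn: "\<phi> = real (m - j) * \<theta>" using j mt jm by (simp add: of_nat_diff algebra_simps)
    have "real (j) * \<theta> > 1 * \<theta>" using pt j by simp
    then have j2: "j > 1" using th by (simp add: mult_less_cancel_right)
    show "\<exists>n. 1 \<le> n \<and> n + 2 \<le> m \<and> a = sin (real n * (pi / real m)) / sin (pi / real m)
        \<and> b = sin (real (n + 1) * (pi / real m)) / sin (pi / real m)"
    proof (intro exI[of _ "m - j"] conjI)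
      show "1 \<le> m - j" "m - j + 2 \<le> m" using jm j2 by auto
      show "a = sin (real (m - j) * (pi / real m)) / sin (pi / real m)"
        using ph(4) st pn tm by (simp add: field_simps)
      have "\<phi> + \<theta> = real (m - j + 1) * \<theta>" using pn by (simp add: algebra_simps)
      then show "b = sin (real (m - j + 1) * (pi / real m)) / sin (pi / real m)"
        using sb st tm by (metis nonzero_mult_div_cancel_left less_irrefl)
    qed
  qed
qed

end

section \<open>Rank two and rank three subsystems\<close>

lemma sin_ge_sin_between:
  assumes "0 \<le> (a::real)" "a \<le> x" "x \<le> pi - a" shows "sin a \<le> sin x"
proof (cases "x \<le> pi / 2")
  case True
  then show ?thesis using assms by (intro sin_monotone_2pi_le) auto
next
  case False
  then have "sin a \<le> sin (pi - x)" using assms by (intro sin_monotone_2pi_le) auto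
  then show ?thesis by simp
qed

text \<open>\<open>P\<close> and \<open>Q\<close> are consecutive values \<open>s n\<close> and
  \<open>s (n + 1)\<close> of a sequence that is symmetric and unimodal and starts 0, 1,
  \<open>c\<close>, \<open>c\<^sup>2 - 1\<close>. The bound \<open>c\<^sup>2 \<ge> 3\<close> means
  \<open>m \<ge> 6\<close>, and then \<open>s k \<ge> 2\<close> except within two steps of either
  end. The alternatives list these exceptions; the threshold 2 is what a root with product -1/2
  needs in order to reach -1.\<close>

lemma dihedral_coeffs:
  fixes m n :: nat
  assumes m: "m \<ge> 4" and n: "2 \<le> n" "n + 2 \<le> m"
  defines "c \<equiv> 2 * cos (pi / real m)"
    and "P \<equiv> sin (real n * (pi / real m)) / sin (pi / real m)"
    and "Q \<equiv> sin (real (n + 1) * (pi / real m)) / sin (pi / real m)"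
  shows "0 < c" "c < 2" "c\<^sup>2 \<ge> 2" "P \<ge> c" "Q \<ge> 1"
    "c\<^sup>2 \<ge> 3 \<Longrightarrow> Q \<ge> 2 \<or> c * P - Q \<ge> 2 \<or> (c\<^sup>2 = 3 \<and> P = 2 \<and> Q = c)"
    "c\<^sup>2 \<ge> 3 \<Longrightarrow> P \<ge> 2 \<or> (P = c \<and> Q = c\<^sup>2 - 1) \<or> (P = c \<and> Q = 1 \<and> (c\<^sup>2 = 3 \<or> c ^ 3 - 2 * c \<ge> 2))"
proof -
  define t where "t = pi / real m"
  define s where "s k = sin (real k * t) / sin t" for k :: nat
  have mt: "real m * t = pi" using m by (simp add: t_def)
  have t0: "t > 0" using m by (simp add: t_def)
  have t4: "t \<le> pi / 4" unfolding t_def using m by (intro divide_left_mono) auto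
  have tp: "t < pi" using t4 pi_gt_zero by linarith
  have st: "sin t > 0" using t0 tp by (rule sin_gt_zero)
  have c: "c = 2 * cos t" by (simp add: c_def t_def)
  have PQ: "P = s n" "Q = s (n + 1)" by (simp_all add: P_def Q_def s_def t_def)
  have rec: "s (k + 2) = c * s (k + 1) - s k" for k
  proof -
    have h: "sin (z + t) + sin (z - t) = 2 * cos t * sin z" for z :: real by (simp add: sin_add sin_diff)
    have e: "real (k + 1) * t + t = real (k + 2) * t" "real (k + 1) * t - t = real k * t"
      by (simp_all add: algebra_simps)
    have "sin (real (k + 2) * t) = c * sin (real (k + 1) * t) - sin (real k * t)"
      using h[of "real (k + 1) * t"] unfolding e c by simp
    then show ?thesis by (simp add: s_def diff_divide_distrib)
  qed
  have s0: "s 0 = 0" and s1: "s 1 = 1" using st by (simp_all add: s_def)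
  have rec': "s l = c * s j - s k" if "l = k + 2" "j = k + 1" for k j l using rec[of k] that by simp
  have s2: "s 2 = c" using rec'[of 2 0 1] s0 s1 by simp
  have s3: "s 3 = c\<^sup>2 - 1" using rec'[of 3 1 2] s1 s2 by (simp add: power2_eq_square)
  have s4: "s 4 = c ^ 3 - 2 * c" using rec'[of 4 2 3] s2 s3 by (simp add: power2_eq_square power3_eq_cube algebra_simps)
  have refl: "s k = s (m - k)" if "k \<le> m" for k
  proof -
    have "real (m - k) * t = pi - real k * t" using that mt by (simp add: of_nat_diff algebra_simps)
    then show ?thesis by (simp add: s_def)
  qed
  have mono: "s k \<le> s j" if "k \<le> j" "j + k \<le> m" for j k
  proof -
    have "real j * t + real k * t \<le> real m * t" using that t0 by (simp flip: distrib_right of_nat_add)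
    then have "sin (real k * t) \<le> sin (real j * t)" using that t0 mt
      by (intro sin_ge_sin_between) (auto intro: mult_right_mono)
    then show ?thesis unfolding s_def using st by (simp add: divide_right_mono)
  qed
  have cos4: "cos t \<ge> cos (pi / 4)" using t0 t4 by (intro cos_monotone_0_pi_le) auto
  then have cs: "c \<ge> sqrt 2" unfolding c by (simp add: cos_45)
  then show c0: "0 < c" by (meson less_le_trans real_sqrt_gt_zero zero_less_numeral)
  show "c\<^sup>2 \<ge> 2" using power_mono[OF cs, of 2] by simp
  have "cos t < cos 0" using t0 tp by (intro cos_monotone_0_pi) auto
  then show "c < 2" unfolding c by simp
  show "P \<ge> c" unfolding PQ using mono[of 2 n] n s2 by simp
  show "Q \<ge> 1" unfolding PQ using mono[of 1 "n + 1"] n s1 by simp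
  have small: "m \<ge> 6" if "c\<^sup>2 \<ge> 3"
  proof (rule ccontr)
    assume "\<not> m \<ge> 6"
    then have "t > pi / 6" unfolding t_def using m by (intro divide_strict_left_mono) auto
    then have "cos t < cos (pi / 6)" using tp by (intro cos_monotone_0_pi) auto
    then have "c < sqrt 3" unfolding c by (simp add: cos_30)
    then have "c\<^sup>2 < (sqrt 3)\<^sup>2" using c0 by (intro power_strict_mono) auto
    then show False using that by simp
  qed
  have six: "c\<^sup>2 = 3" if "m = 6" unfolding c t_def using that by (simp add: cos_30 power_mult_distrib power_divide)
  have cP: "c * P - Q = s (n - 1)" using rec'[of "n + 1" "n - 1" n] n PQ by simp
  { assume c3: "c\<^sup>2 \<ge> 3"
    then have m6: "m \<ge> 6" using small by simp
    have big: "s j \<ge> 2" if "3 \<le> j" "j + 3 \<le> m" for j using mono[of 3 j] that s3 c3 by simp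
    show "Q \<ge> 2 \<or> c * P - Q \<ge> 2 \<or> (c\<^sup>2 = 3 \<and> P = 2 \<and> Q = c)"
    proof -
      consider "n + 4 \<le> m" | "n \<ge> 4" | "n \<le> 3" "n + 4 > m" by linarith
      then show ?thesis
      proof cases
        case 1 then show ?thesis using big[of "n + 1"] n PQ by simp
      next
        case 2 then show ?thesis using big[of "n - 1"] n cP by simp
      next
        case 3
        then have e: "m = 6" "n = 3" using m6 by auto
        then have "P = 2" "Q = c" using PQ s3 six refl[of 4] s2 by simp_all
        then show ?thesis using six e by simp
      qed
    qed
    show "P \<ge> 2 \<or> (P = c \<and> Q = c\<^sup>2 - 1) \<or> (P = c \<and> Q = 1 \<and> (c\<^sup>2 = 3 \<or> c ^ 3 - 2 * c \<ge> 2))"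
    proof -
      consider "3 \<le> n" "n + 3 \<le> m" | "n = 2" | "n + 2 = m" using n by linarith
      then show ?thesis
      proof cases
        case 1 then show ?thesis using big[of n] PQ by simp
      next
        case 2 then show ?thesis using PQ s2 s3 by simp
      next
        case 3
        have P: "P = c" using refl[of n] PQ s2 3 by auto
        have Q: "Q = 1" using refl[of "n + 1"] PQ s1 3 by auto
        have "c\<^sup>2 = 3 \<or> c ^ 3 - 2 * c \<ge> 2"
        proof (cases "m = 6")
          case True then show ?thesis using six by simp
        next
          case False then show ?thesis using big[of 4] m6 s4 by simp
        qed
        then show ?thesis using P Q by simp
      qed
    qed }
qed

section \<open>Chains of three simple roots\<close>

lemma in_span_pair: "x \<in> span {a, b} \<longleftrightarrow> (\<exists>k l. x = k *\<^sub>R a + l *\<^sub>R b)"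
  by (simp add: span_breakdown_eq diff_eq_eq algebra_simps)

lemma in_span_triple: "x \<in> span {a, b, d} \<longleftrightarrow> (\<exists>k l n. x = k *\<^sub>R a + l *\<^sub>R b + n *\<^sub>R d)"
proof -
  have "x \<in> span {a, b, d} \<longleftrightarrow> (\<exists>k. x - k *\<^sub>R a \<in> span {b, d})" by (rule span_breakdown_eq)
  then show ?thesis unfolding in_span_pair by (simp add: diff_eq_eq algebra_simps)
qed

context geometric_representation
begin

text \<open>A fourth simple root has nonpositive products \<open>- v1\<close>, \<open>- v2\<close>,
  \<open>- v3\<close> with the chain, whose Gram determinant is \<open>(3 - c\<^sup>2) / 4\<close>.
  If this is positive, solving for the coordinates makes them all nonpositive, against positivity of
  the root. Otherwise its norm equation forces \<open>c\<^sup>2 = 3\<close>, after which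
  \<open>v1\<close> and \<open>v3\<close> vanish and the norm would be 0.\<close>

lemma triple_sbase:
  assumes U: "U = span {p, x, q}" and S: "p \<in> sbase U" "x \<in> sbase U" "q \<in> sbase U"
    and b: "B p x = - 1 / 2" "B x q = - c / 2" "B p q = 0" and c: "0 < c" "c < 2"
    and e: "\<eta> \<in> sbase U"
  shows "\<eta> \<in> {p, x, q}"
proof (rule ccontr)
  assume n: "\<eta> \<notin> {p, x, q}"
  have sub: "subspace U" using U by simp
  obtain A X D where ax: "\<eta> = A *\<^sub>R p + X *\<^sub>R x + D *\<^sub>R q"
    using sbaseD(2)[OF e] unfolding U in_span_triple by blast
  have nrm: "B p p = 1" "B x x = 1" "B q q = 1" "B \<eta> \<eta> = 1" using S e sbaseD(3) root_norm by auto
  have bs: "B x p = - 1 / 2" "B q x = - c / 2" "B q p = 0" using b B_sym by metis+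
  define v1 v2 v3 where "v1 = - B \<eta> p" and "v2 = - B \<eta> x" and "v3 = - B \<eta> q"
  have v: "v1 \<ge> 0" "v2 \<ge> 0" "v3 \<ge> 0" unfolding v1_def v2_def v3_def
    using sbase_obtuse[OF sub e] S n by auto
  have e1: "A = X / 2 - v1" unfolding v1_def ax using nrm b bs by (simp add: B_lin)
  have e2: "- A / 2 + X - c * D / 2 = - v2" unfolding v2_def ax using nrm b bs by (simp add: B_lin)
  have e3: "D = c * X / 2 - v3" unfolding v3_def ax using nrm b bs by (simp add: B_lin)
  have e4: "- (A * v1 + X * v2 + D * v3) = 1"
  proof -
    have "B \<eta> \<eta> = A * B \<eta> p + X * B \<eta> x + D * B \<eta> q" by (subst (2) ax) (simp add: B_lin)
    then show ?thesis using nrm by (simp add: v1_def v2_def v3_def)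
  qed
  define T where "T = v2 + v1 / 2 + c * v3 / 2"
  have T0: "T \<ge> 0" using v c by (simp add: T_def)
  have XT: "X * (c\<^sup>2 - 3) = 4 * T" using e2 unfolding e1 e3 T_def by (simp add: field_simps power2_eq_square)
  have one: "1 = - X * T + v1\<^sup>2 + v3\<^sup>2" using e4 unfolding e1 e3 T_def by (simp add: field_simps power2_eq_square)
  show False
  proof (cases "c\<^sup>2 < 3")
    case True
    have "X \<le> 0"
    proof (rule ccontr)
      assume "\<not> X \<le> 0"
      then have "X * (c\<^sup>2 - 3) < 0" using True by (intro mult_pos_neg) auto
      then show False using XT T0 by simp
    qed
    moreover have "c * X \<le> 0" using \<open>X \<le> 0\<close> c by (simp add: mult_nonneg_nonpos)
    ultimately have "- A \<ge> 0" "- X \<ge> 0" "- D \<ge> 0" unfolding e1 e3 using v by simp_all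
    then have "(- A) *\<^sub>R p + (- X) *\<^sub>R x + (- D) *\<^sub>R q \<in> K" using S sbaseD(1)
      by (intro K_add K_scale pos_K) auto
    moreover have "- \<eta> = (- A) *\<^sub>R p + (- X) *\<^sub>R x + (- D) *\<^sub>R q" unfolding ax by simp
    ultimately show False using pos_not_neg_K[OF sbaseD(1)[OF e]] by simp
  next
    case False
    have c2: "c\<^sup>2 < 4" using c power_strict_mono[of c 2 2] by simp
    \<comment> \<open>Multiplying by \<open>c\<^sup>2 - 3\<close> lets \<open>X\<close> be
      eliminated through \<open>XT\<close> without dividing in the degenerate case.\<close>
    have "c\<^sup>2 - 3 = - (X * (c\<^sup>2 - 3)) * T + (c\<^sup>2 - 3) * (v1\<^sup>2 + v3\<^sup>2)"
      using arg_cong[OF one, of "\<lambda>z. (c\<^sup>2 - 3) * z"] by (simp add: algebra_simps)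
    then have q: "c\<^sup>2 - 3 = - 4 * T\<^sup>2 + (c\<^sup>2 - 3) * (v1\<^sup>2 + v3\<^sup>2)" unfolding XT by (simp add: power2_eq_square)
    have "4 * T\<^sup>2 = v1\<^sup>2 + c\<^sup>2 * v3\<^sup>2 + (4 * v2\<^sup>2 + 4 * v2 * v1 + 4 * c * v2 * v3 + 2 * c * v1 * v3)"
      unfolding T_def by (simp add: power2_eq_square field_simps)
    moreover have "4 * v2\<^sup>2 + 4 * v2 * v1 + 4 * c * v2 * v3 + 2 * c * v1 * v3 \<ge> 0" using v c by simp
    ultimately have "4 * T\<^sup>2 \<ge> v1\<^sup>2 + c\<^sup>2 * v3\<^sup>2" by linarith
    moreover have "(c\<^sup>2 - 3) * v1\<^sup>2 \<le> 1 * v1\<^sup>2" "(c\<^sup>2 - 3) * v3\<^sup>2 \<le> c\<^sup>2 * v3\<^sup>2"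
      using c2 by (intro mult_right_mono; simp)+
    ultimately have "c\<^sup>2 - 3 \<le> 0" using q by (simp add: distrib_left)
    then have c3: "c\<^sup>2 = 3" using False by simp
    then have "T = 0" using XT by simp
    then have "v2 + v1 / 2 + c * v3 / 2 = 0" by (simp add: T_def)
    moreover have "c * v3 \<ge> 0" using c v by simp
    ultimately have "v1 = 0" "c * v3 = 0" using v by linarith+
    then show False using one \<open>T = 0\<close> c by simp
  qed
qed

text \<open>Completing squares shows that the form is positive definite, while a product at most -1
  gives the sum of the two roots nonpositive norm. It serves in the contrapositive: a product at
  most -1 forces \<open>c\<^sup>2 \<ge> 3\<close>.\<close>

lemma triple_posdef:
  assumes U: "U = span {p, x, q}" and S: "p \<in> sbase U" "x \<in> sbase U" "q \<in> sbase U"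
    and b: "B p x = - 1 / 2" "B x q = - c / 2" "B p q = 0" and c: "c\<^sup>2 < 3"
    and k: "\<kappa> \<in> \<Phi>" "\<kappa> \<in> U" "\<xi> \<in> \<Phi>" "\<xi> \<in> U"
  shows "B \<kappa> \<xi> > -1"
proof (rule ccontr)
  assume n: "\<not> B \<kappa> \<xi> > -1"
  have "\<kappa> + \<xi> \<in> U" using U k by (simp add: span_add)
  then obtain A X D where ax: "\<kappa> + \<xi> = A *\<^sub>R p + X *\<^sub>R x + D *\<^sub>R q" unfolding U in_span_triple by blast
  have nrm: "B p p = 1" "B x x = 1" "B q q = 1" "B \<kappa> \<kappa> = 1" "B \<xi> \<xi> = 1"
    using S k pos_root sbaseD(3) root_norm by auto
  have bs: "B x p = - 1 / 2" "B q x = - c / 2" "B q p = 0" using b B_sym by metis+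
  have "B (\<kappa> + \<xi>) (\<kappa> + \<xi>) = 2 + 2 * B \<kappa> \<xi>" using nrm B_sym[of \<xi> \<kappa>] by (simp add: B_lin)
  then have "B (\<kappa> + \<xi>) (\<kappa> + \<xi>) \<le> 0" using n by simp
  moreover have "B (\<kappa> + \<xi>) (\<kappa> + \<xi>) = A * A + X * X + D * D - A * X - c * X * D"
    unfolding ax using nrm b bs by (simp add: B_lin algebra_simps)
  moreover have "A * A + X * X + D * D - A * X - c * X * D = (A - X / 2)\<^sup>2 + (D - c * X / 2)\<^sup>2 + X\<^sup>2 * ((3 - c\<^sup>2) / 4)"
    by (simp add: field_simps power2_eq_square)
  moreover have "X\<^sup>2 * ((3 - c\<^sup>2) / 4) \<ge> 0" using c by simp
  ultimately have "(A - X / 2)\<^sup>2 = 0" "(D - c * X / 2)\<^sup>2 = 0" "X\<^sup>2 * ((3 - c\<^sup>2) / 4) = 0"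
    by (smt (verit) zero_le_power2)+
  then have "X = 0" "A = 0" "D = 0" using c by auto
  then have "\<xi> = - \<kappa>" using ax by (simp add: add_eq_0_iff)
  then show False using k not_pos_neg by blast
qed

lemma invs_step:
  assumes "subspace U" "a \<in> carrier W" "\<kappa> \<in> invs a" "\<kappa> \<in> U" "\<eta> \<in> sbase U" "\<kappa> \<noteq> \<eta>"
  shows "\<rho> (r \<eta>) \<kappa> \<in> invs (a \<otimes> r \<eta>)" "\<rho> (r \<eta>) \<kappa> \<in> U"
proof -
  note d = sbaseD[OF assms(5)]
  show "\<rho> (r \<eta>) \<kappa> \<in> U" using act_r_subspace assms d by auto
  have "\<rho> (r \<eta>) \<kappa> \<in> \<Phi>" using sbase_permutes assms by (auto simp: invs_def)
  then show "\<rho> (r \<eta>) \<kappa> \<in> invs (a \<otimes> r \<eta>)" using assms d by (simp add: invs_def)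
qed

lemma not_pos_invs: "w \<in> carrier W \<Longrightarrow> \<rho> w x \<in> \<Phi> \<Longrightarrow> x \<notin> invs w"
  using not_pos_neg by (auto simp: invs_def)

text \<open>Multiplying \<open>a\<close> by reflections in simple roots of the subsystem, the image of \<open>\<kappa>\<close> stays inverted and
  so forces the next simple root to be inverted, until an explicit root inverted by \<open>a\<close> does the job.\<close>

lemma separating_root_far_end:
  assumes U: "subspace U" and S: "\<delta> \<in> sbase U" "\<epsilon> \<in> sbase U" "\<eta> \<in> sbase U"
    and only: "\<And>x. x \<in> sbase U \<Longrightarrow> x \<in> {\<delta>, \<epsilon>, \<eta>}"
    and b: "B \<eta> \<epsilon> = - 1 / 2" "B \<eta> \<delta> = 0" "B \<delta> \<epsilon> = - c / 2" and c: "c\<^sup>2 = 3" "0 < c" "c < 2"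
    and a: "a \<in> carrier W" "\<rho> a \<delta> \<in> \<Phi>" "\<rho> a \<epsilon> \<in> \<Phi>" "\<eta> \<in> invs a" "- \<rho> (a \<otimes> r \<eta>) \<epsilon> \<in> \<Phi>"
    and k: "\<kappa> \<in> invs a" "\<kappa> \<in> U" "B \<kappa> \<delta> \<le> -1"
  shows "\<exists>k \<in> invs a \<inter> U. B k (2 *\<^sub>R \<delta> + c *\<^sub>R \<epsilon>) \<le> -1"
proof -
  note D = S[THEN sbaseD(3)] and DU = S[THEN sbaseD(2)] and DP = S[THEN sbaseD(1)]
  have nrm: "B \<delta> \<delta> = 1" "B \<epsilon> \<epsilon> = 1" "B \<eta> \<eta> = 1" using D root_norm by auto
  have bs: "B \<epsilon> \<eta> = - 1 / 2" "B \<delta> \<eta> = 0" "B \<epsilon> \<delta> = - c / 2" using b B_sym by metis+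
  note G = nrm b bs
  let ?b1 = "a \<otimes> r \<eta>"
  let ?b2 = "?b1 \<otimes> r \<epsilon>"
  let ?k1 = "\<rho> (r \<eta>) \<kappa>"
  let ?k2 = "\<rho> (r \<epsilon>) ?k1"
  have cl: "?b1 \<in> carrier W" "?b2 \<in> carrier W" using a D by auto
  have e1: "\<rho> (r \<eta>) \<epsilon> = \<epsilon> + \<eta>" using D G by (simp add: r_act)
  have "\<kappa> \<noteq> \<eta>" using k G by auto
  note k1 = invs_step[OF U a(1) k(1,2) S(3) this]
  have "?k1 \<noteq> \<epsilon>"
  proof
    assume "?k1 = \<epsilon>"
    then have "\<kappa> = \<epsilon> + \<eta>" using e1 r_act_twice[OF D(3), of \<kappa>] by simp
    then show False using k G c by (simp add: B_lin)
  qed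
  note k2 = invs_step[OF U cl(1) k1 S(2) this]
  have "\<rho> ?b2 \<epsilon> \<in> \<Phi>" using a cl D by (simp add: r_act_self act_lin)
  moreover have "\<rho> ?b2 \<eta> = \<rho> ?b1 (\<eta> + \<epsilon>)" using cl D G by (simp add: r_act)
  then have "\<rho> ?b2 \<eta> = \<rho> a \<epsilon>" using a(1) D e1 by (simp add: act_lin r_act_self)
  then have "\<rho> ?b2 \<eta> \<in> \<Phi>" using a by simp
  moreover obtain x where "x \<in> sbase U" "x \<in> invs ?b2" using sbase_inverted[OF cl(2)] k2 by blast
  ultimately have d: "\<delta> \<in> invs ?b2" using only not_pos_invs[OF cl(2)] by blast
  let ?z = "\<rho> (r \<eta>) (\<rho> (r \<epsilon>) \<delta>)"
  have z: "?z = \<delta> + c *\<^sub>R (\<epsilon> + \<eta>)" using D G by (simp add: r_act B_lin algebra_simps)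
  have "?z \<in> K" unfolding z using c DP by (intro K_add K_scale pos_K) auto
  then have "?z \<in> \<Phi>" using D by (intro posI) auto
  moreover have "- \<rho> a ?z \<in> \<Phi>" using d a(1) D by (simp add: invs_def)
  ultimately have "?z \<in> invs a" by (simp add: invs_def)
  moreover have "?z \<in> U" using act_r_subspace U D DU by simp
  moreover have "B ?z (2 *\<^sub>R \<delta> + c *\<^sub>R \<epsilon>) = -1"
    unfolding z using G c by (simp add: B_lin power2_eq_square algebra_simps)
  ultimately show ?thesis by force
qed

text \<open>The walk of \<open>separating_root_far_end\<close>, now with \<eta> joined to \<delta>.
  Each crossing leaves one simple root that can be inverted next, and pulling it back gives the
  roots \<open>?z2\<close> and \<open>?z3\<close> inverted by \<open>a\<close>; the walk stops at
  the first with product at most -1. Only \<open>c * c = 3\<close> with \<open>Q = 1\<close> goes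
  further, where either \<open>?z4\<close> works or no simple root is left to be inverted.\<close>

lemma separating_root_near_end:
  assumes U: "subspace U" and S: "\<delta> \<in> sbase U" "\<epsilon> \<in> sbase U" "\<eta> \<in> sbase U"
    and only: "\<And>x. x \<in> sbase U \<Longrightarrow> x \<in> {\<delta>, \<epsilon>, \<eta>}"
    and b: "B \<eta> \<delta> = - 1 / 2" "B \<eta> \<epsilon> = 0" "B \<delta> \<epsilon> = - c / 2" and c: "c * c \<ge> 3" "0 < c" "c < 2"
    and PQ: "P = c" "Q = c * c - 1 \<or> Q = 1 \<and> (c * c = 3 \<or> c * c * c - 2 * c \<ge> 2)"
    and a: "a \<in> carrier W" "\<rho> a \<delta> \<in> \<Phi>" "\<rho> a \<epsilon> \<in> \<Phi>" "\<eta> \<in> invs a"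
    and k: "\<kappa> \<in> invs a" "\<kappa> \<in> U" "B \<kappa> \<delta> \<le> -1"
  shows "\<exists>k \<in> invs a \<inter> U. B k (P *\<^sub>R \<delta> + Q *\<^sub>R \<epsilon>) \<le> -1"
proof -
  note D = S[THEN sbaseD(3)] and DU = S[THEN sbaseD(2)] and DP = S[THEN sbaseD(1)]
  have nrm: "B \<delta> \<delta> = 1" "B \<epsilon> \<epsilon> = 1" "B \<eta> \<eta> = 1" using D root_norm by auto
  have bs: "B \<delta> \<eta> = - 1 / 2" "B \<epsilon> \<eta> = 0" "B \<epsilon> \<delta> = - c / 2" using b B_sym by metis+
  note G = nrm b bs
  have h: "\<rho> (r \<eta>) \<delta> = \<delta> + \<eta>" "\<rho> (r \<eta>) \<epsilon> = \<epsilon>" "\<rho> (r \<eta>) \<eta> = - \<eta>"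
    "\<rho> (r \<delta>) \<eta> = \<eta> + \<delta>" "\<rho> (r \<delta>) \<epsilon> = \<epsilon> + c *\<^sub>R \<delta>" "\<rho> (r \<delta>) \<delta> = - \<delta>"
    "\<rho> (r \<epsilon>) \<delta> = \<delta> + c *\<^sub>R \<epsilon>" "\<rho> (r \<epsilon>) \<eta> = \<eta>" "\<rho> (r \<epsilon>) \<epsilon> = - \<epsilon>"
    using D G by (simp_all add: r_act_self) (simp_all add: r_act)
  let ?z2 = "\<rho> (r \<eta>) (\<rho> (r \<delta>) \<epsilon>)" and ?z3 = "\<rho> (r \<eta>) (\<rho> (r \<delta>) (\<rho> (r \<epsilon>) \<delta>))"
    and ?z4 = "\<rho> (r \<eta>) (\<rho> (r \<delta>) (\<rho> (r \<epsilon>) (\<rho> (r \<delta>) \<epsilon>)))"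
    and ?z5 = "\<rho> (r \<eta>) (\<rho> (r \<delta>) (\<rho> (r \<epsilon>) (\<rho> (r \<delta>) \<eta>)))"
  have z2: "?z2 = \<epsilon> + c *\<^sub>R \<delta> + c *\<^sub>R \<eta>" using D by (simp add: act_lin h algebra_simps)
  have z3: "?z3 = (c * c - 1) *\<^sub>R \<delta> + (c * c - 1) *\<^sub>R \<eta> + c *\<^sub>R \<epsilon>" using D by (simp add: act_lin h algebra_simps)
  have two: "(c * 2) *\<^sub>R x = c *\<^sub>R x + c *\<^sub>R x" for x :: 'v by (simp flip: scaleR_left_distrib)
  have z4: "?z4 = (c * c * c - c * 2) *\<^sub>R \<delta> + (c * c * c - c * 2) *\<^sub>R \<eta> + (c * c - 1) *\<^sub>R \<epsilon>"
    using D by (simp add: act_lin h algebra_simps) (simp add: two)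
  have z5: "?z5 = (c * c) *\<^sub>R \<delta> + (c * c - 1) *\<^sub>R \<eta> + c *\<^sub>R \<epsilon>" using D by (simp add: act_lin h algebra_simps)
  have ccc: "c * c * c - c * 2 \<ge> 0" using mult_right_mono[OF c(1), of c] c by simp
  have fin: ?thesis if "z \<in> roots" "z = x1 *\<^sub>R \<delta> + x2 *\<^sub>R \<eta> + x3 *\<^sub>R \<epsilon>" "x1 \<ge> 0" "x2 \<ge> 0" "x3 \<ge> 0"
    "- \<rho> a z \<in> \<Phi>" "x1 * (P - Q * c / 2) + x2 * (- P / 2) + x3 * (Q - P * c / 2) \<le> -1" for z x1 x2 x3
  proof -
    have "z \<in> K" unfolding that(2) using that DP by (intro K_add K_scale pos_K) auto
    then have "z \<in> invs a" using that posI by (simp add: invs_def)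
    moreover have "z \<in> U" unfolding that(2) using U DU by (intro subspace_add subspace_scale)
    moreover have "B z (P *\<^sub>R \<delta> + Q *\<^sub>R \<epsilon>) = x1 * (P - Q * c / 2) + x2 * (- P / 2) + x3 * (Q - P * c / 2)"
      unfolding that(2) using G by (simp add: B_lin algebra_simps)
    ultimately show ?thesis using that(7) by (intro bexI[of _ z]) simp_all
  qed
  let ?b1 = "a \<otimes> r \<eta>"
  let ?b2 = "?b1 \<otimes> r \<delta>"
  let ?b3 = "?b2 \<otimes> r \<epsilon>"
  let ?b4 = "?b3 \<otimes> r \<delta>"
  let ?b5 = "?b4 \<otimes> r \<eta>"
  let ?k1 = "\<rho> (r \<eta>) \<kappa>"
  let ?k2 = "\<rho> (r \<delta>) ?k1"
  let ?k3 = "\<rho> (r \<epsilon>) ?k2"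
  let ?k4 = "\<rho> (r \<delta>) ?k3"
  have cl: "?b1 \<in> carrier W" "?b2 \<in> carrier W" "?b3 \<in> carrier W" "?b4 \<in> carrier W" "?b5 \<in> carrier W" using a D by auto
  have "\<kappa> \<noteq> \<eta>" using k G by auto
  note k1 = invs_step[OF U a(1) k(1,2) S(3) this]
  have b1: "\<rho> ?b1 \<eta> \<in> \<Phi>" "\<rho> ?b1 \<epsilon> \<in> \<Phi>" using a D by (auto simp: h act_lin invs_def)
  obtain x where "x \<in> sbase U" "x \<in> invs ?b1" using sbase_inverted[OF cl(1)] k1 by blast
  then have d1: "\<delta> \<in> invs ?b1" using b1 only not_pos_invs[OF cl(1)] by blast
  have "?k1 \<noteq> \<delta>"
  proof
    assume "?k1 = \<delta>"
    then have "\<kappa> = \<delta> + \<eta>" using h r_act_twice[OF D(3), of \<kappa>] by simp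
    then show False using k G by (simp add: B_lin)
  qed
  note k2 = invs_step[OF U cl(1) k1 S(1) this]
  have b2d: "\<rho> ?b2 \<delta> \<in> \<Phi>" using d1 cl D by (simp add: h act_lin invs_def)
  have "\<rho> ?b2 \<eta> = \<rho> ?b1 (\<eta> + \<delta>)" using cl(1) D by (simp add: h)
  then have "\<rho> ?b2 \<eta> = \<rho> a \<delta>" using a(1) D by (simp add: act_lin h)
  then have b2e: "\<rho> ?b2 \<eta> \<in> \<Phi>" using a by simp
  obtain x where "x \<in> sbase U" "x \<in> invs ?b2" using sbase_inverted[OF cl(2)] k2 by blast
  then have d2: "\<epsilon> \<in> invs ?b2" using b2d b2e only not_pos_invs[OF cl(2)] by blast
  have n2: "- \<rho> a ?z2 \<in> \<Phi>" using d2 a(1) D by (simp add: invs_def)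
  show ?thesis
  proof (cases "Q = 1")
    case False
    then have Q: "Q = c * c - 1" using PQ by simp
    have "c * (c - Q * c / 2) + c * (- c / 2) + 1 * (Q - c * c / 2) = - ((c * c - 1) * (c * c / 2 - 1))"
      unfolding Q by (simp add: algebra_simps)
    moreover have "(c * c - 1) * (c * c / 2 - 1) \<ge> 2 * (1 / 2)" using c by (intro mult_mono) auto
    ultimately have val: "c * (c - Q * c / 2) + c * (- c / 2) + 1 * (Q - c * c / 2) \<le> -1" by linarith
    show ?thesis
    proof (rule fin[of ?z2 "c" "c" "1"])
      show "?z2 \<in> roots" using D by simp
      show "?z2 = (c) *\<^sub>R \<delta> + (c) *\<^sub>R \<eta> + (1) *\<^sub>R \<epsilon>" using z2 by simp
      show "c * (P - Q * c / 2) + c * (- P / 2) + 1 * (Q - P * c / 2) \<le> -1" using val PQ(1) by simp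
      show "- \<rho> a ?z2 \<in> \<Phi>" by (rule n2)
    qed (use c in auto)
  next
    case Q1: True
    have "?k2 \<noteq> \<epsilon>"
    proof
      assume "?k2 = \<epsilon>"
      then have "\<kappa> = ?z2" using r_act_twice[OF D(3), of \<kappa>] r_act_twice[OF D(1), of ?k1] by simp
      then show False using k G unfolding z2 by (simp add: B_lin)
    qed
    note k3 = invs_step[OF U cl(2) k2 S(2) this]
    have b3: "\<rho> ?b3 \<epsilon> \<in> \<Phi>" using d2 cl D by (simp add: h act_lin invs_def)
    have b3e: "\<rho> ?b3 \<eta> \<in> \<Phi>" using b2e cl(2) D by (simp add: h)
    obtain x where "x \<in> sbase U" "x \<in> invs ?b3" using sbase_inverted[OF cl(3)] k3 by blast
    then have d3: "\<delta> \<in> invs ?b3" using b3 b3e only not_pos_invs[OF cl(3)] by blast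
    have n3: "- \<rho> a ?z3 \<in> \<Phi>" using d3 a(1) D by (simp add: invs_def)
    show ?thesis
    proof (cases "c * c = 3")
      case False
      then have "c * c * c - 2 * c \<ge> 2 \<or> Q = c * c - 1 \<and> c * c = 2" using PQ Q1 by auto
      then have "c * c * c - 2 * c \<ge> 2" using c by auto
      then have val: "(c * c - 1) * (P - Q * c / 2) + (c * c - 1) * (- P / 2) + c * (Q - P * c / 2) \<le> -1"
        using PQ(1) Q1 by (simp add: algebra_simps)
      show ?thesis
      proof (rule fin[of ?z3 "c * c - 1" "c * c - 1" "c"])
        show "?z3 \<in> roots" using D by simp
        show "?z3 = (c * c - 1) *\<^sub>R \<delta> + (c * c - 1) *\<^sub>R \<eta> + (c) *\<^sub>R \<epsilon>" by (rule z3)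
        show "(c * c - 1) * (P - Q * c / 2) + (c * c - 1) * (- P / 2) + c * (Q - P * c / 2) \<le> -1" by (rule val)
        show "- \<rho> a ?z3 \<in> \<Phi>" by (rule n3)
      qed (use c in auto)
    next
      case cc: True
      have "?k3 \<noteq> \<delta>"
      proof
        assume "?k3 = \<delta>"
        then have "\<kappa> = ?z3" using r_act_twice[OF D(3), of \<kappa>] r_act_twice[OF D(1), of ?k1] r_act_twice[OF D(2), of ?k2] by simp
        then show False using k G cc unfolding z3 by (simp add: B_lin)
      qed
      note k4 = invs_step[OF U cl(3) k3 S(1) this]
      have b4: "\<rho> ?b4 \<delta> \<in> \<Phi>" using d3 cl D by (simp add: h act_lin invs_def)
      show ?thesis
      proof (cases "\<epsilon> \<in> invs ?b4")
        case True
        then have n4: "- \<rho> a ?z4 \<in> \<Phi>" using a(1) D by (simp add: invs_def)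
        have cccc: "c * c * c - c * 2 = c" using cc by simp
        have val: "c * (P - Q * c / 2) + c * (- P / 2) + 2 * (Q - P * c / 2) \<le> -1"
          using PQ(1) Q1 cc by (simp add: algebra_simps)
        show ?thesis
        proof (rule fin[of ?z4 "c" "c" "2"])
          show "?z4 \<in> roots" using D by simp
          show "?z4 = (c) *\<^sub>R \<delta> + (c) *\<^sub>R \<eta> + (2) *\<^sub>R \<epsilon>" using z4 unfolding cccc cc by simp
          show "c * (P - Q * c / 2) + c * (- P / 2) + 2 * (Q - P * c / 2) \<le> -1" by (rule val)
          show "- \<rho> a ?z4 \<in> \<Phi>" by (rule n4)
        qed (use c in auto)
      next
        case False
        then have e4: "\<rho> ?b4 \<epsilon> \<in> \<Phi>" using not_invs[OF cl(4) DP(2)] by simp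
        obtain x where "x \<in> sbase U" "x \<in> invs ?b4" using sbase_inverted[OF cl(4)] k4 by blast
        then have d4: "\<eta> \<in> invs ?b4" using b4 False only not_pos_invs[OF cl(4)] by blast
        have "?k4 \<noteq> \<eta>"
        proof
          assume "?k4 = \<eta>"
          then have "\<kappa> = ?z5" using r_act_twice[OF D(3), of \<kappa>] r_act_twice[OF D(1), of ?k1]
              r_act_twice[OF D(2), of ?k2] r_act_twice[OF D(1), of ?k3] by simp
          then show False using k G cc unfolding z5 by (simp add: B_lin)
        qed
        note k5 = invs_step[OF U cl(4) k4 S(3) this]
        have "\<rho> ?b5 \<eta> \<in> \<Phi>" using d4 cl D by (simp add: h act_lin invs_def)
        moreover have "\<rho> ?b5 \<epsilon> \<in> \<Phi>" using e4 cl(4) D by (simp add: h)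
        moreover have "\<rho> ?b5 \<delta> = \<rho> ?b4 (\<delta> + \<eta>)" using cl(4) D by (simp add: h)
        then have "\<rho> ?b5 \<delta> = \<rho> ?b3 \<eta>" using cl(3) D by (simp add: h act_lin)
        then have "\<rho> ?b5 \<delta> \<in> \<Phi>" using b3e by simp
        moreover obtain x where "x \<in> sbase U" "x \<in> invs ?b5" using sbase_inverted[OF cl(5)] k5 by blast
        ultimately show ?thesis using only not_pos_invs[OF cl(5)] by blast
      qed
    qed
  qed
qed

lemma span_replace:
  assumes "U = span {a, b, e}" "x \<in> U" "x \<notin> span {a, b}" shows "U = span {a, b, x}"
proof
  have "e \<in> span {a, b, x}"
  proof -
    have "{a, b, e} = insert e {a, b}" "{a, b, x} = insert x {a, b}" by auto
    then show ?thesis using in_span_insert[of x e "{a, b}"] assms by simp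
  qed
  then show "U \<subseteq> span {a, b, x}" unfolding assms(1) by (intro span_minimal) (auto intro: span_base)
  show "span {a, b, x} \<subseteq> U" using assms(2) unfolding assms(1) by (intro span_minimal) (auto intro: span_base)
qed

text \<open>Here \<open>a\<close> is the chamber at the intersection of the two walls, seen from the base chamber, so
  that the roots in \<open>invs a\<close> are those separating the two.\<close>

lemma separating_root_transfer:
  fixes m n :: nat
  assumes U: "U = span {\<delta>, \<epsilon>, e}" and S: "\<delta> \<in> sbase U" "\<epsilon> \<in> sbase U" "\<delta> \<noteq> \<epsilon>"
    and m: "m \<ge> 4" "2 \<le> n" "n + 2 \<le> m" and b: "B \<delta> \<epsilon> = - cos (pi / real m)"
    and P: "P = sin (real n * (pi / real m)) / sin (pi / real m)"
    and Q: "Q = sin (real (n + 1) * (pi / real m)) / sin (pi / real m)"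
    and a: "a \<in> carrier W" "\<rho> a \<delta> \<in> \<Phi>" "\<rho> a \<epsilon> \<in> \<Phi>"
    and k: "\<kappa> \<in> invs a" "\<kappa> \<in> U" "B \<kappa> \<delta> \<le> -1"
  shows "\<exists>k \<in> invs a \<inter> U. B k (P *\<^sub>R \<delta> + Q *\<^sub>R \<epsilon>) \<le> -1"
  using a k
proof (induction "len a" arbitrary: a \<kappa> rule: less_induct)
  case less
  note a = less.prems(1-3) and k = less.prems(4-6)
  have sub: "subspace U" using U by simp
  define c where "c = 2 * cos (pi / real m)"
  note C = dihedral_coeffs[OF m, folded c_def P Q]
  have bc: "B \<delta> \<epsilon> = - c / 2" using b c_def by simp
  obtain \<eta> where h: "\<eta> \<in> sbase U" "\<eta> \<in> invs a" using sbase_inverted[OF a(1)] k by blast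
  have ne: "\<eta> \<noteq> \<delta>" "\<eta> \<noteq> \<epsilon>" using h a not_pos_invs[OF a(1)] by blast+
  note D = S(1,2)[THEN sbaseD(3)] sbaseD(3)[OF h(1)] and DU = S(1,2)[THEN sbaseD(2)] sbaseD(2)[OF h(1)]
    and DP = S(1,2)[THEN sbaseD(1)] sbaseD(1)[OF h(1)]
  have nrm: "B \<delta> \<delta> = 1" "B \<epsilon> \<epsilon> = 1" "B \<eta> \<eta> = 1" using D root_norm by auto
  have "\<eta> \<notin> span {\<delta>, \<epsilon>}" unfolding in_span_pair using sbase_not_comb[OF sub S(1,2) h(1) ne S(3)] by blast
  then have U': "U = span {\<delta>, \<epsilon>, \<eta>}" using span_replace U DU by blast
  define g1 g2 where "g1 = - B \<eta> \<delta>" and "g2 = - B \<eta> \<epsilon>"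
  have g: "B \<eta> \<delta> = - g1" "B \<delta> \<eta> = - g1" "B \<eta> \<epsilon> = - g2" "B \<epsilon> \<eta> = - g2" "B \<epsilon> \<delta> = - c / 2"
    using B_sym bc by (auto simp: g1_def g2_def)
  have g0: "g1 \<ge> 0" "g2 \<ge> 0" unfolding g1_def g2_def using sbase_obtuse[OF sub h(1)] S ne by auto
  have gr1: "g1 = 0 \<or> g1 = 1 / 2 \<or> 2 * g1\<^sup>2 \<ge> 1" using sbase_gram[OF sub h(1) S(1) ne(1)] by (simp add: g1_def)
  have gr2: "g2 = 0 \<or> g2 = 1 / 2 \<or> 2 * g2\<^sup>2 \<ge> 1" using sbase_gram[OF sub h(1) S(2) ne(2)] by (simp add: g2_def)
  let ?z = "P *\<^sub>R \<delta> + Q *\<^sub>R \<epsilon>"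
  have Bz: "B \<eta> ?z = - (P * g1 + Q * g2)" using g by (simp add: B_lin)
  have P0: "P > 0" using C by linarith
  show ?case
  \<comment> \<open>If the product of \<eta> with the target root is already at most -1, \<eta>
    itself is the separating root.\<close>
  proof (cases "P * g1 + Q * g2 \<ge> 1")
    case True
    then show ?thesis using Bz h DU by force
  next
    case lt: False
    have Pg: "P * g1 < 1" and Qg: "Q * g2 < 1" using lt g0 C P0 by (smt (verit) mult_nonneg_nonneg)+
    \<comment> \<open>Otherwise \<open>P \<ge> c\<close> and \<open>c\<^sup>2 \<ge> 2\<close> would
      already give \<open>P * g1 \<ge> 1\<close>.\<close>
    have "\<not> 2 * g1\<^sup>2 \<ge> 1"
    proof
      assume "2 * g1\<^sup>2 \<ge> 1"
      have "P\<^sup>2 \<ge> c\<^sup>2" using C by (intro power_mono) auto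
      then have "P\<^sup>2 \<ge> 2" using C by linarith
      then have "P\<^sup>2 * g1\<^sup>2 \<ge> 2 * g1\<^sup>2" by (intro mult_right_mono) auto
      then have "1\<^sup>2 \<le> (P * g1)\<^sup>2" using \<open>2 * g1\<^sup>2 \<ge> 1\<close> by (simp add: power_mult_distrib)
      then have "1 \<le> P * g1" using P0 g0 power2_le_imp_le[of 1 "P * g1"] by simp
      then show False using Pg by simp
    qed
    then consider "g1 = 0" | "g1 = 1 / 2" using gr1 by blast
    then show ?thesis
    proof cases
      case 2
      \<comment> \<open>With \<open>g1 = 1 / 2\<close> this leaves \<open>Q * g2 < 1 / 2\<close>,
        and the possible Gram values then force \<open>g2 = 0\<close>: a chain with \<delta> in the
        middle.\<close>
      have "c \<ge> 1"
      proof (rule ccontr)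
        assume "\<not> c \<ge> 1"
        then have "c\<^sup>2 < 1\<^sup>2" using C by (intro power_strict_mono) auto
        then show False using C by simp
      qed
      then have "Q * g2 < 1 / 2" using lt C 2 by simp
      then have g2h: "g2 < 1 / 2" using mult_right_mono[OF C(5) g0(2)] by simp
      then have "\<not> 2 * g2\<^sup>2 \<ge> 1" using g0 power_strict_mono[of g2 "1/2" 2] by (simp add: power_divide)
      then have g20: "g2 = 0" using gr2 g2h by auto
      have U2: "U = span {\<eta>, \<delta>, \<epsilon>}" unfolding U' by (simp add: insert_commute)
      have bb: "B \<eta> \<delta> = - 1 / 2" "B \<delta> \<epsilon> = - c / 2" "B \<eta> \<epsilon> = 0" using 2 g20 g bc by auto
      have c3: "c\<^sup>2 \<ge> 3" using triple_posdef[OF U2 h(1) S(1,2) bb _ _ k(2) DP(1) DU(1)] k by (force simp: invs_def)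
      have P2: "\<not> P \<ge> 2" using Pg 2 by simp
      have only: "x \<in> {\<delta>, \<epsilon>, \<eta>}" if "x \<in> sbase U" for x
        using triple_sbase[OF U2 h(1) S(1,2) bb C(1,2) that] by blast
      have PQ: "P = c" "Q = c * c - 1 \<or> Q = 1 \<and> (c * c = 3 \<or> c * c * c - 2 * c \<ge> 2)"
        using C(7)[OF c3] P2 by (auto simp: power2_eq_square power3_eq_cube)
      show ?thesis using separating_root_near_end[OF sub S(1,2) h(1) only bb(1,3,2) _ C(1,2) PQ a h(2) k] c3
        by (simp add: power2_eq_square)
    next
      case 1
      let ?b = "a \<otimes> r \<eta>"
      have bcl: "?b \<in> carrier W" using a D by simp
      have bl: "len ?b < len a" using refl_shortens[OF a(1) h(2)] .
      have rd: "\<rho> (r \<eta>) \<delta> = \<delta>" using D g 1 by (simp add: r_act)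
      have bd: "\<rho> ?b \<delta> \<in> \<Phi>" using a D rd by simp
      have re: "\<rho> (r \<eta>) \<epsilon> = \<epsilon> + (2 * g2) *\<^sub>R \<eta>" using D g by (simp add: r_act)
      have kn: "\<kappa> \<noteq> \<eta>" using k g 1 by auto
      show ?thesis
      proof (cases "\<rho> ?b \<epsilon> \<in> \<Phi>")
        case True
        \<comment> \<open>The induction applies beyond the wall of \<eta>. The root
          \<open>k'\<close> found there is reflected back when its product with \<eta> is
          nonpositive, which does not raise the product with \<open>?z\<close>; otherwise
          \<open>k'\<close> is already inverted by \<open>a\<close>.\<close>
        note k1 = invs_step[OF sub a(1) k(1,2) h(1) kn]
        have "B (\<rho> (r \<eta>) \<kappa>) \<delta> = B \<kappa> \<delta>" using B_act_inv[of "r \<eta>" \<kappa> \<delta>] D rd by (simp add: r_inv)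
        then obtain k' where k': "k' \<in> invs ?b" "k' \<in> U" "B k' ?z \<le> -1"
          using less.hyps[OF bl bcl bd True k1] k by auto
        have bh: "\<rho> ?b \<eta> \<in> \<Phi>" using h a D by (simp add: r_act_self act_lin invs_def)
        show ?thesis
        proof (cases "B k' \<eta> \<le> 0")
          case True
          have "k' \<noteq> \<eta>" using not_pos_invs[OF bcl bh] k' by blast
          note k2 = invs_step[OF sub bcl k'(1,2) h(1) this]
          have "?b \<otimes> r \<eta> = a" using a D by (simp add: m_assoc r_sq)
          moreover have "B (\<rho> (r \<eta>) k') ?z = B k' ?z - 2 * B k' \<eta> * B \<eta> ?z" using D by (simp add: r_act B_lin algebra_simps)
          moreover have "B k' \<eta> * B \<eta> ?z \<ge> 0" using True Bz mult_nonneg_nonneg[of P g1] mult_nonneg_nonneg[of Q g2] P0 C(5) g0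
            by (intro mult_nonpos_nonpos) linarith+
          ultimately show ?thesis using k2 k' by (intro bexI[of _ "\<rho> (r \<eta>) k'"]) auto
        next
          case False
          have "\<rho> ?b k' = \<rho> a k' - (2 * B k' \<eta>) *\<^sub>R \<rho> a \<eta>" using a D by (simp add: r_act act_lin)
          then have e: "- \<rho> a k' = 1 *\<^sub>R (- \<rho> ?b k') + (2 * B k' \<eta>) *\<^sub>R (- \<rho> a \<eta>)" by (simp add: algebra_simps)
          have "- \<rho> a k' \<in> \<Phi>" using k' h a False by (intro K_comb_pos[OF _ e] pos_K) (auto simp: invs_def pos_root)
          then show ?thesis using k' by (auto simp: invs_def)
        qed
      next
        case False
        \<comment> \<open>Here \<open>a\<close> inverts the reflected root \<open>?s\<close>, which
          serves unless \<open>g2 = 1 / 2\<close> and the target is the exceptional root with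
          \<open>P = 2\<close> and \<open>Q = c\<close>.\<close>
        let ?s = "\<rho> (r \<eta>) \<epsilon>"
        have bn: "- \<rho> ?b \<epsilon> \<in> \<Phi>" using False neg_iff bcl D by simp
        have s: "?s \<in> invs a \<inter> U"
          using bn a D sbase_permutes[OF sub h(1) DP(2) DU(2)] ne act_r_subspace sub DU by (auto simp: invs_def)
        have Bs: "B ?s ?z = Q * (1 - 2 * g2\<^sup>2) - P * c / 2"
          unfolding re using g 1 bc nrm by (simp add: B_lin algebra_simps power2_eq_square)
        have "g2 \<noteq> 0"
        proof
          assume "g2 = 0"
          then have "\<rho> ?b \<epsilon> = \<rho> a \<epsilon>" using re a D by simp
          then show False using False a by simp
        qed
        then consider "2 * g2\<^sup>2 \<ge> 1" | "g2 = 1 / 2" using gr2 by blast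
        then show ?thesis
        proof cases
          case 1
          have "Q * (1 - 2 * g2\<^sup>2) \<le> 0" using 1 C by (simp add: mult_nonneg_nonpos)
          moreover have "P * c \<ge> c * c" using C by (intro mult_right_mono) auto
          moreover have "c * c \<ge> 2" using C by (simp add: power2_eq_square)
          ultimately have "B ?s ?z \<le> -1" unfolding Bs by linarith
          then show ?thesis using s by blast
        next
          case half: 2
          have U2: "U = span {\<eta>, \<epsilon>, \<delta>}" unfolding U' by (simp add: insert_commute)
          have bb: "B \<eta> \<epsilon> = - 1 / 2" "B \<epsilon> \<delta> = - c / 2" "B \<eta> \<delta> = 0" using half 1 g bc by auto
          have c3: "c\<^sup>2 \<ge> 3" using triple_posdef[OF U2 h(1) S(2,1) bb _ _ k(2) DP(1) DU(1)] k by (force simp: invs_def)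
          have only: "x \<in> {\<delta>, \<epsilon>, \<eta>}" if "x \<in> sbase U" for x
            using triple_sbase[OF U2 h(1) S(2,1) bb C(1,2) that] by blast
          have "\<not> Q \<ge> 2" using Qg half by simp
          then consider "c * P - Q \<ge> 2" | "c\<^sup>2 = 3" "P = 2" "Q = c" using C(6)[OF c3] by blast
          then show ?thesis
          proof cases
            case 1
            have "B ?s ?z \<le> -1" unfolding Bs half using 1 by (simp add: power_divide algebra_simps)
            then show ?thesis using s by blast
          next
            case 2
            show ?thesis unfolding 2 using separating_root_far_end[OF sub S(1,2) h(1) only bb(1,3) bc 2(1) C(1,2) a h(2) bn k] .
          qed
        qed
      qed
    qed
  qed
qed

end

section \<open>Small roots\<close>

text \<open>The points with \<open>f\<close> positive, together with the hull of the generators on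
  which \<open>f\<close> vanishes, form a convex cone containing all generators.\<close>

lemma cone_hull_face:
  assumes "linear f" "x \<in> convex_cone hull A" "\<And>a. a \<in> A \<Longrightarrow> f a \<ge> (0::real)" "f x = 0"
  shows "x \<in> convex_cone hull {a \<in> A. f a = 0}"
proof -
  let ?H = "convex_cone hull {a \<in> A. f a = 0}"
  let ?Z = "{x. f x \<ge> 0 \<and> (f x = 0 \<longrightarrow> x \<in> ?H)}"
  have "convex_cone ?Z"
  proof (rule convex_coneI)
    show "0 \<in> ?Z" using linear_0[OF assms(1)] convex_cone_hull_contains_0 by auto
  next
    fix x y assume "x \<in> ?Z" "y \<in> ?Z"
    then show "x + y \<in> ?Z" using linear_add[OF assms(1), of x y] convex_cone_hull_add by auto
  next
    fix x and c :: real assume x: "x \<in> ?Z" and c: "c \<ge> 0"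
    have "c *\<^sub>R x \<in> ?H" if "c * f x = 0"
    proof (cases "c = 0")
      case True then show ?thesis using convex_cone_hull_contains_0 by simp
    next
      case False then show ?thesis using that x c convex_cone_hull_mul by auto
    qed
    then show "c *\<^sub>R x \<in> ?Z" using linear_scale[OF assms(1), of c x] x c by auto
  qed
  moreover have "A \<subseteq> ?Z" using assms(3) by (auto intro: hull_inc)
  ultimately have "convex_cone hull A \<subseteq> ?Z" by (intro hull_minimal)
  then show ?thesis using assms(2,4) by blast
qed

lemma cone_hull_singleton: "x \<in> convex_cone hull {a} \<Longrightarrow> \<exists>t\<ge>0. x = t *\<^sub>R a"
proof -
  let ?Z = "{x. \<exists>t\<ge>0. x = t *\<^sub>R a}"
  have "convex_cone ?Z"
  proof (rule convex_coneI)
    show "0 \<in> ?Z" by (auto intro: exI[of _ 0])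
  next
    fix x y assume "x \<in> ?Z" "y \<in> ?Z"
    then obtain s t where "s \<ge> 0" "x = s *\<^sub>R a" "t \<ge> 0" "y = t *\<^sub>R a" by blast
    then show "x + y \<in> ?Z" by (auto intro!: exI[of _ "s + t"] simp: scaleR_left_distrib)
  next
    fix x and c :: real assume "x \<in> ?Z" "c \<ge> 0"
    then obtain s where "s \<ge> 0" "x = s *\<^sub>R a" by blast
    then show "c *\<^sub>R x \<in> ?Z" using \<open>c \<ge> 0\<close> by (auto intro!: exI[of _ "c * s"])
  qed
  moreover have "{a} \<subseteq> ?Z" by (auto intro: exI[of _ 1])
  ultimately have "convex_cone hull {a} \<subseteq> ?Z" by (intro hull_minimal)
  then show "x \<in> convex_cone hull {a} \<Longrightarrow> \<exists>t\<ge>0. x = t *\<^sub>R a" by blast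
qed

context geometric_representation
begin

definition nonsmall :: "'v \<Rightarrow> bool" where
  "nonsmall \<beta> \<longleftrightarrow> (\<exists>\<theta> \<in> \<Phi>. \<theta> \<noteq> \<beta> \<and> dom \<theta> \<beta>)"

text \<open>The dominated root \<theta> either stays positive under \<open>r \<epsilon>\<close>, and
  its image is dominated, or it is inverted by \<open>r \<epsilon>\<close>. In the latter case
  \<theta> itself is dominated: an element inverting the reflected \<beta> but not \<theta> would
  make \<epsilon> negative while keeping \<theta> and its partner positive, although these sum to a
  positive multiple of \<epsilon>.\<close>

lemma nonsmall_reflect:
  assumes p: "\<beta> \<in> \<Phi>" "\<epsilon> \<in> \<Phi>" and ns: "nonsmall \<beta>" and b: "B \<beta> \<epsilon> \<le> 0"
  shows "nonsmall (\<rho> (r \<epsilon>) \<beta>)"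
proof -
  note R = p[THEN pos_root]
  let ?z = "\<rho> (r \<epsilon>) \<beta>"
  obtain \<theta> where t: "\<theta> \<in> \<Phi>" "\<theta> \<noteq> \<beta>" "dom \<theta> \<beta>" using ns nonsmall_def by blast
  have d: "dom (\<rho> (r \<epsilon>) \<theta>) ?z" using dom_act t R by simp
  show ?thesis
  proof (cases "\<rho> (r \<epsilon>) \<theta> \<in> \<Phi>")
    case True
    then show ?thesis unfolding nonsmall_def using d t R by (intro bexI[of _ "\<rho> (r \<epsilon>) \<theta>"]) auto
  next
    case False
    then have ti: "\<theta> \<in> invs (r \<epsilon>)" using not_invs[of "r \<epsilon>" \<theta>] t R by auto
    have ze: "?z = \<beta> + (- 2 * B \<beta> \<epsilon>) *\<^sub>R \<epsilon>" using r_act R by simp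
    have "dom \<theta> ?z" unfolding dom_def
    proof (intro ballI impI)
      fix w assume w: "w \<in> carrier W" "- \<rho> w ?z \<in> \<Phi>"
      show "- \<rho> w \<theta> \<in> \<Phi>"
      proof (rule ccontr)
        assume n: "- \<rho> w \<theta> \<notin> \<Phi>"
        then have wt: "\<rho> w \<theta> \<in> \<Phi>" using neg_iff[of "\<rho> w \<theta>"] w t pos_root by auto
        have "- \<rho> w \<beta> \<notin> \<Phi>" using n domD[OF t(3)] w by blast
        then have wb: "\<rho> w \<beta> \<in> \<Phi>" using neg_iff[of "\<rho> w \<beta>"] w R by auto
        have we: "- \<rho> w \<epsilon> \<in> \<Phi>"
        proof (rule ccontr)
          assume "- \<rho> w \<epsilon> \<notin> \<Phi>"
          then have e: "\<rho> w \<epsilon> \<in> \<Phi>" using neg_iff[of "\<rho> w \<epsilon>"] w R by auto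
          have "\<rho> w ?z = \<rho> w \<beta> + (- 2 * B \<beta> \<epsilon>) *\<^sub>R \<rho> w \<epsilon>" unfolding ze using w by (simp only: act_lin)
          also have "\<dots> \<in> K" using wb e b by (intro K_add K_scale pos_K) auto
          finally show False using pos_not_neg_K[OF w(2)] by simp
        qed
        have "- \<rho> w (\<rho> (r \<epsilon>) \<theta>) \<in> \<Phi>" using domD[OF d] w by blast
        then have s: "\<rho> w (- \<rho> (r \<epsilon>) \<theta>) \<in> K" using w pos_K by (simp add: act_lin)
        have bp: "B \<theta> \<epsilon> > 0" using invs_r_pair(1)[OF p(2) ti] .
        have "\<rho> w \<theta> + (\<rho> w (- \<rho> (r \<epsilon>) \<theta>) + (2 * B \<theta> \<epsilon>) *\<^sub>R (- \<rho> w \<epsilon>)) = 0"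
          unfolding invs_r_pair(3)[OF p(2) ti] using w by (simp add: act_lin)
        moreover have "(2 * B \<theta> \<epsilon>) *\<^sub>R (- \<rho> w \<epsilon>) \<in> K" using bp we by (intro K_scale pos_K) auto
        ultimately have "\<rho> w \<theta> = 0" using K_sum_zero(1) wt s K_add pos_K by metis
        then show False using wt root_nz pos_root by blast
      qed
    qed
    moreover have "\<theta> \<noteq> ?z" using False R p by auto
    ultimately show ?thesis unfolding nonsmall_def using t by blast
  qed
qed

text \<open>By \<open>disjoint_pair\<close> no element inverts both \<open>k\<close> and
  \<open>\<rho> (inv u) \<zeta>\<close>. Read at \<open>u\<close>, this says that every element
  inverting \<zeta> also inverts \<open>- \<rho> u k\<close>.\<close>

lemma nonsmall_of_disjoint:
  assumes "u \<in> carrier W" "k \<in> invs u" "\<zeta> \<in> \<Phi>" "\<rho> (inv u) \<zeta> \<in> \<Phi>" "B k (\<rho> (inv u) \<zeta>) \<le> -1"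
  shows "nonsmall \<zeta>"
proof -
  have k: "k \<in> \<Phi>" "- \<rho> u k \<in> \<Phi>" using assms by (auto simp: invs_def)
  have "dom (- \<rho> u k) \<zeta>" unfolding dom_def
  proof (intro ballI impI)
    fix w assume w: "w \<in> carrier W" "- \<rho> w \<zeta> \<in> \<Phi>"
    have z: "\<rho> (inv u) \<zeta> \<in> invs (w \<otimes> u)" using assms w by (simp add: invs_def)
    have "\<not> k \<in> invs (w \<otimes> u)" using disjoint_pair[OF _ _ z] assms(1,5) w by force
    then have "\<rho> (w \<otimes> u) k \<in> \<Phi>" using not_invs[of "w \<otimes> u" k] w assms(1) k by simp
    then show "- \<rho> w (- \<rho> u k) \<in> \<Phi>" using w assms(1) by (simp add: act_lin)
  qed
  moreover have "- \<rho> u k \<noteq> \<zeta>"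
  proof
    assume "- \<rho> u k = \<zeta>"
    then have "\<rho> (inv u) \<zeta> = - k" using assms(1) by (auto simp: act_lin)
    then show False using assms(4) k not_pos_neg by auto
  qed
  ultimately show ?thesis unfolding nonsmall_def using k by blast
qed

text \<open>Let \<open>y\<close> invert only \<beta> within \<open>U\<close>. If \<open>w\<close>
  inverted \<zeta> but not \<beta>, then \<open>y \<otimes> inv w\<close> would invert
  \<open>\<rho> w \<beta>\<close> and \<open>- \<rho> w \<zeta>\<close>, whose product is at most
  -1.\<close>

lemma nonsmall_of_B_ge:
  assumes "\<beta> \<in> sbase U" "\<zeta> \<in> \<Phi>" "\<zeta> \<in> U" "\<zeta> \<noteq> \<beta>" "B \<zeta> \<beta> \<ge> 1"
  shows "nonsmall \<zeta>"
proof -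
  note D = sbaseD[OF assms(1)]
  obtain y where y: "y \<in> carrier W" "- \<rho> y \<beta> \<in> \<Phi>" "\<And>z. z \<in> \<Phi> \<Longrightarrow> z \<in> U \<Longrightarrow> z \<noteq> \<beta> \<Longrightarrow> \<rho> y z \<in> \<Phi>"
    using sbase_witness assms(1) by blast
  have "dom \<beta> \<zeta>" unfolding dom_def
  proof (intro ballI impI)
    fix w assume w: "w \<in> carrier W" "- \<rho> w \<zeta> \<in> \<Phi>"
    show "- \<rho> w \<beta> \<in> \<Phi>"
    proof (rule ccontr)
      assume "- \<rho> w \<beta> \<notin> \<Phi>"
      then have wb: "\<rho> w \<beta> \<in> \<Phi>" using neg_iff[of "\<rho> w \<beta>"] w D by auto
      let ?u = "y \<otimes> inv w"
      have "\<rho> w \<beta> \<in> invs ?u" using wb y w by (simp add: invs_def)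
      moreover have "- \<rho> w \<zeta> \<in> invs ?u" using y w assms by (simp add: invs_def act_lin)
      moreover have "B (\<rho> w \<beta>) (- \<rho> w \<zeta>) \<le> -1" using w assms B_sym by (simp add: B_lin B_invariant)
      ultimately show False using disjoint_pair[of ?u] y w by force
    qed
  qed
  then show ?thesis unfolding nonsmall_def using D(1) assms(4) by (intro bexI[of _ \<beta>]) auto
qed

text \<open>Norm one makes both products of \<zeta> with the simple roots at least 1 in absolute
  value, and their combination with the positive weights \<open>P\<close> and \<open>Q\<close>
  equals 1. So one of them is positive, hence at least 1.\<close>

lemma nonsmall_infinite:
  assumes S: "\<beta> \<in> sbase U" "\<epsilon> \<in> sbase U" and b: "B \<beta> \<epsilon> \<le> -1"
    and z: "\<zeta> = P *\<^sub>R \<beta> + Q *\<^sub>R \<epsilon>" "\<zeta> \<in> \<Phi>" "\<zeta> \<in> U" "\<zeta> \<noteq> \<beta>" "\<zeta> \<noteq> \<epsilon>" and P: "P > 0" "Q > 0"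
  shows "nonsmall \<zeta>"
proof -
  note D = S[THEN sbaseD(3)]
  define g where "g = - B \<beta> \<epsilon>"
  have g: "g \<ge> 1" "B \<beta> \<epsilon> = - g" "B \<epsilon> \<beta> = - g" using b B_sym[of \<epsilon> \<beta>] by (auto simp: g_def)
  have e1: "B \<zeta> \<beta> = P - g * Q" and e2: "B \<zeta> \<epsilon> = Q - g * P" unfolding z(1) using g D root_norm by (auto simp: B_lin)
  have "B \<zeta> \<zeta> = P * B \<zeta> \<beta> + Q * B \<zeta> \<epsilon>" by (subst (2) z(1)) (simp add: B_lin)
  then have n: "P * B \<zeta> \<beta> + Q * B \<zeta> \<epsilon> = 1" using root_norm pos_root z by simp
  have gg: "g * g - 1 \<ge> 0" using g mult_mono[of 1 g 1 g] by simp
  have "(B \<zeta> \<beta>)\<^sup>2 = 1 + (g * g - 1) * (Q * Q)" using n unfolding e1 e2 by (simp add: power2_eq_square algebra_simps)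
  moreover have "(B \<zeta> \<epsilon>)\<^sup>2 = 1 + (g * g - 1) * (P * P)" using n unfolding e1 e2 by (simp add: power2_eq_square algebra_simps)
  ultimately have "(B \<zeta> \<beta>)\<^sup>2 \<ge> 1\<^sup>2" "(B \<zeta> \<epsilon>)\<^sup>2 \<ge> 1\<^sup>2" using gg by auto
  then have q: "B \<zeta> \<beta> > 0 \<Longrightarrow> B \<zeta> \<beta> \<ge> 1" "B \<zeta> \<epsilon> > 0 \<Longrightarrow> B \<zeta> \<epsilon> \<ge> 1"
    using power2_le_imp_le[of 1 "B \<zeta> \<beta>"] power2_le_imp_le[of 1 "B \<zeta> \<epsilon>"] by auto
  have "B \<zeta> \<beta> > 0 \<or> B \<zeta> \<epsilon> > 0"
  proof (rule ccontr)
    assume "\<not> ?thesis"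
    then have "P * B \<zeta> \<beta> \<le> 0" "Q * B \<zeta> \<epsilon> \<le> 0" using P by (auto simp: mult_nonneg_nonpos)
    then show False using n by simp
  qed
  then show ?thesis using q nonsmall_of_B_ge[OF S(1) z(2,3,4)] nonsmall_of_B_ge[OF S(2) z(2,3,5)] by blast
qed

text \<open>The product of the two reflections rotates the plane, and a rotation power plus its
  inverse is twice a cosine. The power is chosen so that this cosine is nonpositive.\<close>

lemma rotation_relation:
  assumes R: "\<beta> \<in> roots" "\<epsilon> \<in> roots" and b: "-1 < B \<beta> \<epsilon>" "B \<beta> \<epsilon> < 0"
  shows "\<exists>u \<in> carrier W. \<exists>v \<in> carrier W. \<exists>t\<ge>0. \<forall>x \<in> span {\<beta>, \<epsilon>}. \<rho> u x + \<rho> v x + t *\<^sub>R x = 0"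
proof -
  \<comment> \<open>The rotation angle is twice the angle between the mirrors; it is below
    \<open>pi\<close> because the product of the two roots is negative.\<close>
  define \<theta> where "\<theta> = 2 * arccos (- B \<beta> \<epsilon>)"
  have ct: "cos (\<theta> / 2) = - B \<beta> \<epsilon>" unfolding \<theta>_def using b by (simp add: cos_arccos)
  have th: "0 < \<theta>" "\<theta> < pi" unfolding \<theta>_def
    using arccos_lt_bounded[of "- B \<beta> \<epsilon>"] arccos_less_arccos[of 0 "- B \<beta> \<epsilon>"] b by auto
  define \<mu> where "\<mu> = 2 * cos \<theta>"
  have "cos \<theta> = 2 * (cos (\<theta> / 2))\<^sup>2 - 1" using cos_double_cos[of "\<theta> / 2"] by simp
  then have mu: "\<mu> = 4 * (B \<beta> \<epsilon> * B \<beta> \<epsilon>) - 2" unfolding \<mu>_def ct by (simp add: power2_eq_square)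
  let ?R = "r \<beta> \<otimes> r \<epsilon>" and ?V = "r \<epsilon> \<otimes> r \<beta>"
  have cl: "?R \<in> carrier W" "?V \<in> carrier W" using R by auto
  have RV: "\<rho> ?R (\<rho> ?V x) = x" "\<rho> ?V (\<rho> ?R x) = x" for x using R by simp_all
  have nrm: "B \<beta> \<beta> = 1" "B \<epsilon> \<epsilon> = 1" using R root_norm by auto
  have bs: "B \<epsilon> \<beta> = B \<beta> \<epsilon>" by (rule B_sym)
  have h: "\<rho> (r \<beta>) \<beta> = - \<beta>" "\<rho> (r \<epsilon>) \<epsilon> = - \<epsilon>" "\<rho> (r \<beta>) \<epsilon> = \<epsilon> - (2 * B \<beta> \<epsilon>) *\<^sub>R \<beta>"
    "\<rho> (r \<epsilon>) \<beta> = \<beta> - (2 * B \<beta> \<epsilon>) *\<^sub>R \<epsilon>"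
    using R bs by (simp_all add: r_act_self) (simp_all add: r_act)
  have g1: "\<rho> ?R \<beta> + \<rho> ?V \<beta> = \<mu> *\<^sub>R \<beta>" "\<rho> ?R \<epsilon> + \<rho> ?V \<epsilon> = \<mu> *\<^sub>R \<epsilon>" unfolding mu
    using R by (simp_all add: h act_lin algebra_simps scaleR_2)
  have A1: "\<rho> ?R x + \<rho> ?V x = \<mu> *\<^sub>R x" if "x \<in> span {\<beta>, \<epsilon>}" for x
  proof -
    obtain k l where x: "x = k *\<^sub>R \<beta> + l *\<^sub>R \<epsilon>" using \<open>x \<in> span {\<beta>, \<epsilon>}\<close> in_span_pair by blast
    have "\<rho> ?R x + \<rho> ?V x = k *\<^sub>R (\<rho> ?R \<beta> + \<rho> ?V \<beta>) + l *\<^sub>R (\<rho> ?R \<epsilon> + \<rho> ?V \<epsilon>)"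
      unfolding x using cl by (simp only: act_lin) (simp add: algebra_simps)
    then show ?thesis unfolding g1 x by (simp add: algebra_simps)
  qed
  have pw: "\<rho> (?R [^] n) x + \<rho> (?V [^] n) x = (2 * cos (real n * \<theta>)) *\<^sub>R x" if x: "x \<in> span {\<beta>, \<epsilon>}" for n :: nat and x
  proof (induction n rule: induct_nat_012)
    case 0
    then show ?case using R by (simp add: scaleR_2)
  next
    case 1
    then show ?case using A1[OF x] cl \<mu>_def by simp
  next
    case (ge2 n)
    have p: "?R [^] n \<in> carrier W" "?V [^] n \<in> carrier W" using cl by auto
    have "\<mu> *\<^sub>R (\<rho> (?R [^] Suc n) x + \<rho> (?V [^] Suc n) x) = \<rho> (?R [^] Suc n) (\<rho> ?R x + \<rho> ?V x) + \<rho> (?V [^] Suc n) (\<rho> ?R x + \<rho> ?V x)"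
      unfolding A1[OF x] using cl by (simp only: act_lin nat_pow_closed scaleR_add_right)
    also have "\<dots> = (\<rho> (?R [^] Suc (Suc n)) x + \<rho> (?V [^] Suc (Suc n)) x) + (\<rho> (?R [^] n) x + \<rho> (?V [^] n) x)"
    proof -
      have "\<rho> (?R [^] Suc n) (\<rho> ?V x) = \<rho> (?R [^] n) x" "\<rho> (?V [^] Suc n) (\<rho> ?R x) = \<rho> (?V [^] n) x"
        unfolding nat_pow_Suc act_mult[OF p(1) cl(1)] act_mult[OF p(2) cl(2)] RV by simp_all
      moreover have "\<rho> (?R [^] Suc n) (\<rho> ?R x) = \<rho> (?R [^] Suc (Suc n)) x" "\<rho> (?V [^] Suc n) (\<rho> ?V x) = \<rho> (?V [^] Suc (Suc n)) x"
        using cl by (simp_all only: nat_pow_Suc nat_pow_closed act_mult m_closed)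
      moreover have "?R [^] Suc n \<in> carrier W" "?V [^] Suc n \<in> carrier W" using cl by auto
      ultimately show ?thesis by (simp only: act_lin) (simp only: ac_simps)
    qed
    finally have "\<rho> (?R [^] Suc (Suc n)) x + \<rho> (?V [^] Suc (Suc n)) x = (\<mu> * (2 * cos (real (Suc n) * \<theta>)) - 2 * cos (real n * \<theta>)) *\<^sub>R x"
      unfolding ge2 by (simp add: algebra_simps)
    moreover have "\<mu> * (2 * cos (real (Suc n) * \<theta>)) - 2 * cos (real n * \<theta>) = 2 * cos (real (Suc (Suc n)) * \<theta>)"
    proof -
      have hh: "cos (z + \<theta>) + cos (z - \<theta>) = 2 * cos \<theta> * cos z" for z :: real by (simp add: cos_add cos_diff)
      have e: "real (Suc n) * \<theta> + \<theta> = real (Suc (Suc n)) * \<theta>" "real (Suc n) * \<theta> - \<theta> = real n * \<theta>" by (simp_all add: algebra_simps)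
      show ?thesis using hh[of "real (Suc n) * \<theta>"] unfolding e \<mu>_def by simp
    qed
    ultimately show ?case by simp
  qed
  obtain n :: nat where n: "cos (real n * \<theta>) \<le> 0" using cos_multiple_nonpos th by blast
  have "\<rho> (?R [^] n) x + \<rho> (?V [^] n) x + (- 2 * cos (real n * \<theta>)) *\<^sub>R x = 0" if "x \<in> span {\<beta>, \<epsilon>}" for x
    using pw[OF that, of n] by simp
  moreover have "- 2 * cos (real n * \<theta>) \<ge> 0" using n by simp
  moreover have "?R [^] n \<in> carrier W" "?V [^] n \<in> carrier W" using cl by auto
  ultimately show ?thesis by blast
qed

section \<open>Bipodality\<close>

text \<open>The operator \<open>M = u + v + t\<close> of the relation above kills the plane and maps all but finitely many
  positive roots into the simple cone, so those outside the plane all lie on the same side of it.\<close>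

lemma finite_plane_functional:
  assumes S: "\<beta> \<in> \<Phi>" "\<epsilon> \<in> \<Phi>" "\<beta> \<noteq> \<epsilon>" and b: "-1 < B \<beta> \<epsilon>" "B \<beta> \<epsilon> < 0"
    and t: "\<theta> \<notin> span {\<beta>, \<epsilon>}" and U: "U = span {\<beta>, \<epsilon>, \<theta>}"
  shows "\<exists>f. linear f \<and> (\<forall>x \<in> U. f x = (0::real) \<longleftrightarrow> x \<in> span {\<beta>, \<epsilon>}) \<and> finite {\<kappa> \<in> \<Phi> \<inter> U. f \<kappa> < 0}"
proof -
  have "\<beta> \<notin> span {\<epsilon>}"
  proof
    assume "\<beta> \<in> span {\<epsilon>}"
    then obtain k where "\<beta> = k *\<^sub>R \<epsilon>" by (auto simp: span_singleton)
    then show False using unit_multiple S by blast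
  qed
  then have "independent {\<theta>, \<beta>, \<epsilon>}" using t S root_nz pos_root by (auto simp: independent_insert span_base)
  then obtain g where g: "linear g" "g \<beta> = 0" "g \<epsilon> = 0" "g \<theta> = (1::real)"
    using linear_independent_extend[of "{\<theta>, \<beta>, \<epsilon>}" "\<lambda>x. if x = \<theta> then 1 else 0"] t
    by (metis insert_iff span_base)
  have gU: "\<exists>y \<in> span {\<beta>, \<epsilon>}. x = y + g x *\<^sub>R \<theta>" if x: "x \<in> U" for x
  proof -
    obtain k l n where "x = k *\<^sub>R \<beta> + l *\<^sub>R \<epsilon> + n *\<^sub>R \<theta>" using x U in_span_triple by blast
    moreover have "g (k *\<^sub>R \<beta> + l *\<^sub>R \<epsilon> + n *\<^sub>R \<theta>) = n" using g by (simp add: linear_add linear_scale)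
    ultimately show ?thesis by (intro bexI[of _ "k *\<^sub>R \<beta> + l *\<^sub>R \<epsilon>"]) (auto simp: in_span_pair)
  qed
  have g0: "g x = 0 \<longleftrightarrow> x \<in> span {\<beta>, \<epsilon>}" if "x \<in> U" for x
  proof
    assume "g x = 0" then show "x \<in> span {\<beta>, \<epsilon>}" using gU[OF that] by auto
  next
    assume "x \<in> span {\<beta>, \<epsilon>}"
    then show "g x = 0" using g by (auto simp: in_span_pair linear_add linear_scale)
  qed
  obtain u v t0 where uv: "u \<in> carrier W" "v \<in> carrier W" "t0 \<ge> 0" "\<And>x. x \<in> span {\<beta>, \<epsilon>} \<Longrightarrow> \<rho> u x + \<rho> v x + t0 *\<^sub>R x = 0"
    using rotation_relation[of \<beta> \<epsilon>] S pos_root b by blast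
  define M where "M x = \<rho> u x + \<rho> v x + t0 *\<^sub>R x" for x
  have M: "M x = g x *\<^sub>R M \<theta>" if x: "x \<in> U" for x
  proof -
    obtain y where y: "y \<in> span {\<beta>, \<epsilon>}" "x = y + g x *\<^sub>R \<theta>" using gU[OF x] by blast
    have "M (y + g x *\<^sub>R \<theta>) = M y + g x *\<^sub>R M \<theta>" unfolding M_def using uv by (simp add: act_lin algebra_simps)
    then show ?thesis using y uv(4)[of y] by (simp add: M_def)
  qed
  define F where "F = invs u \<union> invs v"
  have F: "finite F" unfolding F_def using finite_invs uv by simp
  have MK: "M x \<in> K \<and> M x \<noteq> 0" if x: "x \<in> \<Phi>" "x \<notin> F" for x
  proof -
    have p: "\<rho> u x \<in> \<Phi>" "\<rho> v x \<in> \<Phi>" using x not_invs uv unfolding F_def by auto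
    have k: "\<rho> v x + t0 *\<^sub>R x \<in> K" using p x uv by (intro K_add K_scale pos_K)
    have "M x = \<rho> u x + (\<rho> v x + t0 *\<^sub>R x)" by (simp add: M_def)
    then show ?thesis using K_add K_sum_zero(1) k p pos_K root_nz pos_root by metis
  qed
  have opp: False if x: "x \<in> \<Phi>" "x \<in> U" "x \<notin> F" "g x < 0" and y: "y \<in> \<Phi>" "y \<in> U" "y \<notin> F" "g y > 0" for x y
  proof -
    have "g y *\<^sub>R M x + (- g x) *\<^sub>R M y = 0" unfolding M[OF x(2)] M[OF y(2)] by (simp add: mult.commute)
    moreover have "g y *\<^sub>R M x \<in> K" "(- g x) *\<^sub>R M y \<in> K"
      using MK[OF x(1,3)] MK[OF y(1,3)] x(4) y(4) by (intro K_scale; simp)+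
    ultimately have "g y *\<^sub>R M x = 0" using K_sum_zero(1) by blast
    then show False using MK x y by auto
  qed
  show ?thesis
  \<comment> \<open>By \<open>opp\<close> the functional \<open>g\<close> does not take both signs
    on the positive roots of \<open>U\<close> outside \<open>F\<close>; the sign that makes it
    nonnegative there is chosen.\<close>
  proof (cases "\<exists>y \<in> \<Phi> \<inter> U - F. g y > 0")
    case True
    then obtain y where y: "y \<in> \<Phi>" "y \<in> U" "y \<notin> F" "g y > 0" by blast
    have "{\<kappa> \<in> \<Phi> \<inter> U. g \<kappa> < 0} \<subseteq> F"
    proof
      fix x assume "x \<in> {\<kappa> \<in> \<Phi> \<inter> U. g \<kappa> < 0}"
      then show "x \<in> F" using opp[of x y] y by blast
    qed
    then have "finite {\<kappa> \<in> \<Phi> \<inter> U. g \<kappa> < 0}" using F finite_subset by blast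
    then show ?thesis using g(1) g0 by blast
  next
    case False
    then have "{\<kappa> \<in> \<Phi> \<inter> U. - g \<kappa> < 0} \<subseteq> F" by force
    moreover have "linear (\<lambda>x. - g x)" using g(1) by (rule linear_compose_neg)
    ultimately show ?thesis using g0 F finite_subset by (intro exI[of _ "\<lambda>x. - g x"]) auto
  qed
qed

lemma act_image_iff: "a \<in> carrier W \<Longrightarrow> x \<in> \<rho> (inv a) ` U \<longleftrightarrow> \<rho> a x \<in> U"
  by (metis act_inv image_eqI imageE)

text \<open>Walking along the walls of chambers, each crossed wall being on the wrong side of the functional
  \<open>f\<close>, leads to a chamber at the intersection of the two walls.\<close>

lemma chamber_at_intersection:
  assumes U2: "V = span {\<beta>, \<epsilon>}" and S: "\<beta> \<in> sbase V" "\<epsilon> \<in> sbase V" "\<beta> \<noteq> \<epsilon>" and b: "-1 < B \<beta> \<epsilon>" "B \<beta> \<epsilon> < 0"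
    and t: "\<theta> \<notin> V" and U: "U = span {\<beta>, \<epsilon>, \<theta>}"
  shows "\<exists>a \<in> carrier W. \<rho> (inv a) \<beta> \<in> sbase (\<rho> (inv a) ` U) \<and> \<rho> (inv a) \<epsilon> \<in> sbase (\<rho> (inv a) ` U)"
proof -
  note D = S(1,2)[THEN sbaseD(3)] and DP = S(1,2)[THEN sbaseD(1)]
  have subV: "subspace V" and subU: "subspace U" using U2 U by auto
  obtain f where f: "linear f" "\<And>x. x \<in> U \<Longrightarrow> f x = (0::real) \<longleftrightarrow> x \<in> V" "finite {\<kappa> \<in> \<Phi> \<inter> U. f \<kappa> < 0}"
    using finite_plane_functional[OF DP S(3) b t[unfolded U2] U] unfolding U2[symmetric] by blast
  have VU: "V \<subseteq> U" unfolding U2 U by (intro span_mono) auto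
  have in_U: "\<beta> \<in> V" "\<epsilon> \<in> V" unfolding U2 by (auto intro: span_base)
  have fb: "f \<beta> = 0" "f \<epsilon> = 0" using f(2) in_U VU by auto
  \<comment> \<open>These roots of \<open>U\<close> are positive as seen from \<open>a\<close> but
    on the wrong side of \<open>f\<close>. They are finite in number for the identity, so a chamber
    with fewest of them exists among those that keep \<beta> and \<epsilon> positive.\<close>
  define Sep where "Sep a = {\<kappa> \<in> roots \<inter> U. \<rho> (inv a) \<kappa> \<in> \<Phi> \<and> f \<kappa> < 0}" for a
  define good where "good a \<longleftrightarrow> a \<in> carrier W \<and> \<rho> (inv a) \<beta> \<in> \<Phi> \<and> \<rho> (inv a) \<epsilon> \<in> \<Phi> \<and> finite (Sep a)" for a
  have "Sep \<one> = {\<kappa> \<in> \<Phi> \<inter> U. f \<kappa> < 0}" 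
    unfolding Sep_def using act_one pos_root by (auto simp only: inv_one)
  then have "good \<one>" unfolding good_def using f(3) DP by (simp only: inv_one act_one one_closed)
  then obtain a where ga: "good a" and min: "\<And>x. good x \<Longrightarrow> card (Sep a) \<le> card (Sep x)"
    using ex_has_least_nat[of good \<one> "\<lambda>x. card (Sep x)"] by blast
  have a: "a \<in> carrier W" "\<rho> (inv a) \<beta> \<in> \<Phi>" "\<rho> (inv a) \<epsilon> \<in> \<Phi>" "finite (Sep a)" using ga unfolding good_def by auto
  let ?U = "\<rho> (inv a) ` U"
  have subU': "subspace ?U" using subU act_linear[of "inv a"] a by (intro linear_subspace_image) auto
  \<comment> \<open>If a simple root of the moved subspace were on the wrong side, crossing its wall
    would remove exactly that root from \<open>Sep a\<close>.\<close>
  have pos: "f (\<rho> a \<delta>) \<ge> 0" if d: "\<delta> \<in> sbase ?U" for \<delta>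
  proof (rule ccontr)
    assume n: "\<not> f (\<rho> a \<delta>) \<ge> 0"
    note E = sbaseD[OF d]
    let ?a = "a \<otimes> r \<delta>"
    have ac: "?a \<in> carrier W" and ia: "inv ?a = r \<delta> \<otimes> inv a" using a E by (auto simp: inv_mult_group r_inv)
    have aU: "\<rho> a \<delta> \<in> U" using E(2) act_image_iff a by blast
    have sep: "Sep ?a = Sep a - {\<rho> a \<delta>}"
    proof -
      have "\<rho> (inv ?a) \<kappa> \<in> \<Phi> \<longleftrightarrow> \<rho> (inv a) \<kappa> \<in> \<Phi> \<and> \<kappa> \<noteq> \<rho> a \<delta>" if k: "\<kappa> \<in> roots" "\<kappa> \<in> U" "f \<kappa> < 0" for \<kappa>
      proof -
        let ?t = "\<rho> (inv a) \<kappa>"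
        have tU: "?t \<in> ?U" using k by blast
        have tr: "?t \<in> roots" using k a by simp
        have kt: "\<rho> a ?t = \<kappa>" using a by simp
        have "\<rho> (inv ?a) \<kappa> = \<rho> (r \<delta>) ?t" using ia a E by simp
        moreover have "\<rho> (r \<delta>) ?t \<in> \<Phi> \<longleftrightarrow> ?t \<in> \<Phi> \<and> ?t \<noteq> \<delta>"
        proof
          assume h: "\<rho> (r \<delta>) ?t \<in> \<Phi>"
          have "?t \<in> \<Phi>"
          proof (rule ccontr)
            assume "?t \<notin> \<Phi>"
            then have m: "- ?t \<in> \<Phi>" using neg_iff tr by blast
            have "- ?t = \<delta>"
            proof (rule ccontr)
              assume "- ?t \<noteq> \<delta>"
              then have "\<rho> (r \<delta>) (- ?t) \<in> \<Phi>" using sbase_permutes[OF subU' d m] tU subU' subspace_neg by blast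
              then show False using h not_pos_neg E by (simp add: act_lin)
            qed
            then have "\<rho> a \<delta> = - \<kappa>" using kt a by (metis act_lin(3))
            then show False using n k linear_neg[OF f(1)] by simp
          qed
          moreover have "?t \<noteq> \<delta>" using h E not_pos_neg[OF E(1)] r_act_self[OF E(3)] by auto
          ultimately show "?t \<in> \<Phi> \<and> ?t \<noteq> \<delta>" by blast
        next
          assume "?t \<in> \<Phi> \<and> ?t \<noteq> \<delta>"
          then show "\<rho> (r \<delta>) ?t \<in> \<Phi>" using sbase_permutes[OF subU' d _ tU] by blast
        qed
        moreover have "?t = \<delta> \<longleftrightarrow> \<kappa> = \<rho> a \<delta>" using act_inv[OF a(1)] by metis
        ultimately show ?thesis by metis
      qed
      then show ?thesis unfolding Sep_def by blast
    qed
    have "\<rho> a \<delta> \<in> Sep a" unfolding Sep_def using aU n E a by simp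
    then have less: "card (Sep ?a) < card (Sep a)" unfolding sep by (rule card_Diff1_less[OF a(4)])
    have "\<rho> (inv ?a) x \<in> \<Phi>" if x: "\<rho> (inv a) x \<in> \<Phi>" "x \<in> V" "f x = 0" for x
    proof -
      have "\<rho> (inv a) x \<noteq> \<delta>"
      proof
        assume "\<rho> (inv a) x = \<delta>"
        then have "\<rho> a \<delta> = x" using act_inv(2)[OF a(1)] by metis
        then show False using n x(3) by simp
      qed
      moreover have "\<rho> (inv a) x \<in> ?U" using x VU by blast
      ultimately have "\<rho> (r \<delta>) (\<rho> (inv a) x) \<in> \<Phi>" using sbase_permutes[OF subU' d x(1)] by blast
      then show ?thesis using ia a E by simp
    qed
    moreover have "finite (Sep ?a)" unfolding sep using a(4) by simp
    ultimately have "good ?a" unfolding good_def using ac a(2,3) in_U fb by blast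
    then show False using min[of ?a] less by linarith
  qed
  \<comment> \<open>A moved root of the plane lies in the cone of the simple roots on which
    \<open>f\<close> vanishes. These are among the moved \<beta> and \<epsilon>, since any other
    would be a nonnegative combination of the two. Neither can be missing, as the two are not
    proportional.\<close>
  have key: "x \<in> sbase ?U" if xy: "x = \<rho> (inv a) \<beta> \<and> y = \<rho> (inv a) \<epsilon> \<or> x = \<rho> (inv a) \<epsilon> \<and> y = \<rho> (inv a) \<beta>" for x y
  proof -
    have xp: "x \<in> \<Phi>" and yp: "y \<in> \<Phi>" and xne: "x \<noteq> y" using xy a S(3) by auto
    have xU: "x \<in> ?U" and fx: "f (\<rho> a x) = 0" using xy a in_U VU fb by auto
    have lin: "linear (\<lambda>z. f (\<rho> a z))"
      using linear_compose[OF act_linear[OF a(1)] f(1)] by (simp add: o_def)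
    have h: "x \<in> convex_cone hull {\<delta> \<in> sbase ?U. f (\<rho> a \<delta>) = 0}"
      using cone_hull_face[OF lin pos_in_sbase_cone[OF subU' xp xU] _ fx] pos by blast
    have sub: "\<delta> = x \<or> \<delta> = y" if d: "\<delta> \<in> sbase ?U" "f (\<rho> a \<delta>) = 0" for \<delta>
    proof (rule ccontr)
      assume ne: "\<not> (\<delta> = x \<or> \<delta> = y)"
      note E = sbaseD[OF d(1)]
      have aV: "\<rho> a \<delta> \<in> V" using d f(2) E(2) act_image_iff[OF a(1)] by blast
      then obtain k l where kl: "\<rho> a \<delta> = k *\<^sub>R \<beta> + l *\<^sub>R \<epsilon>" unfolding U2 in_span_pair by blast
      have dl: "\<delta> = k *\<^sub>R \<rho> (inv a) \<beta> + l *\<^sub>R \<rho> (inv a) \<epsilon>"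
        using arg_cong[OF kl, of "\<rho> (inv a)"] a by (simp add: act_lin)
      have ar: "\<rho> a \<delta> \<in> roots" using a E by simp
      have "\<rho> a \<delta> \<in> \<Phi>"
      proof (rule ccontr)
        assume "\<rho> a \<delta> \<notin> \<Phi>"
        then have m: "- \<rho> a \<delta> \<in> \<Phi>" using neg_iff ar by blast
        have "- \<rho> a \<delta> = (- k) *\<^sub>R \<beta> + (- l) *\<^sub>R \<epsilon>" using kl by simp
        then have "- k \<ge> 0 \<and> - l \<ge> 0" using sbase_coords_pos[OF subV S m] by blast
        then have "(- k) *\<^sub>R \<rho> (inv a) \<beta> + (- l) *\<^sub>R \<rho> (inv a) \<epsilon> \<in> K" using a by (intro K_add K_scale pos_K) auto
        then show False using pos_not_neg_K[OF E(1)] dl by simp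
      qed
      then have kl0: "k \<ge> 0 \<and> l \<ge> 0" using sbase_coords_pos[OF subV S _ kl] by blast
      obtain z where z: "z \<in> carrier W" "- \<rho> z \<delta> \<in> \<Phi>" "\<And>w. w \<in> \<Phi> \<Longrightarrow> w \<in> ?U \<Longrightarrow> w \<noteq> \<delta> \<Longrightarrow> \<rho> z w \<in> \<Phi>"
        using sbase_witness d(1) by blast
      have "\<rho> z (\<rho> (inv a) \<beta>) \<in> \<Phi>" "\<rho> z (\<rho> (inv a) \<epsilon>) \<in> \<Phi>" using z(3)[OF a(2)] z(3)[OF a(3)] ne xy in_U VU by blast+
      then have "k *\<^sub>R \<rho> z (\<rho> (inv a) \<beta>) + l *\<^sub>R \<rho> z (\<rho> (inv a) \<epsilon>) \<in> K" using kl0 by (intro K_add K_scale pos_K) auto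
      moreover have "\<rho> z \<delta> = k *\<^sub>R \<rho> z (\<rho> (inv a) \<beta>) + l *\<^sub>R \<rho> z (\<rho> (inv a) \<epsilon>)" by (subst dl) (use z in \<open>simp add: act_lin\<close>)
      ultimately show False using pos_not_neg_K[OF z(2)] by (metis minus_minus)
    qed
    show ?thesis
    proof (rule ccontr)
      assume "x \<notin> sbase ?U"
      then have "{\<delta> \<in> sbase ?U. f (\<rho> a \<delta>) = 0} \<subseteq> {y}" using sub by blast
      then have "x \<in> convex_cone hull {y}" using h hull_mono by blast
      then obtain k where "x = k *\<^sub>R y" using cone_hull_singleton by blast
      then show False using unit_multiple xp yp xne by blast
    qed
  qed
  show ?thesis using a(1) key[of "\<rho> (inv a) \<beta>" "\<rho> (inv a) \<epsilon>"] key[of "\<rho> (inv a) \<epsilon>" "\<rho> (inv a) \<beta>"] by blast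
qed

text \<open>An infinite plane is settled by the form, and \<open>n = 1\<close> is the reflection of
  \<beta> in \<epsilon>. Otherwise the plane is moved to a chamber \<open>a\<close> where \<beta>
  and \<epsilon> become simple in rank three. There a dominated root \<theta> is negative, and its
  negative is a root inverted by \<open>a\<close> whose product with \<beta> is at most -1; this
  bound is transferred to \<zeta>.\<close>

lemma bipodal:
  assumes V: "V = span {\<beta>, \<epsilon>}" and S: "\<beta> \<in> sbase V" "\<epsilon> \<in> sbase V" "\<beta> \<noteq> \<epsilon>"
    and z: "\<zeta> \<in> \<Phi>" "\<zeta> \<in> V" "\<zeta> \<noteq> \<beta>" "\<zeta> \<noteq> \<epsilon>" and ns: "nonsmall \<beta>"
  shows "nonsmall \<zeta>"
proof -
  have sub: "subspace V" using V by simp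
  note D = S(1,2)[THEN sbaseD(3)] and DP = S(1,2)[THEN sbaseD(1)]
  have nrm: "B \<beta> \<beta> = 1" "B \<epsilon> \<epsilon> = 1" using D root_norm by auto
  obtain P Q where PQ: "\<zeta> = P *\<^sub>R \<beta> + Q *\<^sub>R \<epsilon>" using z V in_span_pair by blast
  have "P \<ge> 0 \<and> Q \<ge> 0" using sbase_coords_pos[OF sub S z(1) PQ] .
  moreover have "P \<noteq> 0" "Q \<noteq> 0" using PQ unit_multiple[OF z(1) DP(1), of P] unit_multiple[OF z(1) DP(2), of Q] z by auto
  ultimately have P: "P > 0" "Q > 0" by auto
  show ?thesis
  proof (cases "B \<beta> \<epsilon> \<le> -1")
    case True
    then show ?thesis using nonsmall_infinite[OF S(1,2) _ PQ z P] by blast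
  next
    case False
    obtain m :: nat where m: "m \<ge> 2" "B \<beta> \<epsilon> = - cos (pi / real m)"
      "\<And>a b. a *\<^sub>R \<beta> + b *\<^sub>R \<epsilon> \<in> roots \<Longrightarrow> a > 0 \<Longrightarrow> b > 0 \<Longrightarrow>
      \<exists>n. 1 \<le> n \<and> n + 2 \<le> m \<and> a = sin (real n * (pi / real m)) / sin (pi / real m)
        \<and> b = sin (real (n + 1) * (pi / real m)) / sin (pi / real m)"
      using sbase_dihedral[OF sub S] False by (metis not_le)
    obtain n where n: "1 \<le> n" "n + 2 \<le> m" "P = sin (real n * (pi / real m)) / sin (pi / real m)"
      "Q = sin (real (n + 1) * (pi / real m)) / sin (pi / real m)"
      using m(3) PQ P z pos_root by blast
    have m3: "m \<ge> 3" using n by simp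
    have "pi / real m \<le> pi / 3" using m3 by (intro divide_left_mono) auto
    then have pm: "0 < pi / real m" "pi / real m < pi / 2" using m3 pi_gt_zero by (auto, linarith)
    then have sp: "sin (pi / real m) > 0" by (intro sin_gt_zero) linarith+
    have bn: "B \<beta> \<epsilon> < 0" unfolding m(2) using cos_gt_zero[OF pm] by simp
    show ?thesis
    proof (cases "n = 1")
      case True
      then have "P = 1" "Q = - 2 * B \<beta> \<epsilon>" using n sp m(2) sin_double[of "pi / real m"] by (simp_all add: field_simps)
      then have "\<zeta> = \<rho> (r \<epsilon>) \<beta>" using PQ r_act D by simp
      then show ?thesis using nonsmall_reflect[OF DP ns] bn by simp
    next
      case False
      obtain \<theta> where t: "\<theta> \<in> \<Phi>" "\<theta> \<noteq> \<beta>" "dom \<theta> \<beta>" using ns nonsmall_def by blast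
      have Bt: "B \<theta> \<beta> \<ge> 1" using dom_B t DP by blast
      \<comment> \<open>The plane is positive definite, whereas
        \<open>B \<theta> \<beta> \<ge> 1\<close> makes the norm of
        \<open>\<theta> - \<beta>\<close> nonpositive.\<close>
      have tV: "\<theta> \<notin> V"
      proof
        assume "\<theta> \<in> V"
        then obtain k l where kl: "\<theta> = k *\<^sub>R \<beta> + l *\<^sub>R \<epsilon>" using V in_span_pair by blast
        define x where "x = k - 1"
        have e: "\<theta> - \<beta> = x *\<^sub>R \<beta> + l *\<^sub>R \<epsilon>" using kl by (simp add: x_def algebra_simps)
        have "B (\<theta> - \<beta>) (\<theta> - \<beta>) = 2 - 2 * B \<theta> \<beta>" using nrm root_norm[OF pos_root[OF t(1)]] B_sym[of \<beta> \<theta>] by (simp add: B_lin)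
        moreover have "B (\<theta> - \<beta>) (\<theta> - \<beta>) = (x + B \<beta> \<epsilon> * l)\<^sup>2 + (1 - B \<beta> \<epsilon> * B \<beta> \<epsilon>) * l\<^sup>2"
          unfolding e using nrm B_sym[of \<epsilon> \<beta>] by (simp add: B_lin algebra_simps power2_eq_square)
        moreover have b1: "B \<beta> \<epsilon> * B \<beta> \<epsilon> < 1" using bn \<open>\<not> B \<beta> \<epsilon> \<le> -1\<close> mult_strict_mono[of "- B \<beta> \<epsilon>" 1 "- B \<beta> \<epsilon>" 1] by simp
        then have "(1 - B \<beta> \<epsilon> * B \<beta> \<epsilon>) * l\<^sup>2 \<ge> 0" by simp
        ultimately have "(x + B \<beta> \<epsilon> * l)\<^sup>2 = 0" "(1 - B \<beta> \<epsilon> * B \<beta> \<epsilon>) * l\<^sup>2 = 0" using Bt zero_le_power2[of "x + B \<beta> \<epsilon> * l"] by linarith+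
        then have "l = 0" "x = 0" using b1 by auto
        then show False using e t by simp
      qed
      define U where "U = span {\<beta>, \<epsilon>, \<theta>}"
      obtain a where a: "a \<in> carrier W" "\<rho> (inv a) \<beta> \<in> sbase (\<rho> (inv a) ` U)" "\<rho> (inv a) \<epsilon> \<in> sbase (\<rho> (inv a) ` U)"
        using chamber_at_intersection[OF V S _ bn tV U_def] \<open>\<not> B \<beta> \<epsilon> \<le> -1\<close> by auto
      let ?U = "\<rho> (inv a) ` U" and ?b = "\<rho> (inv a) \<beta>" and ?e = "\<rho> (inv a) \<epsilon>" and ?k = "- \<rho> (inv a) \<theta>"
      have U': "?U = span {?b, ?e, \<rho> (inv a) \<theta>}"
        unfolding U_def using linear_span_image[OF act_linear[of "inv a"], of "{\<beta>, \<epsilon>, \<theta>}"] a(1) by simp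
      have subU: "subspace ?U" using U' by simp
      have tU: "\<rho> (inv a) \<theta> \<in> ?U" unfolding U' by (simp add: span_base)
      \<comment> \<open>The moved \<beta> can be inverted alone within the moved subspace, but
        dominance forces \<theta> to become negative along with it.\<close>
      have "\<rho> (inv a) \<theta> \<notin> \<Phi>"
      proof
        assume p: "\<rho> (inv a) \<theta> \<in> \<Phi>"
        obtain y where y: "y \<in> carrier W" "- \<rho> y ?b \<in> \<Phi>" "\<And>z. z \<in> \<Phi> \<Longrightarrow> z \<in> ?U \<Longrightarrow> z \<noteq> ?b \<Longrightarrow> \<rho> y z \<in> \<Phi>"
          using sbase_witness a(2) by blast
        have "\<rho> y (\<rho> (inv a) \<theta>) \<in> \<Phi>" using y(3)[OF p tU] t a by simp
        moreover have "- \<rho> y (\<rho> (inv a) \<theta>) \<in> \<Phi>" using domD[OF t(3), of "y \<otimes> inv a"] y a(1) by simp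
        ultimately show False using not_pos_neg by blast
      qed
      then have kp: "?k \<in> \<Phi>" using neg_iff[of "\<rho> (inv a) \<theta>"] a(1) t pos_root by auto
      have ki: "?k \<in> invs a" using kp t a by (simp add: invs_def act_lin)
      have kU: "?k \<in> ?U" using tU subU subspace_neg by blast
      have kB: "B ?k ?b \<le> -1" using Bt a(1) by (simp add: B_lin B_invariant)
      have ze: "\<rho> (inv a) \<zeta> = P *\<^sub>R ?b + Q *\<^sub>R ?e" using PQ a(1) by (simp add: act_lin)
      have "\<exists>k \<in> invs a \<inter> ?U. B k (P *\<^sub>R ?b + Q *\<^sub>R ?e) \<le> -1"
      proof (rule separating_root_transfer[OF U' a(2,3) _ _ _ n(2) _ n(3,4) a(1) _ _ ki kU kB])
        show "?b \<noteq> ?e" using S(3) a(1) by simp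
        show "4 \<le> m" "2 \<le> n" using False n by auto
        show "B ?b ?e = - cos (pi / real m)" using m(2) a(1) by (simp add: B_invariant)
        show "\<rho> a ?b \<in> \<Phi>" "\<rho> a ?e \<in> \<Phi>" using DP a(1) by auto
      qed
      then obtain k where k: "k \<in> invs a" "B k (\<rho> (inv a) \<zeta>) \<le> -1" using ze by auto
      have "P *\<^sub>R ?b + Q *\<^sub>R ?e \<in> K" using P a(2,3) sbaseD(1) by (intro K_add K_scale pos_K) auto
      moreover have "\<rho> (inv a) \<zeta> \<in> roots" using z(1) a(1) pos_root by simp
      ultimately have "\<rho> (inv a) \<zeta> \<in> \<Phi>" using ze posI by metis
      then show ?thesis using nonsmall_of_disjoint[OF a(1) k(1) z(1) _ k(2)] by blast
    qed
  qed
qed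

end

section \<open>Short inversions\<close>

lemma span_pair_eq:
  assumes "x \<in> span {p, q}" "y \<in> span {p, q}" "x \<noteq> 0" "y \<notin> span {x}"
  shows "span {p, q} = span {x, y}"
proof -
  have step: "span {a, b} = span {x, b}" if "x \<in> span {a, b}" "x \<notin> span {b}" for a b
  proof
    have "a \<in> span {x, b}" using in_span_insert[of x a "{b}"] that by simp
    then show "span {a, b} \<subseteq> span {x, b}" by (intro span_minimal) (auto intro: span_base)
    show "span {x, b} \<subseteq> span {a, b}" using that(1) by (intro span_minimal) (auto intro: span_base)
  qed
  obtain b where b: "span {p, q} = span {x, b}"
  proof (cases "x \<in> span {q}")
    case False
    then show ?thesis using step[OF assms(1)] that by blast
  next
    case True
    have "x \<notin> span {p} \<or> span {p, q} = span {x, q}"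
    proof (rule disjCI)
      assume "\<not> span {p, q} = span {x, q}"
      show "x \<notin> span {p}"
      proof
        assume "x \<in> span {p}"
        then obtain k where k: "x = k *\<^sub>R p" by (auto simp: span_singleton)
        then have "p = (1 / k) *\<^sub>R x" using assms(3) by auto
        then have "p \<in> span {x, q}" by (auto intro: span_scale span_base)
        then have "span {p, q} \<subseteq> span {x, q}" by (intro span_minimal) (auto intro: span_base)
        moreover have "span {x, q} \<subseteq> span {p, q}" using assms(1) by (intro span_minimal) (auto intro: span_base)
        ultimately show False using \<open>\<not> span {p, q} = span {x, q}\<close> by blast
      qed
    qed
    moreover have "span {p, q} = span {q, p}" by (simp add: insert_commute)
    ultimately show ?thesis using step[of q p] assms(1) that by metis
  qed
  have "b \<in> span {y, x}"
  proof -
    have "y \<in> span (insert b {x})" using assms(2) b by (simp add: insert_commute)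
    then show ?thesis using in_span_insert[of y b "{x}"] assms(4) by simp
  qed
  then have "span {x, b} \<subseteq> span {x, y}" by (intro span_minimal) (auto intro: span_base simp: insert_commute)
  moreover have "span {x, y} \<subseteq> span {x, b}" using assms(2) b by (intro span_minimal) (auto intro: span_base)
  ultimately show ?thesis using b by blast
qed

context geometric_representation
begin

text \<open>If \<beta> were the only simple root, \<zeta> would be a multiple of it. So there is a
  second one, and the two span \<open>V\<close>.\<close>

lemma bipodal_plane:
  assumes V: "V = span {p, q}" and S: "\<beta> \<in> sbase V"
    and z: "\<zeta> \<in> \<Phi>" "\<zeta> \<in> V" "\<zeta> \<notin> sbase V" and ns: "nonsmall \<beta>"
  shows "nonsmall \<zeta>"
proof -
  have sub: "subspace V" using V by simp
  have zb: "\<zeta> \<noteq> \<beta>" using S z by blast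
  have "\<exists>e \<in> sbase V. e \<noteq> \<beta>"
  proof (rule ccontr)
    assume "\<not> (\<exists>e \<in> sbase V. e \<noteq> \<beta>)"
    then have "sbase V = {\<beta>}" using S by blast
    then obtain k where "\<zeta> = k *\<^sub>R \<beta>" using pos_in_sbase_cone[OF sub z(1,2)] cone_hull_singleton by metis
    then show False using unit_multiple z(1) sbaseD(1)[OF S] zb by blast
  qed
  then obtain e where e: "e \<in> sbase V" "e \<noteq> \<beta>" by blast
  have "e \<notin> span {\<beta>}"
  proof
    assume "e \<in> span {\<beta>}"
    then obtain k where "e = k *\<^sub>R \<beta>" by (auto simp: span_singleton)
    then show False using unit_multiple sbaseD(1)[OF e(1)] sbaseD(1)[OF S] e(2) by blast
  qed
  then have "V = span {\<beta>, e}" using span_pair_eq[of \<beta> p q e] V sbaseD(2)[OF S] sbaseD(2)[OF e(1)] root_nz[OF sbaseD(3)[OF S]] by blast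
  moreover have "\<zeta> \<noteq> e" using e z by blast
  ultimately show ?thesis using bipodal[of V \<beta> e \<zeta>] S e z zb ns by metis
qed

text \<open>An element inverting only \<zeta> within \<open>V\<close> would keep the right-hand side
  in \<open>K\<close>.\<close>

lemma not_sbase_comb:
  assumes "\<beta> \<in> \<Phi>" "\<beta> \<in> V" "\<beta> \<noteq> \<zeta>" "\<epsilon> \<in> \<Phi>" "\<epsilon> \<in> V" "\<epsilon> \<noteq> \<zeta>" "p > 0" "a \<ge> 0" "b \<ge> 0"
    and e: "p *\<^sub>R \<zeta> = a *\<^sub>R \<beta> + b *\<^sub>R \<epsilon>"
  shows "\<zeta> \<notin> sbase V"
proof
  assume "\<zeta> \<in> sbase V"
  then obtain y where y: "y \<in> carrier W" "- \<rho> y \<zeta> \<in> \<Phi>" "\<And>z. z \<in> \<Phi> \<Longrightarrow> z \<in> V \<Longrightarrow> z \<noteq> \<zeta> \<Longrightarrow> \<rho> y z \<in> \<Phi>"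
    using sbase_witness by blast
  have "p *\<^sub>R \<rho> y \<zeta> = a *\<^sub>R \<rho> y \<beta> + b *\<^sub>R \<rho> y \<epsilon>" using arg_cong[OF e, of "\<rho> y"] y(1) by (simp add: act_lin)
  moreover have "a *\<^sub>R \<rho> y \<beta> + b *\<^sub>R \<rho> y \<epsilon> \<in> K" using y(3) assms by (intro K_add K_scale pos_K) auto
  ultimately have "p *\<^sub>R \<rho> y \<zeta> \<in> K" by metis
  then have "(1 / p) *\<^sub>R (p *\<^sub>R \<rho> y \<zeta>) \<in> K" by (rule K_scale) (use assms(7) in simp)
  then show False using pos_not_neg_K[OF y(2)] assms(7) by simp
qed

text \<open>The witness is \<open>r \<beta>\<close> with \<beta> the negative of
  \<open>\<rho> v \<gamma>\<close>: it inverts no other root of \<open>V\<close>. Any other such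
  root and its partner would both be inverted by \<open>inv v\<close>; pulled back, they would be
  partners for \<gamma> both inverted by \<open>v\<close>, against
  \<open>short_pair\<close>.\<close>

lemma short_sbase:
  assumes v: "v \<in> carrier W" and g: "\<gamma> \<in> invs v" and l: "len (v \<otimes> r \<gamma>) + 1 = len v"
    and a: "\<sigma> \<in> invs (r \<gamma>)" "\<sigma> \<in> invs v" "\<sigma> \<noteq> \<gamma>" and V: "V = span {\<rho> v \<gamma>, \<rho> v \<sigma>}"
  shows "- \<rho> v \<gamma> \<in> sbase V"
proof -
  have gp: "\<gamma> \<in> \<Phi>" "- \<rho> v \<gamma> \<in> \<Phi>" and rg: "\<gamma> \<in> roots" using g pos_root by (auto simp: invs_def)
  have sp: "\<sigma> \<in> \<Phi>" "- \<rho> v \<sigma> \<in> \<Phi>" using a by (auto simp: invs_def)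
  define \<beta> where "\<beta> = - \<rho> v \<gamma>"
  define \<zeta> where "\<zeta> = - \<rho> v \<sigma>"
  define c where "c = 2 * B \<sigma> \<gamma>"
  have c0: "c > 0" using invs_r_pair(1)[OF gp(1) a(1)] c_def by simp
  define \<sigma>' where "\<sigma>' = c *\<^sub>R \<gamma> - \<sigma>"
  have s': "- \<rho> (r \<gamma>) \<sigma> = \<sigma>'" using invs_r_pair(3)[OF gp(1) a(1)] by (simp add: \<sigma>'_def c_def)
  have s'p: "\<sigma>' \<in> \<Phi>" using invs_r_pair(2)[OF gp(1) a(1)] s' by (simp add: invs_def)
  define \<epsilon> where "\<epsilon> = \<rho> v \<sigma>'"
  have ep: "\<epsilon> \<in> \<Phi>" using short_pair[OF v g l a] s' by (simp add: \<epsilon>_def)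
  have ze: "\<zeta> = c *\<^sub>R \<beta> + \<epsilon>" unfolding \<zeta>_def \<beta>_def \<epsilon>_def \<sigma>'_def using v by (simp add: act_lin)
  have bp: "\<beta> \<in> \<Phi>" "\<beta> \<in> roots" using gp(2) pos_root[OF gp(2)] by (simp_all only: \<beta>_def)
  have zp: "\<zeta> \<in> \<Phi>" using sp by (simp add: \<zeta>_def)
  have rb: "r \<beta> = v \<otimes> r \<gamma> \<otimes> inv v" using r_neg[of "\<rho> v \<gamma>"] r_conj[OF v rg] v rg by (simp add: \<beta>_def)
  have bV: "\<beta> \<in> V" unfolding V \<beta>_def by (intro span_neg span_base) auto
  have Bzb: "B \<zeta> \<beta> = c / 2" using v by (simp add: \<zeta>_def \<beta>_def B_lin B_invariant c_def)
  have Vin: "\<exists>x y. p = x *\<^sub>R \<beta> + y *\<^sub>R \<zeta>" if pV: "p \<in> V" for p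
  proof -
    obtain x y where "p = x *\<^sub>R \<rho> v \<gamma> + y *\<^sub>R \<rho> v \<sigma>" using pV unfolding V in_span_pair by blast
    then have "p = (- x) *\<^sub>R \<beta> + (- y) *\<^sub>R \<zeta>" by (simp add: \<beta>_def \<zeta>_def)
    then show ?thesis by blast
  qed
  \<comment> \<open>Let \<open>p\<close> have coordinates \<open>x\<close>, \<open>y\<close> in
    \<beta>, \<zeta>. If \<open>inv v\<close> kept \<open>p\<close> positive, then
    \<open>y > 0\<close> would contradict positivity of the partner of \<open>p\<close>, and
    \<open>y < 0\<close> positivity of its image; \<zeta> is \<epsilon> plus a positive multiple of
    \<beta>.\<close>
  have claim: "- \<rho> (inv v) p \<in> \<Phi>" if p: "p \<in> invs (r \<beta>)" "p \<in> V" "p \<noteq> \<beta>" for p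
  proof (rule ccontr)
    assume n: "- \<rho> (inv v) p \<notin> \<Phi>"
    have pp: "p \<in> \<Phi>" using p by (simp add: invs_def)
    then have t: "\<rho> (inv v) p \<in> \<Phi>" using n neg_iff[of "\<rho> (inv v) p"] v pos_root by auto
    obtain x y where xy: "p = x *\<^sub>R \<beta> + y *\<^sub>R \<zeta>" using Vin p by blast
    have te: "\<rho> (inv v) p = (- x) *\<^sub>R \<gamma> + (- y) *\<^sub>R \<sigma>" unfolding xy \<beta>_def \<zeta>_def using v by (simp add: act_lin)
    consider "y = 0" | "y > 0" | "y < 0" by linarith
    then show False
    proof cases
      case 1
      then show False using unit_multiple[OF pp bp(1), of x] xy p by simp
    next
      case 2
      have x: "x < 0"
      proof (rule ccontr)
        assume "\<not> x < 0"
        then have "x *\<^sub>R \<gamma> + y *\<^sub>R \<sigma> \<in> K" using 2 gp sp by (intro K_add K_scale pos_K) auto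
        then show False using pos_not_neg_K[OF t] te by (simp add: add.commute)
      qed
      have pb: "B p \<beta> = x + y * (c / 2)" unfolding xy using Bzb root_norm bp by (simp add: B_lin)
      have "- \<rho> (r \<beta>) p = (2 * B p \<beta>) *\<^sub>R \<beta> - p" using invs_r_pair(3)[OF bp(1) p(1)] .
      also have "\<dots> = x *\<^sub>R \<beta> - y *\<^sub>R \<epsilon>" unfolding pb by (simp add: xy ze algebra_simps flip: scaleR_2)
      finally have "- (- \<rho> (r \<beta>) p) = (- x) *\<^sub>R \<beta> + y *\<^sub>R \<epsilon>" by simp
      moreover have "(- x) *\<^sub>R \<beta> + y *\<^sub>R \<epsilon> \<in> K" using x 2 bp ep by (intro K_add K_scale pos_K) auto
      moreover have "- \<rho> (r \<beta>) p \<in> \<Phi>" using p by (simp add: invs_def)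
      ultimately show False using pos_not_neg_K by metis
    next
      case 3
      have pe: "p = (x + c * y) *\<^sub>R \<beta> + y *\<^sub>R \<epsilon>" unfolding xy ze by (simp add: algebra_simps)
      have x: "x + c * y > 0"
      proof (rule ccontr)
        assume "\<not> x + c * y > 0"
        then have "(- (x + c * y)) *\<^sub>R \<beta> + (- y) *\<^sub>R \<epsilon> \<in> K" using 3 bp ep by (intro K_add K_scale pos_K) auto
        moreover have "- p = (- (x + c * y)) *\<^sub>R \<beta> + (- y) *\<^sub>R \<epsilon>" by (subst pe) (simp add: algebra_simps)
        ultimately show False using pos_not_neg_K[OF pp] by simp
      qed
      have "- \<rho> (inv v) p = (x + c * y) *\<^sub>R \<gamma> + (- y) *\<^sub>R \<sigma>'" unfolding te \<sigma>'_def by (simp add: algebra_simps)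
      moreover have "(x + c * y) *\<^sub>R \<gamma> + (- y) *\<^sub>R \<sigma>' \<in> K" using x 3 gp s'p by (intro K_add K_scale pos_K) auto
      ultimately show False using pos_not_neg_K[OF t] by simp
    qed
  qed
  have "invs (r \<beta>) \<inter> V = {\<beta>}"
  proof (rule ccontr)
    assume "invs (r \<beta>) \<inter> V \<noteq> {\<beta>}"
    then obtain p where p: "p \<in> invs (r \<beta>)" "p \<in> V" "p \<noteq> \<beta>" using self_inv[OF bp(1)] bV by blast
    let ?q = "- \<rho> (r \<beta>) p"
    have q: "?q \<in> invs (r \<beta>)" using invs_r_pair(2)[OF bp(1) p(1)] .
    have qV: "?q \<in> V" using invs_r_pair(3)[OF bp(1) p(1)] p(2) bV V by (simp add: span_diff span_scale)
    have qne: "?q \<noteq> \<beta>"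
    proof
      assume "?q = \<beta>"
      then have "\<rho> (r \<beta>) p = \<rho> (r \<beta>) \<beta>" using r_act_self[OF bp(2)] by (metis minus_minus)
      then show False using p bp by simp
    qed
    have c1: "- \<rho> (inv v) p \<in> \<Phi>" using claim p by blast
    have c2: "- \<rho> (inv v) ?q \<in> \<Phi>" using claim q qV qne by blast
    let ?s = "- \<rho> (inv v) p"
    have qe: "- \<rho> (inv v) ?q = - \<rho> (r \<gamma>) ?s" unfolding rb using v rg by (simp add: act_lin)
    have "?s \<in> invs (r \<gamma>)" using c1 c2 qe by (simp add: invs_def)
    moreover have "?s \<in> invs v" using c1 p v by (simp add: invs_def act_lin)
    moreover have "?s \<noteq> \<gamma>" using p v by (auto simp: \<beta>_def act_lin)
    ultimately have "\<rho> v (- \<rho> (r \<gamma>) ?s) \<in> \<Phi>" using short_pair[OF v g l] by blast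
    then have "- ?q \<in> \<Phi>" using qe v by (metis act_inv(2) act_lin(3) inv_closed)
    then show False using q not_pos_neg by (auto simp: invs_def)
  qed
  then have "\<beta> \<in> sbase V" using bp bV unfolding sbase_def by auto
  then show ?thesis by (simp add: \<beta>_def)
qed

text \<open>This is the shortest element of the coset of \<open>w\<close> under the subgroup
  generated by \<open>s\<close> and \<open>t\<close>, reached by removing these letters on the left.
  The last clause keeps what is needed of the difference: it preserves the plane of the two
  roots.\<close>

lemma coset_representative:
  assumes "w \<in> carrier W" "s \<in> S" "t \<in> S"
  shows "\<exists>g \<in> carrier W. \<rho> (inv g) (\<alpha> s) \<in> \<Phi> \<and> \<rho> (inv g) (\<alpha> t) \<in> \<Phi> \<and> invs g \<subseteq> invs w \<and>
    (g = w \<or> len g < len w) \<and> (\<forall>u \<in> span {\<alpha> s, \<alpha> t}. \<rho> g (\<rho> (inv w) u) \<in> span {\<alpha> s, \<alpha> t})"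
  using assms(1)
proof (induction "len w" arbitrary: w rule: less_induct)
  case less
  let ?A = "span {\<alpha> s, \<alpha> t}"
  show ?case
  proof (cases "\<rho> (inv w) (\<alpha> s) \<in> \<Phi> \<and> \<rho> (inv w) (\<alpha> t) \<in> \<Phi>")
    case True
    then show ?thesis using less.prems by (intro bexI[of _ w]) auto
  next
    case False
    then obtain x where x: "x \<in> {s, t}" "\<rho> (inv w) (\<alpha> x) \<notin> \<Phi>" by blast
    have xS: "x \<in> S" using x assms by auto
    have xn: "- \<rho> (inv w) (\<alpha> x) \<in> \<Phi>" using x neg_iff[of "\<rho> (inv w) (\<alpha> x)"] less.prems xS simple_root by simp
    let ?w = "x \<otimes> w"
    have wc: "?w \<in> carrier W" using less.prems xS by simp
    have l: "len ?w < len w" using left_len(2)[OF less.prems xS xn] by simp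
    have iw: "inv ?w = inv w \<otimes> x" using less.prems xS by (simp add: inv_mult_group simple_inv)
    have "\<rho> (inv ?w) (\<alpha> x) \<in> \<Phi>" using xn iw less.prems xS by (simp add: simple_act_self act_lin)
    then have "invs ?w \<subseteq> invs (x \<otimes> ?w)" using invs_left(1)[OF wc xS] by blast
    moreover have "x \<otimes> ?w = w" using less.prems xS by (simp add: simple_sq flip: m_assoc)
    ultimately have sub: "invs ?w \<subseteq> invs w" by simp
    obtain g where g: "g \<in> carrier W" "\<rho> (inv g) (\<alpha> s) \<in> \<Phi>" "\<rho> (inv g) (\<alpha> t) \<in> \<Phi>" "invs g \<subseteq> invs ?w"
      "g = ?w \<or> len g < len ?w" "\<And>u. u \<in> ?A \<Longrightarrow> \<rho> g (\<rho> (inv ?w) u) \<in> ?A"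
      using less.hyps[OF l wc] by blast
    have "\<rho> g (\<rho> (inv w) u) \<in> ?A" if u: "u \<in> ?A" for u
    proof -
      have "\<rho> x u \<in> ?A" unfolding simple_act[OF xS] using u x(1) by (intro span_diff span_scale) (auto intro: span_base)
      then have "\<rho> g (\<rho> (inv ?w) (\<rho> x u)) \<in> ?A" using g(6) by blast
      then show ?thesis using iw less.prems xS by simp
    qed
    then show ?thesis using g l sub by (intro bexI[of _ g]) auto
  qed
qed

text \<open>The induction runs over the depth of the inverted root; a short inversion that is not a descent is
  an end of the inverted segment in a rank two subsystem whose other end is an inverted root of smaller
  depth, and bipodality transfers the failure of smallness to it.\<close>

lemma short_nonsmall_descent:
  assumes v: "v \<in> carrier W" and "\<gamma> \<in> invs v" "len (v \<otimes> r \<gamma>) + 1 = len v" "nonsmall (- \<rho> v \<gamma>)"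
  shows "\<exists>s \<in> S. - \<rho> v (\<alpha> s) \<in> \<Phi> \<and> nonsmall (- \<rho> v (\<alpha> s))"
  using assms(2-4)
proof (induction "depth \<gamma>" arbitrary: \<gamma> rule: less_induct)
  case less
  note g = less.prems(1) and l = less.prems(2) and ns = less.prems(3)
  have gp: "\<gamma> \<in> \<Phi>" "- \<rho> v \<gamma> \<in> \<Phi>" and rg: "\<gamma> \<in> roots" using g pos_root by (auto simp: invs_def)
  obtain y where y: "y \<in> carrier W" "- \<rho> y \<gamma> \<in> \<Phi>" "len y = depth \<gamma>" using depth_attained gp by blast
  then have "y \<noteq> \<one>" using not_pos_neg gp by auto
  then obtain s z where sz: "s \<in> S" "z \<in> carrier W" "y = s \<otimes> z" "len y = len z + 1"
    "\<rho> (inv z) (\<alpha> s) \<in> \<Phi>" "invs y = insert (\<rho> (inv z) (\<alpha> s)) (invs z)" "\<rho> (inv z) (\<alpha> s) \<notin> invs z"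
    using peel[OF y(1)] by blast
  \<comment> \<open>\<open>z\<close> is shorter than the depth of \<gamma>, so \<gamma> is the last
    root that \<open>y\<close> inverts.\<close>
  have gz: "\<gamma> \<notin> invs z" using depth_le[OF sz(2), of \<gamma>] y(3) sz(4) by (auto simp: invs_def)
  moreover have "\<gamma> \<in> invs y" using y gp by (simp add: invs_def)
  ultimately have ge: "\<gamma> = \<rho> (inv z) (\<alpha> s)" using sz by blast
  have zg: "\<rho> z \<gamma> = \<alpha> s" using ge sz by simp
  \<comment> \<open>Otherwise \<open>y \<otimes> r \<sigma>\<close>, which is shorter than
    \<open>y\<close>, would make \<gamma> negative too.\<close>
  have Bpos: "B \<sigma> \<gamma> > 0" if "\<sigma> \<in> invs z" for \<sigma>
  proof (rule ccontr)
    assume b: "\<not> B \<sigma> \<gamma> > 0"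
    have si: "\<sigma> \<in> invs y" using that sz by blast
    have sr: "\<sigma> \<in> roots" "- \<rho> y \<sigma> \<in> \<Phi>" using si pos_root by (auto simp: invs_def)
    have e: "- \<rho> (y \<otimes> r \<sigma>) \<gamma> = 1 *\<^sub>R (- \<rho> y \<gamma>) + (- 2 * B \<sigma> \<gamma>) *\<^sub>R (- \<rho> y \<sigma>)"
      using y(1) sr B_sym[of \<gamma> \<sigma>] by (simp add: r_act act_lin)
    have "- \<rho> (y \<otimes> r \<sigma>) \<gamma> \<in> \<Phi>" using y sr b rg by (intro K_comb_pos[OF _ e] pos_K) auto
    then show False using depth_le[of "y \<otimes> r \<sigma>" \<gamma>] refl_shortens[OF y(1) si] y sr by simp
  qed
  have zr: "\<sigma> \<in> invs (r \<gamma>)" if s: "\<sigma> \<in> invs z" for \<sigma>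
  proof (rule ccontr)
    assume n: "\<sigma> \<notin> invs (r \<gamma>)"
    have sp: "\<sigma> \<in> \<Phi>" "- \<rho> z \<sigma> \<in> \<Phi>" using s by (auto simp: invs_def)
    let ?t = "\<rho> (r \<gamma>) \<sigma>"
    have t: "?t \<in> \<Phi>" using n not_invs[of "r \<gamma>" \<sigma>] sp rg by simp
    have te: "?t = \<sigma> - (2 * B \<sigma> \<gamma>) *\<^sub>R \<gamma>" using r_act rg by simp
    \<comment> \<open>The reflected root would be inverted by \<open>z\<close> as well, but its
      product with \<gamma> is the negative of that of \<sigma>, against
      \<open>Bpos\<close>.\<close>
    have "?t \<in> invs z"
    proof (rule ccontr)
      assume "?t \<notin> invs z"
      then have zt: "\<rho> z ?t \<in> \<Phi>" using not_invs[OF sz(2) t] by simp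
      have "\<rho> z \<sigma> = \<rho> z ?t + (2 * B \<sigma> \<gamma>) *\<^sub>R \<alpha> s" unfolding te using sz zg by (simp add: act_lin)
      moreover have "\<rho> z ?t + (2 * B \<sigma> \<gamma>) *\<^sub>R \<alpha> s \<in> K" using zt Bpos[OF s] simple_pos[OF sz(1)]
        by (intro K_add K_scale pos_K) auto
      ultimately show False using pos_not_neg_K[OF sp(2)] by (metis minus_minus)
    qed
    then have "B ?t \<gamma> > 0" by (rule Bpos)
    then show False unfolding te using Bpos[OF s] root_norm[OF rg] by (simp add: B_lin)
  qed
  show ?case
  proof (cases "z = \<one>")
    case True
    then have "\<gamma> = \<alpha> s" using ge by simp
    then show ?thesis using sz gp ns by blast
  next
    case zne: False
    show ?thesis
    proof (cases "invs z \<inter> invs v = {}")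
      case False
      \<comment> \<open>The common inversion can be chosen short for \<open>v\<close>; since
        \<open>z\<close> makes it negative, its depth is below that of \<gamma>.\<close>
      then obtain a where a: "a \<in> invs z" "a \<in> invs v" "len (v \<otimes> r a) + 1 = len v"
        using common_short_inversion[OF sz(2) v] by blast
      have dpa: "depth a < depth \<gamma>" using depth_le[OF sz(2), of a] a y sz by (simp add: invs_def)
      have ag: "a \<noteq> \<gamma>" using gz a by blast
      have ap: "a \<in> \<Phi>" "- \<rho> v a \<in> \<Phi>" using a by (auto simp: invs_def)
      note ar = zr[OF a(1)]
      define V where "V = span {\<rho> v \<gamma>, \<rho> v a}"
      have bS: "- \<rho> v \<gamma> \<in> sbase V" using short_sbase[OF v g l ar a(2) ag V_def] .
      have inV: "\<rho> v \<gamma> \<in> V" "\<rho> v a \<in> V" unfolding V_def by (auto intro: span_base)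
      have sV: "subspace V" unfolding V_def by simp
      let ?e = "\<rho> v (- \<rho> (r \<gamma>) a)"
      have ep: "?e \<in> \<Phi>" using short_pair[OF v g l ar a(2) ag] .
      have ee: "?e = (2 * B a \<gamma>) *\<^sub>R \<rho> v \<gamma> - \<rho> v a" unfolding invs_r_pair(3)[OF gp(1) ar] using v by (simp add: act_lin)
      \<comment> \<open>The partner of \<open>a\<close> stays positive under \<open>v\<close>, which
        writes \<open>- \<rho> v a\<close> as a nonnegative combination of
        \<open>- \<rho> v \<gamma>\<close> and \<open>?e\<close>.\<close>
      have "- \<rho> v a \<notin> sbase V"
      proof (rule not_sbase_comb)
        show "- \<rho> v \<gamma> \<in> \<Phi>" "?e \<in> \<Phi>" using gp ep by auto
        show "- \<rho> v \<gamma> \<in> V" "?e \<in> V" unfolding ee using inV sV by (auto intro: subspace_neg subspace_diff subspace_scale)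
        show "- \<rho> v \<gamma> \<noteq> - \<rho> v a" using ag v by simp
        have "(2 * B a \<gamma>) *\<^sub>R \<rho> v \<gamma> \<noteq> 0" using Bpos[OF a(1)] gp root_nz v rg by simp
        then show "?e \<noteq> - \<rho> v a" unfolding ee by simp
        show "1 *\<^sub>R (- \<rho> v a) = (2 * B a \<gamma>) *\<^sub>R (- \<rho> v \<gamma>) + 1 *\<^sub>R ?e" unfolding ee by simp
        show "2 * B a \<gamma> \<ge> 0" using Bpos[OF a(1)] by simp
      qed simp_all
      then have "nonsmall (- \<rho> v a)" using bipodal_plane[OF V_def bS ap(2) _ _ ns] inV sV subspace_neg by blast
      then show ?thesis using less.hyps[OF dpa a(2,3)] by blast
    next
      case dis: True
      \<comment> \<open>The first two letters \<open>s\<close> and \<open>t\<close> of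
        \<open>y\<close> determine a plane containing \<gamma> and the last root \<sigma> inverted
        by \<open>z\<close>. Now \<open>v\<close> makes \<gamma> negative but keeps \<sigma>
        positive.\<close>
      obtain t z1 where t: "t \<in> S" "z1 \<in> carrier W" "z = t \<otimes> z1" "\<rho> (inv z1) (\<alpha> t) \<in> \<Phi>"
        "invs z = insert (\<rho> (inv z1) (\<alpha> t)) (invs z1)"
        using peel[OF sz(2) zne] by metis
      define \<sigma> where "\<sigma> = \<rho> (inv z1) (\<alpha> t)"
      have sz': "\<sigma> \<in> invs z" using t by (simp add: \<sigma>_def)
      have se: "\<rho> (inv z) (\<alpha> t) = - \<sigma>" unfolding \<sigma>_def using t by (simp add: inv_mult_group simple_inv simple_act_self act_lin)
      have sp: "\<sigma> \<in> \<Phi>" using sz' by (simp add: invs_def)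
      have vs: "\<rho> v \<sigma> \<in> \<Phi>" using dis sz' not_invs[OF v sp] by blast
      define A where "A = span {\<alpha> s, \<alpha> t}"
      have inA: "\<alpha> s \<in> A" "\<alpha> t \<in> A" unfolding A_def by (auto intro: span_base)
      have subA: "subspace A" unfolding A_def by simp
      have SA: "\<alpha> s \<in> sbase A" "\<alpha> t \<in> sbase A" using simple_sbase inA sz t by auto
      have ne: "\<alpha> s \<noteq> \<alpha> t" using ge se gp sp not_pos_neg by metis
      obtain h where h: "h \<in> carrier W" "\<rho> (inv h) (\<alpha> s) \<in> \<Phi>" "\<rho> (inv h) (\<alpha> t) \<in> \<Phi>" "invs h \<subseteq> invs z"
        "h = z \<or> len h < len z" "\<And>u. u \<in> A \<Longrightarrow> \<rho> h (\<rho> (inv z) u) \<in> A"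
        using coset_representative[OF sz(2,1) t(1)] unfolding A_def by blast
      \<comment> \<open>\<open>h = z\<close> is impossible because \<open>inv z\<close> makes
        \<open>\<alpha> t\<close> negative.\<close>
      have hl: "len h < len z" using h(3,5) se sp not_pos_neg by metis
      let ?d1 = "\<rho> (inv h) (\<alpha> s)" and ?d2 = "\<rho> (inv h) (\<alpha> t)"
      have comb: "\<exists>P Q. P \<ge> 0 \<and> Q \<ge> 0 \<and> x = P *\<^sub>R ?d1 + Q *\<^sub>R ?d2" if x: "x \<in> \<Phi>" "\<rho> h x \<in> A" for x
      proof -
        obtain P Q where PQ: "\<rho> h x = P *\<^sub>R \<alpha> s + Q *\<^sub>R \<alpha> t" using x(2) A_def in_span_pair by blast
        have xe: "x = P *\<^sub>R ?d1 + Q *\<^sub>R ?d2" using arg_cong[OF PQ, of "\<rho> (inv h)"] h(1) by (simp add: act_lin)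
        have "\<rho> h x \<in> \<Phi>"
        proof (rule ccontr)
          assume "\<rho> h x \<notin> \<Phi>"
          then have m: "- \<rho> h x \<in> \<Phi>" using neg_iff[of "\<rho> h x"] h(1) x pos_root by auto
          have "- \<rho> h x = (- P) *\<^sub>R \<alpha> s + (- Q) *\<^sub>R \<alpha> t" using PQ by simp
          then have "- P \<ge> 0 \<and> - Q \<ge> 0" using sbase_coords_pos[OF subA SA ne m] by blast
          then have "(- P) *\<^sub>R ?d1 + (- Q) *\<^sub>R ?d2 \<in> K" using h by (intro K_add K_scale pos_K) auto
          then show False using pos_not_neg_K[OF x(1)] xe by simp
        qed
        then show ?thesis using sbase_coords_pos[OF subA SA ne _ PQ] xe by blast
      qed
      have gA: "\<rho> h \<gamma> \<in> A" using h(6)[OF inA(1)] ge by simp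
      have "\<rho> h (- \<sigma>) \<in> A" using h(6)[OF inA(2)] se by simp
      then have sA: "\<rho> h \<sigma> \<in> A" using h(1) subA subspace_neg by (metis act_lin(3) minus_minus)
      obtain P Q where PQ: "P \<ge> 0" "Q \<ge> 0" "\<gamma> = P *\<^sub>R ?d1 + Q *\<^sub>R ?d2" using comb[OF gp(1) gA] by blast
      obtain P' Q' where PQ': "P' \<ge> 0" "Q' \<ge> 0" "\<sigma> = P' *\<^sub>R ?d1 + Q' *\<^sub>R ?d2" using comb[OF sp sA] by blast
      have vg: "\<rho> v \<gamma> = P *\<^sub>R \<rho> v ?d1 + Q *\<^sub>R \<rho> v ?d2" using arg_cong[OF PQ(3), of "\<rho> v"] v by (simp add: act_lin)
      have vs': "\<rho> v \<sigma> = P' *\<^sub>R \<rho> v ?d1 + Q' *\<^sub>R \<rho> v ?d2" using arg_cong[OF PQ'(3), of "\<rho> v"] v by (simp add: act_lin)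
      have dr: "\<rho> v ?d1 \<in> roots" "\<rho> v ?d2 \<in> roots" using v h sz t simple_root by auto
      have not_both_pos: "\<not> (\<rho> v ?d1 \<in> \<Phi> \<and> \<rho> v ?d2 \<in> \<Phi>)"
      proof
        assume "\<rho> v ?d1 \<in> \<Phi> \<and> \<rho> v ?d2 \<in> \<Phi>"
        then have "\<rho> v \<gamma> \<in> K" unfolding vg using PQ by (intro K_add K_scale pos_K) auto
        then show False using pos_not_neg_K[OF gp(2)] by simp
      qed
      have not_both_neg: "\<not> (- \<rho> v ?d1 \<in> \<Phi> \<and> - \<rho> v ?d2 \<in> \<Phi>)"
      proof
        assume "- \<rho> v ?d1 \<in> \<Phi> \<and> - \<rho> v ?d2 \<in> \<Phi>"
        then have "P' *\<^sub>R (- \<rho> v ?d1) + Q' *\<^sub>R (- \<rho> v ?d2) \<in> K" using PQ' by (intro K_add K_scale pos_K) auto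
        moreover have "- \<rho> v \<sigma> = P' *\<^sub>R (- \<rho> v ?d1) + Q' *\<^sub>R (- \<rho> v ?d2)" unfolding vs' by simp
        ultimately show False using pos_not_neg_K[OF vs] by simp
      qed
      \<comment> \<open>The signs of \<gamma> and \<sigma> under \<open>v\<close> leave exactly one
        of \<open>?d1\<close> and \<open>?d2\<close> negative; \<open>q\<close> names the letter of
        the negative one, \<open>q'\<close> the other.\<close>
      have "\<exists>q q' P1 Q1. q \<in> S \<and> \<rho> (inv h) (\<alpha> q) \<in> \<Phi> \<and> \<rho> (inv h) (\<alpha> q') \<in> \<Phi> \<and> - \<rho> v (\<rho> (inv h) (\<alpha> q)) \<in> \<Phi> \<and>
        \<rho> v (\<rho> (inv h) (\<alpha> q')) \<in> \<Phi> \<and> P1 \<ge> 0 \<and> Q1 \<ge> 0 \<and> \<gamma> = P1 *\<^sub>R \<rho> (inv h) (\<alpha> q) + Q1 *\<^sub>R \<rho> (inv h) (\<alpha> q') \<and>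
        span {\<rho> v ?d1, \<rho> v ?d2} = span {\<rho> v (\<rho> (inv h) (\<alpha> q)), \<rho> v (\<rho> (inv h) (\<alpha> q'))}"
      proof (cases "\<rho> v ?d1 \<in> \<Phi>")
        case True
        then have "- \<rho> v ?d2 \<in> \<Phi>" using not_both_pos neg_iff dr by blast
        then show ?thesis using True t h PQ by (intro exI[of _ t] exI[of _ s] exI[of _ Q] exI[of _ P]) (auto simp: insert_commute add.commute)
      next
        case False
        then have "- \<rho> v ?d1 \<in> \<Phi>" using neg_iff dr by blast
        moreover then have "\<rho> v ?d2 \<in> \<Phi>" using not_both_neg neg_iff dr by blast
        ultimately show ?thesis using sz h PQ by blast
      qed
      then obtain q q' P1 Q1 where q: "q \<in> S" "\<rho> (inv h) (\<alpha> q) \<in> \<Phi>" "\<rho> (inv h) (\<alpha> q') \<in> \<Phi>"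
        "- \<rho> v (\<rho> (inv h) (\<alpha> q)) \<in> \<Phi>" "\<rho> v (\<rho> (inv h) (\<alpha> q')) \<in> \<Phi>" "P1 \<ge> 0" "Q1 \<ge> 0"
        "\<gamma> = P1 *\<^sub>R \<rho> (inv h) (\<alpha> q) + Q1 *\<^sub>R \<rho> (inv h) (\<alpha> q')"
        "span {\<rho> v ?d1, \<rho> v ?d2} = span {\<rho> v (\<rho> (inv h) (\<alpha> q)), \<rho> v (\<rho> (inv h) (\<alpha> q'))}" by blast
      let ?d = "\<rho> (inv h) (\<alpha> q)" and ?d' = "\<rho> (inv h) (\<alpha> q')"
      have di: "?d \<in> invs v" using q by (simp add: invs_def)
      have "invs v \<inter> invs h = {}" using dis h(4) by blast
      then have dl: "len (v \<otimes> r ?d) + 1 = len v" using short_of_additive[OF v h(1) q(1)] di by blast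
      have "- \<rho> (q \<otimes> h) ?d \<in> \<Phi>" using q(1) h(1) simple_pos by (simp add: simple_act_self)
      then have "depth ?d \<le> len (q \<otimes> h)" using q h by (intro depth_le) auto
      also have "\<dots> \<le> 1 + len h" using len_mult_le[of q h] len_simple_le[OF q(1)] q h by simp
      finally have dpd: "depth ?d < depth \<gamma>" using hl y(3) sz(4) by simp
      then have dg: "?d \<noteq> \<gamma>" by auto
      let ?s = "- \<rho> (r \<gamma>) \<sigma>"
      note sr = zr[OF sz']
      have s1: "?s \<in> invs (r \<gamma>)" using invs_r_pair(2)[OF gp(1) sr] .
      have s2: "?s \<in> invs v" using pair_inverted[OF v gp sr vs] s1 by (simp add: invs_def)
      have s3: "?s \<noteq> \<gamma>"
      proof
        assume "?s = \<gamma>"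
        then have "\<rho> (r \<gamma>) \<sigma> = \<rho> (r \<gamma>) \<gamma>" using r_act_self[OF rg] by (metis minus_minus)
        then show False using sz' gz rg by simp
      qed
      \<comment> \<open>\<open>short_sbase\<close> needs a second inversion of \<open>v\<close>.
        \<sigma> is none, but its partner \<open>?s\<close> is, and it lies in the same
        plane.\<close>
      define V where "V = span {\<rho> v \<gamma>, \<rho> v ?s}"
      have bS: "- \<rho> v \<gamma> \<in> sbase V" using short_sbase[OF v g l s1 s2 s3 V_def] .
      have V2: "V = span {\<rho> v ?d, \<rho> v ?d'}"
      proof -
        let ?X = "span {\<rho> v ?d1, \<rho> v ?d2}"
        have i1: "\<rho> v \<gamma> \<in> ?X" "\<rho> v \<sigma> \<in> ?X" using vg vs' in_span_pair by blast+
        have "\<rho> v ?s = (2 * B \<sigma> \<gamma>) *\<^sub>R \<rho> v \<gamma> - \<rho> v \<sigma>" unfolding invs_r_pair(3)[OF gp(1) sr] using v by (simp add: act_lin)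
        then have i2: "\<rho> v ?s \<in> ?X" using i1 by (simp add: span_diff span_scale)
        have "\<rho> v ?s \<notin> span {\<rho> v \<gamma>}"
        proof
          assume "\<rho> v ?s \<in> span {\<rho> v \<gamma>}"
          then obtain k where k: "\<rho> v ?s = k *\<^sub>R \<rho> v \<gamma>" by (auto simp: span_singleton)
          then have "- \<rho> v ?s = k *\<^sub>R (- \<rho> v \<gamma>)" by simp
          then have "- \<rho> v ?s = - \<rho> v \<gamma>" using unit_multiple[OF _ gp(2)] s2 by (simp add: invs_def)
          then show False using s3 v by simp
        qed
        moreover have "\<rho> v \<gamma> \<noteq> 0" using root_nz v rg by simp
        ultimately have "?X = V" unfolding V_def using span_pair_eq[OF i1(1) i2] by blast
        then show ?thesis using q(9) by simp
      qed
      have inV: "\<rho> v ?d \<in> V" "\<rho> v ?d' \<in> V" unfolding V2 by (auto intro: span_base)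
      have sV: "subspace V" unfolding V_def by simp
      have P1: "P1 > 0"
      proof (rule ccontr)
        assume "\<not> P1 > 0"
        then have "\<gamma> = Q1 *\<^sub>R ?d'" using q by simp
        then have "\<gamma> = ?d'" using unit_multiple gp q by blast
        then show False using q gp not_pos_neg by metis
      qed
      have "- \<rho> v ?d \<notin> sbase V"
      proof (rule not_sbase_comb)
        show "- \<rho> v \<gamma> \<in> \<Phi>" "\<rho> v ?d' \<in> \<Phi>" using gp q by auto
        show "- \<rho> v \<gamma> \<in> V" "\<rho> v ?d' \<in> V" using inV sbaseD(2)[OF bS] by auto
        show "- \<rho> v \<gamma> \<noteq> - \<rho> v ?d" using dg v by simp
        show "\<rho> v ?d' \<noteq> - \<rho> v ?d"
        proof
          assume "\<rho> v ?d' = - \<rho> v ?d"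
          then have "\<rho> v ?d' = \<rho> v (- ?d)" using v by (simp add: act_lin)
          then have "?d' = - ?d" using v by simp
          then show False using q(2,3) not_pos_neg by metis
        qed
        show "P1 *\<^sub>R (- \<rho> v ?d) = 1 *\<^sub>R (- \<rho> v \<gamma>) + Q1 *\<^sub>R \<rho> v ?d'"
          using arg_cong[OF q(8), of "\<rho> v"] v by (simp add: act_lin)
      qed (use P1 q in auto)
      then have "nonsmall (- \<rho> v ?d)" using bipodal_plane[OF V_def bS q(4) _ _ ns] inV sV subspace_neg by blast
      then show ?thesis using less.hyps[OF dpd di dl] by blast
    qed
  qed
qed

section \<open>Chambers\<close>

lemma inversions_iff: "w \<in> carrier W \<Longrightarrow> x \<in> inversions w \<longleftrightarrow> x \<in> invs (inv w)"
proof -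
  assume w: "w \<in> carrier W"
  have "x \<in> \<rho> w ` neg_roots \<longleftrightarrow> \<rho> (inv w) x \<in> neg_roots" using w by (force intro: rev_image_eqI)
  then show ?thesis by (simp add: inversions_def invs_def mem_neg)
qed

lemma dom_le_iff:
  assumes "x \<in> \<Phi>" "y \<in> \<Phi>" shows "dom_le x y \<longleftrightarrow> dom x y"
proof -
  have "dom_le x y \<longleftrightarrow> (\<forall>w \<in> carrier W. - \<rho> (inv w) y \<in> \<Phi> \<longrightarrow> - \<rho> (inv w) x \<in> \<Phi>)"
    unfolding dom_le_def using assms by (simp add: inversions_iff invs_def)
  then show ?thesis unfolding dom_def by (metis inv_closed inv_inv)
qed

lemma small_iff: "x \<in> small_roots \<longleftrightarrow> x \<in> \<Phi> \<and> \<not> nonsmall x"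
proof (cases "x \<in> \<Phi>")
  case True
  have "dp_inf x = 0 \<longleftrightarrow> {y \<in> \<Phi> - {x}. dom_le y x} = {}"
    unfolding dp_inf_def by (auto simp: Let_def zero_enat_def dest: not_finite_existsD)
  then show ?thesis using True by (auto simp: small_roots_def nonsmall_def dom_le_iff)
qed (simp add: small_roots_def)

text \<open>Passes from left reflections to right ones. That \<gamma> is positive uses the length:
  otherwise \<open>refl_shortens\<close>, applied to \<open>v \<otimes> r \<gamma>\<close>, would
  make \<open>v\<close> the shorter of the two.\<close>

lemma short_inversions_iff:
  assumes v: "v \<in> carrier W"
  shows "x \<in> short_inversions v \<longleftrightarrow> (\<exists>\<gamma> \<in> invs v. x = - \<rho> v \<gamma> \<and> len (v \<otimes> r \<gamma>) + 1 = len v)"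
proof -
  have e: "r (- \<rho> v \<gamma>) \<otimes> v = v \<otimes> r \<gamma>" if "\<gamma> \<in> roots" for \<gamma>
    using that v by (simp add: r_neg r_conj m_assoc)
  show ?thesis
  proof
    assume "x \<in> short_inversions v"
    then have x: "x \<in> \<Phi>" "len (r x \<otimes> v) + 1 = len v" by (auto simp: short_inversions_def)
    define \<gamma> where "\<gamma> = - \<rho> (inv v) x"
    have xg: "x = - \<rho> v \<gamma>" using v by (simp add: \<gamma>_def act_lin)
    have gr: "\<gamma> \<in> roots" using x v pos_root by (simp add: \<gamma>_def)
    have l: "len (v \<otimes> r \<gamma>) + 1 = len v" using e[OF gr] x(2) xg by simp
    have "\<gamma> \<in> \<Phi>"
    proof (rule ccontr)
      assume "\<gamma> \<notin> \<Phi>"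
      then have m: "- \<gamma> \<in> \<Phi>" using neg_iff gr by blast
      let ?u = "v \<otimes> r \<gamma>"
      have "\<rho> ?u (- \<gamma>) = - x" using v gr by (simp add: act_lin r_act_self xg)
      then have "- \<gamma> \<in> invs ?u" using m x(1) by (simp add: invs_def)
      then have "len (?u \<otimes> r (- \<gamma>)) < len ?u" using v gr by (intro refl_shortens) auto
      moreover have "?u \<otimes> r (- \<gamma>) = v" using v gr by (simp add: r_neg m_assoc r_sq)
      ultimately show False using l by simp
    qed
    then show "\<exists>\<gamma> \<in> invs v. x = - \<rho> v \<gamma> \<and> len (v \<otimes> r \<gamma>) + 1 = len v"
      using xg l x(1) by (auto simp: invs_def)
  next
    assume "\<exists>\<gamma> \<in> invs v. x = - \<rho> v \<gamma> \<and> len (v \<otimes> r \<gamma>) + 1 = len v"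
    then obtain \<gamma> where "\<gamma> \<in> invs v" "x = - \<rho> v \<gamma>" "len (v \<otimes> r \<gamma>) + 1 = len v" by blast
    then show "x \<in> short_inversions v" using e[of \<gamma>] pos_root by (simp add: short_inversions_def invs_def)
  qed
qed

lemma low_iff:
  assumes v: "v \<in> carrier W"
  shows "v \<in> low_elements \<longleftrightarrow> (\<forall>s \<in> S. - \<rho> v (\<alpha> s) \<in> \<Phi> \<longrightarrow> \<not> nonsmall (- \<rho> v (\<alpha> s)))"
proof
  assume low: "v \<in> low_elements"
  show "\<forall>s \<in> S. - \<rho> v (\<alpha> s) \<in> \<Phi> \<longrightarrow> \<not> nonsmall (- \<rho> v (\<alpha> s))"
  proof (intro ballI impI)
    fix s assume s: "s \<in> S" and n: "- \<rho> v (\<alpha> s) \<in> \<Phi>"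
    have "\<alpha> s \<in> invs v" using s n simple_pos by (simp add: invs_def)
    moreover have "len (v \<otimes> r (\<alpha> s)) + 1 = len v" using len_mult_simple_neg[OF v s n] s by (simp add: r_simple)
    ultimately have "- \<rho> v (\<alpha> s) \<in> short_inversions v"
      unfolding short_inversions_iff[OF v] by (intro bexI[of _ "\<alpha> s"]) simp_all
    then show "\<not> nonsmall (- \<rho> v (\<alpha> s))" using low by (auto simp: low_elements_def small_iff)
  qed
next
  assume a: "\<forall>s \<in> S. - \<rho> v (\<alpha> s) \<in> \<Phi> \<longrightarrow> \<not> nonsmall (- \<rho> v (\<alpha> s))"
  have "x \<in> small_roots" if x: "x \<in> short_inversions v" for x
  proof -
    obtain \<gamma> where g: "\<gamma> \<in> invs v" "x = - \<rho> v \<gamma>" "len (v \<otimes> r \<gamma>) + 1 = len v"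
      using x short_inversions_iff[OF v] by metis
    have "\<not> nonsmall x" unfolding g(2) using short_nonsmall_descent[OF v g(1,3)] a by blast
    then show ?thesis using g by (simp add: small_iff invs_def)
  qed
  then show "v \<in> low_elements" using v by (auto simp: low_elements_def)
qed

section \<open>Functionals in chambers and the half-spaces\<close>

lemma chamber_iff:
  assumes "w \<in> carrier W"
  shows "f \<in> chamber w \<longleftrightarrow> linear f \<and> (\<forall>s \<in> S. f (\<rho> w (\<alpha> s)) \<ge> 0)"
proof
  assume "f \<in> chamber w"
  then obtain h where h: "linear h" "\<And>s. s \<in> S \<Longrightarrow> h (\<alpha> s) \<ge> 0" "f = (\<lambda>v. h (\<rho> (inv w) v))"
    by (auto simp: chamber_def fund_chamber_def dual_act_def)
  have "linear f" unfolding h(3) using linear_compose[OF act_linear[of "inv w"] h(1)] assms by (simp add: o_def)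
  then show "linear f \<and> (\<forall>s \<in> S. f (\<rho> w (\<alpha> s)) \<ge> 0)" using h assms by simp
next
  assume f: "linear f \<and> (\<forall>s \<in> S. f (\<rho> w (\<alpha> s)) \<ge> 0)"
  let ?h = "\<lambda>v. f (\<rho> w v)"
  have "linear ?h" using linear_compose[OF act_linear[OF assms] f[THEN conjunct1]] by (simp add: o_def)
  then have "?h \<in> fund_chamber" using f by (simp add: fund_chamber_def)
  moreover have "f = dual_act w ?h" using assms by (simp add: dual_act_def fun_eq_iff)
  ultimately show "f \<in> chamber w" unfolding chamber_def by blast
qed

lemma chamber_nonneg:
  assumes "w \<in> carrier W" "f \<in> chamber w" "x \<in> K" shows "f (\<rho> w x) \<ge> 0"
proof -
  have f: "linear f" "\<And>s. s \<in> S \<Longrightarrow> f (\<rho> w (\<alpha> s)) \<ge> 0" using chamber_iff[OF assms(1)] assms(2) by auto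
  have "K \<subseteq> {x. f (\<rho> w x) \<ge> 0}"
    by (intro hull_minimal convex_coneI)
      (use f assms(1) in \<open>auto simp: act_lin linear_add linear_scale linear_0\<close>)
  then show ?thesis using assms(3) by blast
qed

lemma pos_half_space_nonneg:
  assumes "f \<in> pos_half_space x" shows "f x \<ge> 0"
proof -
  obtain w where w: "w \<in> carrier W" "\<rho> (inv w) x \<in> \<Phi>" "f \<in> chamber w" using assms by (auto simp: pos_half_space_def)
  then show ?thesis using chamber_nonneg[OF w(1,3) pos_K[OF w(2)]] by simp
qed

lemma low_chambers_eq:
  defines "\<Gamma> \<equiv> {\<gamma> \<in> \<Phi>. \<exists>s \<in> S. dom (\<alpha> s) \<gamma> \<and> \<gamma> \<noteq> \<alpha> s}"
  shows "(\<Union>w \<in> {w \<in> carrier W. inv w \<in> low_elements}. chamber w) = half_space_inter \<Gamma> (\<lambda>_. Plus)"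
proof (intro equalityI subsetI)
  fix f assume "f \<in> (\<Union>w \<in> {w \<in> carrier W. inv w \<in> low_elements}. chamber w)"
  then obtain w where w: "w \<in> carrier W" "inv w \<in> low_elements" "f \<in> chamber w" by blast
  have "f \<in> pos_half_space \<gamma>" if g: "\<gamma> \<in> \<Gamma>" for \<gamma>
  proof -
    obtain s where s: "\<gamma> \<in> \<Phi>" "s \<in> S" "dom (\<alpha> s) \<gamma>" "\<gamma> \<noteq> \<alpha> s" using g by (auto simp: \<Gamma>_def)
    have "\<rho> (inv w) \<gamma> \<in> \<Phi>"
    proof (rule ccontr)
      assume "\<rho> (inv w) \<gamma> \<notin> \<Phi>"
      then have n: "- \<rho> (inv w) \<gamma> \<in> \<Phi>" using neg_iff[of "\<rho> (inv w) \<gamma>"] w(1) s(1) pos_root by simp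
      have ns: "- \<rho> (inv w) (\<alpha> s) \<in> \<Phi>" using domD[OF s(3) _ n] w(1) by simp
      have "dom (- \<rho> (inv w) \<gamma>) (- \<rho> (inv w) (\<alpha> s))"
        using dom_neg[OF dom_act[OF _ s(3), of "inv w"]] w(1) s(1,2) simple_root pos_root by simp
      moreover have "- \<rho> (inv w) \<gamma> \<noteq> - \<rho> (inv w) (\<alpha> s)" using s(4) w(1) by simp
      ultimately have "nonsmall (- \<rho> (inv w) (\<alpha> s))" using n unfolding nonsmall_def by blast
      then show False using low_iff[of "inv w"] w ns s(2) by simp
    qed
    then show ?thesis using w by (auto simp: pos_half_space_def)
  qed
  then show "f \<in> half_space_inter \<Gamma> (\<lambda>_. Plus)"
    using w by (auto simp: half_space_inter_def half_space_def tits_cone_def)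
next
  fix f assume f: "f \<in> half_space_inter \<Gamma> (\<lambda>_. Plus)"
  then have "\<exists>w. w \<in> carrier W \<and> f \<in> chamber w" by (auto simp: half_space_inter_def tits_cone_def)
  then obtain w where w: "w \<in> carrier W" "f \<in> chamber w"
    and min: "\<And>u. u \<in> carrier W \<Longrightarrow> f \<in> chamber u \<Longrightarrow> len w \<le> len u"
    using exists_least_iff[of "\<lambda>n. \<exists>w. w \<in> carrier W \<and> f \<in> chamber w \<and> len w = n"] by (metis not_less)
  have lf: "linear f" using w chamber_iff by blast
  have "inv w \<in> low_elements"
  proof (rule ccontr)
    assume "inv w \<notin> low_elements"
    then obtain s where s: "s \<in> S" "- \<rho> (inv w) (\<alpha> s) \<in> \<Phi>" "nonsmall (- \<rho> (inv w) (\<alpha> s))"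
      using low_iff[of "inv w"] w(1) by auto
    then obtain \<theta> where t: "\<theta> \<in> \<Phi>" "\<theta> \<noteq> - \<rho> (inv w) (\<alpha> s)" "dom \<theta> (- \<rho> (inv w) (\<alpha> s))"
      unfolding nonsmall_def by blast
    define \<gamma> where "\<gamma> = - \<rho> w \<theta>"
    have d: "dom (\<alpha> s) \<gamma>"
      using dom_neg[OF dom_act[OF w(1) t(3)]] w(1) s(1) t(1) pos_root simple_root by (simp add: act_lin \<gamma>_def)
    have "- \<rho> (inv w) \<gamma> = \<theta>" using w(1) by (simp add: act_lin \<gamma>_def)
    \<comment> \<open>If \<gamma> were negative, dominance taken at the identity would make
      \<open>\<alpha> s\<close> negative.\<close>
    moreover have "\<gamma> \<in> \<Phi>"
    proof (rule ccontr)
      assume n: "\<gamma> \<notin> \<Phi>"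
      have "\<gamma> \<in> roots" using t(1) w(1) pos_root by (simp add: \<gamma>_def)
      then have "- \<rho> \<one> \<gamma> \<in> \<Phi>" using n neg_iff by simp
      then show False using domD[OF d one_closed] simple_pos[OF s(1)] not_pos_neg by simp
    qed
    moreover have "\<gamma> \<noteq> \<alpha> s" using t(2) calculation(1) by auto
    ultimately have g: "\<gamma> \<in> \<Gamma>" "\<gamma> \<in> \<Phi>" using d s(1) by (auto simp: \<Gamma>_def)
    \<comment> \<open>The half-space and the chamber bound the value at \<gamma> from opposite
      sides, so it is zero.\<close>
    have "f \<gamma> \<ge> 0" using f g(1) by (intro pos_half_space_nonneg) (auto simp: half_space_inter_def half_space_def)
    moreover have "f \<gamma> = - f (\<rho> w \<theta>)" unfolding \<gamma>_def using lf by (rule linear_neg)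
    moreover have "f (\<rho> w \<theta>) \<ge> 0" using chamber_nonneg[OF w pos_K[OF t(1)]] .
    ultimately have z: "f (\<rho> w \<theta>) = 0" by simp
    have lin: "linear (\<lambda>x. f (\<rho> w x))" using linear_compose[OF act_linear[OF w(1)] lf] by (simp add: o_def)
    have "\<theta> \<in> convex_cone hull {a \<in> \<alpha> ` S. f (\<rho> w a) = 0}"
      using w chamber_iff by (intro cone_hull_face[OF lin pos_K[OF t(1)] _ z]) auto
    moreover have "convex_cone hull {a \<in> \<alpha> ` S. f (\<rho> w a) = 0} \<subseteq> {x. \<rho> w x \<in> K}"
    proof (intro hull_minimal convex_coneI)
      show "{a \<in> \<alpha> ` S. f (\<rho> w a) = 0} \<subseteq> {x. \<rho> w x \<in> K}"
      proof safe
        fix q assume q: "q \<in> S" "f (\<rho> w (\<alpha> q)) = 0"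
        \<comment> \<open>As \<open>f\<close> vanishes at \<open>\<rho> w (\<alpha> q)\<close>, it
          also lies in the adjacent chamber of \<open>w \<otimes> q\<close>. Minimal length of
          \<open>w\<close> then makes \<open>\<rho> w (\<alpha> q)\<close> positive.\<close>
        have "f (\<rho> (w \<otimes> q) (\<alpha> p)) = f (\<rho> w (\<alpha> p))" for p
          using q w(1) lf by (simp add: simple_act act_lin linear_diff linear_scale)
        then have "f \<in> chamber (w \<otimes> q)" using w q by (simp add: chamber_iff)
        then have "len w \<le> len (w \<otimes> q)" using min w q by simp
        then have "- \<rho> w (\<alpha> q) \<notin> \<Phi>" using len_mult_simple_neg[OF w(1) q(1)] by auto
        then show "\<rho> w (\<alpha> q) \<in> K" using neg_iff[of "\<rho> w (\<alpha> q)"] w(1) q(1) simple_root pos_K by simp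
      qed
    qed (use w(1) K_0 K_add K_scale in \<open>auto simp: act_lin\<close>)
    ultimately have "- \<gamma> \<in> K" by (auto simp: \<gamma>_def)
    then show False using pos_not_neg_K g(2) by blast
  qed
  then show "f \<in> (\<Union>w \<in> {w \<in> carrier W. inv w \<in> low_elements}. chamber w)" using w by blast
qed

end

theorem theorem1p2:
  fixes W :: "('g, 'm) monoid_scheme"
    and S :: "'g set"
    and \<rho> :: "'g \<Rightarrow> 'v::real_vector \<Rightarrow> 'v"
    and B :: "'v \<Rightarrow> 'v \<Rightarrow> real"
    and \<alpha> :: "'g \<Rightarrow> 'v"
    and X :: "('v \<Rightarrow> real) set"
  assumes "geometric_representation W S \<rho> B \<alpha>"
    and "X = (\<Union>w \<in> {w \<in> carrier W. inv\<^bsub>W\<^esub> w \<in> geometric_data.low_elements W S \<rho> B \<alpha>}.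
                geometric_data.chamber W S \<rho> \<alpha> w)"
  shows "geometric_data.tits_convex W S \<rho> \<alpha> X \<and>
    (\<exists>\<Gamma> \<epsilon>. \<Gamma> \<subseteq> geometric_data.pos_roots W S \<rho> \<alpha> \<and>
      X = geometric_data.half_space_inter W S \<rho> \<alpha> \<Gamma> \<epsilon>)"
proof -
  interpret geometric_representation W S \<rho> B \<alpha> by (rule assms(1))
  let ?\<Gamma> = "{\<gamma> \<in> pos_roots. \<exists>s \<in> S. dom (\<alpha> s) \<gamma> \<and> \<gamma> \<noteq> \<alpha> s}"
  have X: "X = half_space_inter ?\<Gamma> (\<lambda>_. Plus)" unfolding assms(2) by (rule low_chambers_eq)
  have "?\<Gamma> \<subseteq> pos_roots" by (rule Collect_restrict)
  moreover have "?\<Gamma> \<subseteq> roots" using pos_root by (auto simp only: mem_Collect_eq)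
  ultimately show ?thesis unfolding tits_convex_def using X by (intro conjI exI[of _ ?\<Gamma>] exI[of _ "\<lambda>_. Plus"])
qed

end
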